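(* Let $\gamma^\star\in C^\delta_{per}$ (not necessarily positive) and assume (A1) and (A2) hold. Then there exists at least one pair $(I^\star,R^\star)\in (C^\delta_{per})^2$ of strictly positive periodic functions solving $$-d\Delta I-\gamma^\star I+\alpha I^2+\alpha IR=0,\qquad -d\Delta R+\lambda R-\mu I=0,\qquad x\in\mathbb{R}^N.$$
   Context: Fix $N\ge1$, $d>0$, $\delta\in(0,1)$. $C^\delta_{per}$ denotes the set of $\delta$-Hölder continuous functions on $\mathbb{R}^N$ that are $1$-periodic in each coordinate. $\alpha,\mu,\lambda\in C^\delta_{per}$ are strictly positive. For $c\in C^\delta_{per}$, $\lambda_1(-d\Delta-c)$ is the principal periodic eigenvalue (the unique real number admitting a positive periodic eigenfunction $\phi$, $-d\Delta\phi-c\phi=\lambda_1\phi$). $\overline I$ is the largest bounded non-negative (periodic) solution of $-d\Delta\overline I=\gamma^\star\overline I-\alpha\overline I^2$, and $\overline R$ is the periodic solution of $-d\Delta\overline R+\lambda\overline R=\mu\overline I$. (A1): $\lambda_1(-d\Delta-\gamma^\star)<0$. (A2): $\lambda_1(-d\Delta-(\gamma^\star-\alpha\overline R))<0$. *)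

theory Defs
  imports "HOL-Analysis.Analysis"
begin

definition periodic1 :: "(real^'n \<Rightarrow> real) \<Rightarrow> bool" where
  "periodic1 u \<longleftrightarrow> (\<forall>x i. u (x + axis i 1) = u x)"

definition holder :: "real \<Rightarrow> (real^'n \<Rightarrow> real) \<Rightarrow> bool" where
  "holder \<delta> u \<longleftrightarrow> (\<exists>C. \<forall>x y. \<bar>u x - u y\<bar> \<le> C * dist x y powr \<delta>)"

definition Cper :: "real \<Rightarrow> (real^'n \<Rightarrow> real) set" where
  "Cper \<delta> = {u. holder \<delta> u \<and> periodic1 u}"

definition C2 :: "(real^'n \<Rightarrow> real) \<Rightarrow> bool" where
  "C2 u \<longleftrightarrow> (\<exists>D D2. (\<forall>x. (u has_derivative blinfun_apply (D x)) (at x)) \<and>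
      (\<forall>x. (D has_derivative blinfun_apply (D2 x)) (at x)) \<and> continuous_on UNIV D2)"

definition lap :: "(real^'n \<Rightarrow> real) \<Rightarrow> real^'n \<Rightarrow> real" where
  "lap u x = (\<Sum>i\<in>UNIV. deriv (deriv (\<lambda>t. u (x + t *\<^sub>R axis i 1))) 0)"

definition princ_eig :: "real \<Rightarrow> (real^'n \<Rightarrow> real) \<Rightarrow> real" where
  "princ_eig d c = (THE l. \<exists>\<phi>. C2 \<phi> \<and> periodic1 \<phi> \<and> (\<forall>x. \<phi> x > 0) \<and>
      (\<forall>x. - d * lap \<phi> x - c x * \<phi> x = l * \<phi> x))"

definition bdd_nonneg_sol :: "real \<Rightarrow> (real^'n \<Rightarrow> real) \<Rightarrow> (real^'n \<Rightarrow> real)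
    \<Rightarrow> (real^'n \<Rightarrow> real) \<Rightarrow> bool" where
  "bdd_nonneg_sol d g a I \<longleftrightarrow> C2 I \<and> bounded (range I) \<and> (\<forall>x. I x \<ge> 0) \<and>
      (\<forall>x. - d * lap I x = g x * I x - a x * (I x)^2)"

definition Ibar :: "real \<Rightarrow> (real^'n \<Rightarrow> real) \<Rightarrow> (real^'n \<Rightarrow> real) \<Rightarrow> (real^'n \<Rightarrow> real)" where
  "Ibar d g a = (THE I. bdd_nonneg_sol d g a I \<and>
      (\<forall>J. bdd_nonneg_sol d g a J \<longrightarrow> (\<forall>x. J x \<le> I x)))"

definition Rbar :: "real \<Rightarrow> (real^'n \<Rightarrow> real) \<Rightarrow> (real^'n \<Rightarrow> real) \<Rightarrow> (real^'n \<Rightarrow> real)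
    \<Rightarrow> (real^'n \<Rightarrow> real) \<Rightarrow> (real^'n \<Rightarrow> real)" where
  "Rbar d g a lam mu = (THE R. C2 R \<and> periodic1 R \<and>
      (\<forall>x. - d * lap R x + lam x * R x = mu x * Ibar d g a x))"

end

theory Submission
  imports Defs "HOL-Complex_Analysis.Great_Picard"
begin

text \<open>
  If \<open>\<phi>\<close> is the principal eigenfunction for the potential \<open>\<gamma> - \<alpha> Rbar\<close>, then \<open>\<epsilon> \<phi>\<close> and \<open>Ibar\<close> are
  ordered barriers for the nonlocal logistic equation obtained by inserting the solution \<open>R = K I\<close>
  of the second equation into the first.  The map
  \<open>I \<mapsto> (\<Lambda> - d \<Delta>)^-1 ((\<Lambda> + \<gamma> - \<alpha> I - \<alpha> K I) I)\<close> preserves the order interval between them, and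
  a Schauder-type fixed point is the desired solution.

  The linear theory rests on the maximum principle alone.  For trigonometric polynomials the
  resolvent \<open>J s = (1 - s \<Delta>)^-1\<close> is explicit; comparing \<open>u (x + h e) - u (x - h e)\<close> with a concave
  function of \<open>h\<close> bounds the gradient of \<open>J s f\<close> by \<open>s^(-1/2)\<close> times the oscillation of \<open>f\<close>
  at scale \<open>s^(1/2)\<close>.  By the resolvent identity \<open>J s' - J s = (s - s') \<Delta> J s J s'\<close> the second
  derivatives along the scales \<open>s = 4^-n\<close> then converge geometrically when \<open>f\<close> is Hoelder
  continuous, so the resolvent maps Hoelder functions to \<open>C2\<close> functions.
\<close>

section \<open>Derivatives along the axes and the maximum principle\<close>

abbreviation ray :: "'n \<Rightarrow> real \<Rightarrow> real^'n" where
  "ray i t \<equiv> t *\<^sub>R axis i 1"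

definition axis_derivs ::
    "(real^'n \<Rightarrow> real) \<Rightarrow> ('n \<Rightarrow> real^'n \<Rightarrow> real) \<Rightarrow> ('n \<Rightarrow> real^'n \<Rightarrow> real) \<Rightarrow> bool" where
  "axis_derivs u p q \<longleftrightarrow> (\<forall>x i.
      ((\<lambda>t. u (x + ray i t)) has_real_derivative p i x) (at 0) \<and>
      ((\<lambda>t. p i (x + ray i t)) has_real_derivative q i x) (at 0))"

definition axis_diff2 :: "(real^'n \<Rightarrow> real) \<Rightarrow> bool" where
  "axis_diff2 u \<longleftrightarrow> (\<exists>p q. axis_derivs u p q)"

lemma deriv_along_axis:
  assumes "\<And>x. ((\<lambda>t. u (x + ray i t)) has_real_derivative p x) (at 0)"
  shows "((\<lambda>t. u (x + ray i t)) has_real_derivative p (x + ray i t)) (at t)"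
proof -
  have "((\<lambda>s. u ((x + ray i t) + ray i s)) has_real_derivative p (x + ray i t)) (at 0)"
    by (rule assms)
  moreover have "(\<lambda>s. u ((x + ray i t) + ray i s)) = (\<lambda>s. u (x + (s + t) *\<^sub>R axis i 1))"
    by (auto simp: algebra_simps)
  ultimately show ?thesis
    using DERIV_shift[of "\<lambda>t. u (x + ray i t)" _ 0 t] by simp
qed

lemma axis_derivs_first:
  "axis_derivs u p q \<Longrightarrow>
    ((\<lambda>t. u (x + ray i t)) has_real_derivative p i (x + ray i t)) (at t)"
  by (rule deriv_along_axis) (auto simp: axis_derivs_def)

lemma axis_derivs_second:
  "axis_derivs u p q \<Longrightarrow>
    ((\<lambda>t. p i (x + ray i t)) has_real_derivative q i (x + ray i t)) (at t)"
  by (rule deriv_along_axis) (auto simp: axis_derivs_def)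

lemma axis_derivs_lap:
  assumes "axis_derivs u p q"
  shows "lap u x = (\<Sum>i\<in>UNIV. q i x)"
proof -
  have "deriv (\<lambda>t. u (x + ray i t)) = (\<lambda>t. p i (x + ray i t))" for i
    using axis_derivs_first[OF assms] by (auto intro!: ext DERIV_imp_deriv)
  then show ?thesis
    unfolding lap_def using axis_derivs_second[OF assms, where t=0]
    by (auto intro!: sum.cong DERIV_imp_deriv)
qed

lemma axis_derivs_add:
  "axis_derivs u p q \<Longrightarrow> axis_derivs v p' q' \<Longrightarrow>
    axis_derivs (\<lambda>x. u x + v x) (\<lambda>i x. p i x + p' i x) (\<lambda>i x. q i x + q' i x)"
  unfolding axis_derivs_def by (auto intro!: DERIV_add)

lemma axis_derivs_cmult:
  "axis_derivs u p q \<Longrightarrow> axis_derivs (\<lambda>x. c * u x) (\<lambda>i x. c * p i x) (\<lambda>i x. c * q i x)"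
  unfolding axis_derivs_def by (auto intro!: DERIV_cmult)

lemma axis_derivs_const: "axis_derivs (\<lambda>x. c) (\<lambda>i x. 0) (\<lambda>i x. 0)"
  unfolding axis_derivs_def by auto

lemma axis_derivs_translate:
  assumes "axis_derivs u p q"
  shows "axis_derivs (\<lambda>x. u (x + y)) (\<lambda>i x. p i (x + y)) (\<lambda>i x. q i (x + y))"
proof -
  have [simp]: "(x + ray i t) + y = (x + y) + ray i t" for x :: "real^'a" and t i
    by simp
  show ?thesis using assms unfolding axis_derivs_def by simp
qed

lemma axis_diff2_add: "axis_diff2 u \<Longrightarrow> axis_diff2 v \<Longrightarrow> axis_diff2 (\<lambda>x. u x + v x)"
  unfolding axis_diff2_def using axis_derivs_add by blast

lemma axis_diff2_cmult: "axis_diff2 u \<Longrightarrow> axis_diff2 (\<lambda>x. c * u x)"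
  unfolding axis_diff2_def using axis_derivs_cmult by blast

lemma axis_diff2_const: "axis_diff2 (\<lambda>x. c)"
  unfolding axis_diff2_def using axis_derivs_const by blast

lemma axis_diff2_diff: "axis_diff2 u \<Longrightarrow> axis_diff2 v \<Longrightarrow> axis_diff2 (\<lambda>x. u x - v x)"
  using axis_diff2_add[of u "\<lambda>x. (-1) * v x"] axis_diff2_cmult[of v "-1"] by simp

lemma axis_diff2_translate: "axis_diff2 u \<Longrightarrow> axis_diff2 (\<lambda>x. u (x + y))"
  unfolding axis_diff2_def using axis_derivs_translate by blast

lemma lap_add:
  "axis_diff2 u \<Longrightarrow> axis_diff2 v \<Longrightarrow> lap (\<lambda>x. u x + v x) x = lap u x + lap v x"
  unfolding axis_diff2_def
  by (auto simp: axis_derivs_lap[OF axis_derivs_add] axis_derivs_lap sum.distrib)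

lemma lap_cmult: "axis_diff2 u \<Longrightarrow> lap (\<lambda>x. c * u x) x = c * lap u x"
  unfolding axis_diff2_def
  by (auto simp: axis_derivs_lap[OF axis_derivs_cmult] axis_derivs_lap sum_distrib_left)

lemma lap_const: "lap (\<lambda>x. c) x = 0"
  by (simp add: axis_derivs_lap[OF axis_derivs_const])

lemma lap_diff:
  "axis_diff2 u \<Longrightarrow> axis_diff2 v \<Longrightarrow> lap (\<lambda>x. u x - v x) x = lap u x - lap v x"
  using lap_add[of u "\<lambda>x. (-1) * v x" x] axis_diff2_cmult[of v "-1"] lap_cmult[of v "-1"] by simp

lemma lap_translate: "axis_diff2 u \<Longrightarrow> lap (\<lambda>x. u (x + y)) x = lap u (x + y)"
  unfolding axis_diff2_def
  by (auto simp: axis_derivs_lap[OF axis_derivs_translate] axis_derivs_lap)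

lemma has_derivative_along_axis:
  fixes u :: "real^'n \<Rightarrow> 'b::real_normed_vector"
  assumes "(u has_derivative D) (at x)"
  shows "((\<lambda>t. u (x + ray i t)) has_vector_derivative D (axis i 1)) (at 0)"
proof -
  have l: "linear D" using assms has_derivative_linear by blast
  have "((\<lambda>t::real. x + ray i t) has_derivative (\<lambda>t. t *\<^sub>R axis i 1)) (at 0)"
    by (auto intro!: derivative_eq_intros)
  from has_derivative_compose[OF this, of u D] assms
  have "((\<lambda>t. u (x + ray i t)) has_derivative (\<lambda>t. D (t *\<^sub>R axis i 1))) (at 0)"
    by (simp add: o_def)
  then show ?thesis
    by (simp add: has_vector_derivative_def linear_scale[OF l])
qed

lemma C2_axis_derivs:
  assumes "C2 u"
  obtains p q where "axis_derivs u p q" "\<And>i. continuous_on UNIV (q i)"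
proof -
  obtain D D2 where D: "\<And>x. (u has_derivative blinfun_apply (D x)) (at x)"
    and D2: "\<And>x. (D has_derivative blinfun_apply (D2 x)) (at x)" and c: "continuous_on UNIV D2"
    using assms unfolding C2_def by blast
  have 1: "((\<lambda>t. u (x + ray i t)) has_real_derivative D x (axis i 1)) (at 0)" for x i
    using has_derivative_along_axis[OF D] by (simp add: has_real_derivative_iff_has_vector_derivative)
  have "((\<lambda>x. blinfun_apply (D x) (axis i 1)) has_derivative (\<lambda>h. blinfun_apply (D2 x h) (axis i 1))) (at x)" for x i
    using bounded_linear.has_derivative[OF blinfun.bounded_linear_left D2] .
  from has_derivative_along_axis[OF this]
  have 2: "((\<lambda>t. D (x + ray i t) (axis i 1)) has_real_derivative D2 x (axis i 1) (axis i 1)) (at 0)" for x i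
    by (simp add: has_real_derivative_iff_has_vector_derivative)
  show ?thesis
  proof (rule that)
    show "axis_derivs u (\<lambda>i x. D x (axis i 1)) (\<lambda>i x. D2 x (axis i 1) (axis i 1))"
      unfolding axis_derivs_def using 1 2 by simp
    show "continuous_on UNIV (\<lambda>x. D2 x (axis i 1) (axis i 1))" for i
      using c by (intro continuous_intros)
  qed
qed

lemma C2_axis_diff2:
  assumes "C2 u" shows "axis_diff2 u"
  using C2_axis_derivs[OF assms] unfolding axis_diff2_def by metis

lemma C2_lap_continuous:
  assumes "C2 u" shows "continuous_on UNIV (lap u)"
proof -
  obtain p q where pq: "axis_derivs u p q" and c: "\<And>i. continuous_on UNIV (q i)"
    using C2_axis_derivs[OF assms] by blast
  have "lap u = (\<lambda>x. \<Sum>i\<in>UNIV. q i x)" using axis_derivs_lap[OF pq] by blast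
  then show ?thesis using c by (simp add: continuous_on_sum)
qed

lemma C2_continuous: "C2 u \<Longrightarrow> continuous_on UNIV u"
  unfolding C2_def
  by (metis continuous_at_imp_continuous_on has_derivative_continuous)

lemma C2_cmult:
  assumes "C2 u" shows "C2 (\<lambda>x. c * u x)"
proof -
  obtain D D2 where D: "\<And>x. (u has_derivative blinfun_apply (D x)) (at x)"
    and D2: "\<And>x. (D has_derivative blinfun_apply (D2 x)) (at x)" and c: "continuous_on UNIV D2"
    using assms unfolding C2_def by blast
  show ?thesis unfolding C2_def
  proof (intro exI conjI allI)
    show "((\<lambda>x. c * u x) has_derivative blinfun_apply (c *\<^sub>R D x)) (at x)" for x
      using has_derivative_mult_right[OF D, of c x] by (simp add: blinfun.scaleR_left[abs_def])
    show "((\<lambda>x. c *\<^sub>R D x) has_derivative blinfun_apply (c *\<^sub>R D2 x)) (at x)" for x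
      using has_derivative_scaleR_right[OF D2, of c x] by (simp add: blinfun.scaleR_left[abs_def])
    show "continuous_on UNIV (\<lambda>x. c *\<^sub>R D2 x)" using c by (intro continuous_intros)
  qed
qed

lemma C2I:
  fixes u :: "real^'n \<Rightarrow> real"
  assumes p: "\<And>x. (u has_derivative (\<lambda>h. p x \<bullet> h)) (at x)"
    and q: "\<And>x. (p has_derivative blinfun_apply (q x)) (at x)"
    and c: "continuous_on UNIV q"
  shows "C2 u" "axis_derivs u (\<lambda>i x. p x $ i) (\<lambda>i x. q x (axis i 1) $ i)"
proof -
  define B :: "real^'n \<Rightarrow> (real^'n) \<Rightarrow>\<^sub>L real" where "B = blinfun_inner_right"
  have B: "bounded_linear B" unfolding B_def by (rule bounded_linear_blinfun_inner_right)
  show "C2 u" unfolding C2_def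
  proof (intro exI conjI allI)
    show "(u has_derivative blinfun_apply (B (p x))) (at x)" for x
      using p by (simp add: B_def)
    show "((\<lambda>x. B (p x)) has_derivative blinfun_apply (Blinfun B o\<^sub>L q x)) (at x)" for x
    proof -
      have "blinfun_apply (Blinfun B o\<^sub>L q x) = (\<lambda>h. B (q x h))"
        by (simp add: fun_eq_iff bounded_linear_Blinfun_apply[OF B])
      then show ?thesis using bounded_linear.has_derivative[OF B q] by simp
    qed
    show "continuous_on UNIV (\<lambda>x. Blinfun B o\<^sub>L q x)"
      using c by (intro continuous_intros)
  qed
  show "axis_derivs u (\<lambda>i x. p x $ i) (\<lambda>i x. q x (axis i 1) $ i)"
    unfolding axis_derivs_def
  proof (intro allI conjI)
    fix x i
    show "((\<lambda>t. u (x + ray i t)) has_real_derivative p x $ i) (at 0)"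
      using has_derivative_along_axis[OF p]
      by (simp add: has_real_derivative_iff_has_vector_derivative inner_axis)
    have "((\<lambda>x. p x $ i) has_derivative (\<lambda>h. q x h $ i)) (at x)"
      using bounded_linear.has_derivative[OF bounded_linear_vec_nth q] .
    from has_derivative_along_axis[OF this]
    show "((\<lambda>t. p (x + ray i t) $ i) has_real_derivative q x (axis i 1) $ i) (at 0)"
      by (simp add: has_real_derivative_iff_has_vector_derivative)
  qed
qed

lemma second_deriv_nonneg_at_min:
  fixes g g' :: "real \<Rightarrow> real"
  assumes e: "e > 0" and g: "\<And>t. \<bar>t - a\<bar> < e \<Longrightarrow> (g has_real_derivative g' t) (at t)"
    and q: "(g' has_real_derivative q) (at a)"
    and min: "\<And>t. \<bar>t - a\<bar> < e \<Longrightarrow> g a \<le> g t"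
  shows "q \<ge> 0"
proof (rule ccontr)
  assume "\<not> q \<ge> 0"
  then obtain d where d: "d > 0" "\<And>h. 0 < h \<Longrightarrow> h < d \<Longrightarrow> g' (a + h) < g' a"
    using DERIV_neg_dec_right[OF q] by auto
  have g0: "g' a = 0"
    using DERIV_local_min[OF g e] min e by (auto simp: abs_minus_commute)
  define h where "h = min d e / 2"
  have h: "0 < h" "h < d" "h < e" using d e by (auto simp: h_def)
  obtain z where z: "a < z" "z < a + h" "g (a + h) - g a = (a + h - a) * g' z"
    using MVT2[of a "a + h" g g'] h g by fastforce
  have "g' z < 0" using d(2)[of "z - a"] z h g0 by auto
  then have "g (a + h) < g a" using z h mult_pos_neg[of h "g' z"] by simp
  moreover have "g a \<le> g (a + h)" using min h by auto
  ultimately show False by simp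
qed

lemma max_principle:
  fixes w :: "real^'n \<Rightarrow> real"
  assumes w: "axis_diff2 w" and cont: "continuous_on UNIV w" and B: "\<And>x. w x \<ge> - B"
    and c: "c > 0" and le: "\<And>x. w x < 0 \<Longrightarrow> lap w x \<le> c * w x"
  shows "w x \<ge> 0"
proof (rule ccontr)
  assume neg: "\<not> w x \<ge> 0"
  obtain p q where pq: "axis_derivs w p q" using w unfolding axis_diff2_def by blast
  define \<eta> where "\<eta> = - w x / 2"
  have \<eta>: "\<eta> > 0" using neg by (simp add: \<eta>_def)
  define N where "N = real CARD('n)"
  have N: "N > 0" unfolding N_def by simp
  define \<epsilon> where "\<epsilon> = min (\<eta> / (1 + x \<bullet> x)) (\<eta> * c / (4 * N))"
  have \<epsilon>: "\<epsilon> > 0" using \<eta> c N by (auto simp: \<epsilon>_def intro!: divide_pos_pos add_pos_nonneg)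
  have "\<epsilon> * (x \<bullet> x) \<le> \<eta> / (1 + x \<bullet> x) * (x \<bullet> x)"
    by (rule mult_right_mono) (auto simp: \<epsilon>_def)
  also have "\<dots> \<le> \<eta>"
  proof -
    have "0 < 1 + x \<bullet> x" by (simp add: add_pos_nonneg)
    then show ?thesis using \<eta> by (simp add: field_simps)
  qed
  finally have ex: "\<epsilon> * (x \<bullet> x) \<le> \<eta>" .
  define W where "W y = w y + \<epsilon> * (y \<bullet> y)" for y
  define R where "R = norm x + B + \<bar>w x\<bar> + \<eta> + 1 + (B + 1 + \<eta>) / \<epsilon>"
  have "B \<ge> - w x" using B[of x] by simp
  then have Bpos: "B > 0" using neg by auto
  have R1: "R \<ge> 1" "R \<ge> norm x" "R \<ge> (B + 1) / \<epsilon>"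
    using Bpos \<eta> \<epsilon> by (auto simp: R_def divide_right_mono add_nonneg_nonneg intro!: add_increasing)
  have Wx: "W x \<le> - \<eta>" using ex by (simp add: W_def \<eta>_def)
  have "compact (cball (0::real^'n) R)" "cball (0::real^'n) R \<noteq> {}" using R1 by auto
  moreover have "continuous_on (cball 0 R) W" unfolding W_def
    by (intro continuous_intros continuous_on_subset[OF cont]) auto
  ultimately obtain z where z: "z \<in> cball 0 R" "\<And>y. y \<in> cball 0 R \<Longrightarrow> W z \<le> W y"
    using continuous_attains_inf[of "cball 0 R" W] by blast
  have zx: "W z \<le> W x" using z(2)[of x] R1 by simp
  have glob: "W z \<le> W y" for y
  proof (cases "norm y \<le> R")
    case False
    then have "R * R \<le> norm y * norm y" using R1 by (intro mult_mono) auto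
    moreover have "R * 1 \<le> R * R" using R1 by (intro mult_left_mono) auto
    ultimately have "R \<le> y \<bullet> y" by (simp add: power2_norm_eq_inner[symmetric] power2_eq_square)
    then have "\<epsilon> * (y \<bullet> y) \<ge> \<epsilon> * ((B + 1) / \<epsilon>)" using R1 \<epsilon> by (intro mult_left_mono) auto
    then have "W y \<ge> 1" using B[of y] \<epsilon> by (simp add: W_def)
    then show ?thesis using zx Wx \<eta> by simp
  qed (use z in auto)
  have wz: "w z \<le> - \<eta>" using zx Wx \<epsilon> by (simp add: W_def) (smt (verit) inner_ge_zero mult_nonneg_nonneg)
  have "q i z + 2 * \<epsilon> \<ge> 0" for i
  proof (rule second_deriv_nonneg_at_min[where e=1 and a=0 and g="\<lambda>t. W (z + ray i t)"
        and g'="\<lambda>t. p i (z + ray i t) + \<epsilon> * (2 * z $ i + 2 * t)"])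
    have [simp]: "(z + ray i t) \<bullet> (z + ray i t) = z \<bullet> z + 2 * t * z $ i + t\<^sup>2" for t
      by (simp add: inner_add_left inner_add_right inner_axis inner_axis' power2_eq_square algebra_simps)
    show "((\<lambda>t. W (z + ray i t)) has_real_derivative
         p i (z + ray i t) + \<epsilon> * (2 * z $ i + 2 * t)) (at t)" for t
      unfolding W_def by (auto intro!: derivative_eq_intros axis_derivs_first[OF pq])
    show "((\<lambda>t. p i (z + ray i t) + \<epsilon> * (2 * z $ i + 2 * t)) has_real_derivative q i z + 2 * \<epsilon>) (at 0)"
      using axis_derivs_second[OF pq, of i z 0] by (auto intro!: derivative_eq_intros)
  qed (use glob in auto)
  then have "0 \<le> (\<Sum>i\<in>UNIV. q i z + 2 * \<epsilon>)" by (intro sum_nonneg) auto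
  then have "0 \<le> lap w z + 2 * \<epsilon> * N"
    by (simp add: axis_derivs_lap[OF pq] sum.distrib N_def mult.commute)
  moreover have "lap w z \<le> c * w z" using le[of z] wz \<eta> by simp
  moreover have "c * w z \<le> c * (- \<eta>)" using wz c by (intro mult_left_mono) auto
  moreover have "2 * \<epsilon> * N \<le> \<eta> * c / 2"
  proof -
    have "\<epsilon> \<le> \<eta> * c / (4 * N)" by (simp add: \<epsilon>_def)
    then show ?thesis using N by (simp add: field_simps)
  qed
  moreover have "\<eta> * c > 0" using \<eta> c by simp
  ultimately show False by (simp add: algebra_simps)
qed

lemma periodic1_shift:
  fixes u :: "real^'n \<Rightarrow> real"
  assumes u: "periodic1 u" and k: "\<And>i. k $ i \<in> \<int>"
  shows "u (x + k) = u x"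
proof -
  have nat: "u (x + real n *\<^sub>R axis i 1) = u x" for x i n
  proof (induction n)
    case (Suc n)
    have "x + real (Suc n) *\<^sub>R axis i 1 = (x + real n *\<^sub>R axis i 1) + axis i 1"
      by (simp add: algebra_simps)
    then show ?case using Suc u unfolding periodic1_def by metis
  qed simp
  have int: "u (x + of_int m *\<^sub>R axis i 1) = u x" for x i m
  proof (cases "m \<ge> 0")
    case True
    then show ?thesis using nat[of x "nat m" i] by simp
  next
    case False
    then show ?thesis using nat[of "x + of_int m *\<^sub>R axis i 1" "nat (- m)" i] by (simp add: algebra_simps)
  qed
  have "u (x + (\<Sum>i\<in>S. k $ i *\<^sub>R axis i 1)) = u x" if "finite S" for S :: "'n set"
    using that
  proof (induction S)
    case (insert a S)
    obtain m where m: "k $ a = of_int m" using k[of a] Ints_cases by blast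
    have "u (x + (\<Sum>i\<in>insert a S. k $ i *\<^sub>R axis i 1)) =
        u ((x + (\<Sum>i\<in>S. k $ i *\<^sub>R axis i 1)) + of_int m *\<^sub>R axis a 1)"
      using insert m by (simp add: algebra_simps)
    then show ?case using insert int by simp
  qed simp
  moreover have "(\<Sum>i\<in>UNIV. k $ i *\<^sub>R axis i 1) = k"
    using basis_expansion[of k] by (simp add: scalar_mult_eq_scaleR)
  ultimately show ?thesis by (metis finite_class.finite_UNIV)
qed

definition unit_cell :: "(real^'n) set" where
  "unit_cell = cbox 0 (\<chi> i. 1)"

lemma compact_unit_cell: "compact (unit_cell :: (real^'n) set)"
  and zero_in_unit_cell: "0 \<in> unit_cell"
  unfolding unit_cell_def by (auto simp: mem_box_cart)

lemma unit_cell_representative: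
  fixes x :: "real^'n"
  obtains y where "y \<in> unit_cell" "\<And>u z. periodic1 u \<Longrightarrow> u (x + z) = u (y + z)"
proof
  define y where "y = (\<chi> i. frac (x $ i))"
  define k where "k = (\<chi> i. real_of_int \<lfloor>x $ i\<rfloor>)"
  show "y \<in> unit_cell"
    unfolding unit_cell_def y_def by (auto simp: mem_box_cart frac_ge_0 less_imp_le[OF frac_lt_1])
  fix u :: "real^'n \<Rightarrow> real" and z assume "periodic1 u"
  moreover have "x + z = (y + z) + k" by (simp add: vec_eq_iff y_def k_def frac_def)
  ultimately show "u (x + z) = u (y + z)"
    using periodic1_shift[of u k "y + z"] by (metis Ints_of_int k_def vec_lambda_beta)
qed

lemma periodic_bounded:
  assumes u: "periodic1 u" "continuous_on UNIV u"
  obtains B where "B > 0" "\<And>x. \<bar>u x\<bar> \<le> B"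
proof -
  have "compact (u ` unit_cell)"
    using compact_unit_cell u(2) by (meson compact_continuous_image continuous_on_subset subset_UNIV)
  then obtain B where B: "B > 0" "\<And>y. y \<in> u ` unit_cell \<Longrightarrow> norm y \<le> B"
    using compact_imp_bounded[of "u ` unit_cell"] unfolding bounded_pos by blast
  have "\<bar>u x\<bar> \<le> B" for x
  proof -
    obtain y where "y \<in> unit_cell" "u (x + 0) = u (y + 0)"
      using unit_cell_representative[of x] u(1) by metis
    then show ?thesis using B(2)[of "u y"] by auto
  qed
  then show ?thesis using that B by blast
qed

lemma periodic_attains_max:
  assumes u: "periodic1 u" "continuous_on UNIV u"
  obtains z where "\<And>x. u x \<le> u z"
proof -
  obtain z where z: "\<And>y. y \<in> unit_cell \<Longrightarrow> u y \<le> u z"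
    using continuous_attains_sup[OF compact_unit_cell _ continuous_on_subset[OF u(2)]] zero_in_unit_cell
    by blast
  have "u x \<le> u z" for x
  proof -
    obtain y where "y \<in> unit_cell" "u (x + 0) = u (y + 0)"
      using unit_cell_representative[of x] u(1) by metis
    then show ?thesis using z by auto
  qed
  then show ?thesis using that by blast
qed

lemma periodic_attains_min:
  assumes u: "periodic1 u" "continuous_on UNIV u"
  obtains z where "\<And>x. u z \<le> u x"
proof -
  have "periodic1 (\<lambda>x. - u x)" "continuous_on UNIV (\<lambda>x. - u x)"
    using u by (auto simp: periodic1_def intro: continuous_intros)
  then obtain z where "\<And>x. - u x \<le> - u z" using periodic_attains_max by blast
  then show ?thesis using that[of z] by auto
qed

lemma strong_max_principle:
  fixes w :: "real^'n \<Rightarrow> real"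
  assumes w: "axis_diff2 w" and cont: "continuous_on UNIV w" and nonneg: "\<And>x. w x \<ge> 0"
    and c: "c > 0" and le: "\<And>x. lap w x \<le> c * w x" and pos: "w x0 > 0"
  shows "w x > 0"
proof -
  obtain p q where pq: "axis_derivs w p q" using w unfolding axis_diff2_def by blast
  have "isCont w x0" using cont by (simp add: continuous_on_eq_continuous_at)
  then obtain r where r: "r > 0" "\<And>y. dist y x0 < r \<Longrightarrow> dist (w y) (w x0) < w x0 / 2"
    using pos unfolding continuous_at_eps_delta by (meson half_gt_zero)
  define N where "N = real CARD('n)"
  have N: "N > 0" unfolding N_def by simp
  define a where "a = (c + 2 * N + 1) / (2 * r\<^sup>2) + 1"
  have a1: "a \<ge> 1" using c N r by (simp add: a_def)
  define R where "R = norm (x - x0) + r + 1"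
  have Rr: "R > r" "R > 0" "R > norm (x - x0)"
    using r norm_ge_zero[of "x - x0"] unfolding R_def by linarith+
  define E where "E y = exp (- a * ((y - x0) \<bullet> (y - x0)))" for y
  have E: "E y = exp (- a * (norm (y - x0))\<^sup>2)" for y
    by (simp add: E_def power2_norm_eq_inner)
  define k where "k = exp (- a * R\<^sup>2)"
  have k: "k > 0" by (simp add: k_def)
  define \<epsilon> where "\<epsilon> = w x0 / 2"
  have \<epsilon>: "\<epsilon> > 0" using pos by (simp add: \<epsilon>_def)
  define g where "g y = w y - \<epsilon> * (E y - k)" for y
  have E_pos: "E y > 0" for y by (simp add: E)
  have E_less: "E y > k \<longleftrightarrow> norm (y - x0) < R" for y
  proof -
    have "(norm (y - x0))\<^sup>2 < R\<^sup>2 \<longleftrightarrow> norm (y - x0) < R"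
      using Rr by (metis less_imp_le norm_ge_zero pos2 power_less_imp_less_base power_strict_mono)
    then show ?thesis using a1 by (simp add: E k_def)
  qed
  have [simp]: "E y \<le> 1" for y using a1 by (simp add: E)
  have inner_near: "g y > 0" if "norm (y - x0) < r" for y
  proof -
    have "w y > \<epsilon>" using r(2)[of y] that by (auto simp: dist_norm \<epsilon>_def abs_if split: if_splits)
    moreover have "\<epsilon> * (E y - k) \<le> \<epsilon> * 1"
      using \<epsilon> k by (intro mult_left_mono) (auto intro: order_trans[of _ "E y"])
    ultimately show ?thesis by (simp add: g_def)
  qed
  have g_cont: "continuous_on UNIV g" unfolding g_def E_def
    by (intro continuous_intros cont)
  have g_nonneg: "g y \<ge> 0" for y
  proof (rule ccontr)
    assume "\<not> g y \<ge> 0"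
    then have gy: "g y < 0" by simp
    have out: "g y' \<ge> 0" if "norm (y' - x0) \<ge> R" for y'
    proof -
      have "E y' \<le> k" using E_less[of y'] that by linarith
      then have "\<epsilon> * (E y' - k) \<le> 0" using \<epsilon> by (simp add: mult_nonneg_nonpos)
      then show ?thesis using nonneg[of y'] by (simp add: g_def)
    qed
    have "cball x0 R \<noteq> {}" using Rr by simp
    then obtain z where z: "\<And>y. y \<in> cball x0 R \<Longrightarrow> g z \<le> g y"
      using continuous_attains_inf[OF compact_cball _ continuous_on_subset[OF g_cont]] by blast
    have "\<not> R \<le> norm (y - x0)" using out[of y] gy by fastforce
    then have yR: "y \<in> cball x0 R" by (simp add: dist_norm norm_minus_commute[of x0])
    have gz: "g z < 0" using z[OF yR] gy by simp
    have glob: "g z \<le> g y'" for y'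
    proof (cases "y' \<in> cball x0 R")
      case False
      then have "norm (y' - x0) \<ge> R" by (simp add: dist_norm norm_minus_commute[of x0])
      then show ?thesis using out[of y'] gz by simp
    qed (use z in auto)
    have zr: "norm (z - x0) \<ge> r" using inner_near[of z] gz by linarith
    define y1 where "y1 = z - x0"
    have 1: "q i z - \<epsilon> * ((4 * a\<^sup>2 * (y1 $ i)\<^sup>2 - 2 * a) * E z) \<ge> 0" for i
    proof (rule second_deriv_nonneg_at_min[where e=1 and a=0 and g="\<lambda>t. g (z + ray i t)"
          and g'="\<lambda>t. p i (z + ray i t) - \<epsilon> * (- a * (2 * y1 $ i + 2 * t) * E (z + ray i t))"])
      have Et: "E (z + ray i t) = exp (- a * (y1 \<bullet> y1 + 2 * t * y1 $ i + t\<^sup>2))" for t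
        by (simp add: E_def y1_def inner_add_left inner_add_right inner_diff_left inner_diff_right
            inner_axis inner_axis' power2_eq_square algebra_simps)
      have dE: "((\<lambda>t. E (z + ray i t)) has_real_derivative
          (- a * (2 * y1 $ i + 2 * t) * E (z + ray i t))) (at t)" for t
        unfolding Et by (auto intro!: derivative_eq_intros simp: algebra_simps)
      show "((\<lambda>t. g (z + ray i t)) has_real_derivative
        p i (z + ray i t) - \<epsilon> * (- a * (2 * y1 $ i + 2 * t) * E (z + ray i t))) (at t)" for t
        unfolding g_def
        by (rule derivative_eq_intros axis_derivs_first[OF pq] dE refl | simp)+
      show "((\<lambda>t. p i (z + ray i t) - \<epsilon> * (- a * (2 * y1 $ i + 2 * t) * E (z + ray i t)))
         has_real_derivative q i z - \<epsilon> * ((4 * a\<^sup>2 * (y1 $ i)\<^sup>2 - 2 * a) * E z)) (at 0)"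
        using axis_derivs_second[OF pq, of i z 0]
        by (auto intro!: derivative_eq_intros dE simp: power2_eq_square algebra_simps)
    qed (use glob in auto)
    have "0 \<le> (\<Sum>i\<in>UNIV. q i z - \<epsilon> * ((4 * a\<^sup>2 * (y1 $ i)\<^sup>2 - 2 * a) * E z))"
      by (intro sum_nonneg 1)
    also have "\<dots> = lap w z - \<epsilon> * ((4 * a\<^sup>2 * (\<Sum>i\<in>UNIV. (y1 $ i)\<^sup>2) - 2 * a * N) * E z)"
      by (simp add: axis_derivs_lap[OF pq] sum_subtractf sum_distrib_left sum_distrib_right
          N_def algebra_simps sum.distrib)
    also have "(\<Sum>i\<in>UNIV. (y1 $ i)\<^sup>2) = (norm y1)\<^sup>2"
      unfolding power2_norm_eq_inner by (simp add: inner_vec_def power2_eq_square)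
    finally have "\<epsilon> * ((4 * a\<^sup>2 * (norm y1)\<^sup>2 - 2 * a * N) * E z) \<le> lap w z" by simp
    also have "\<dots> \<le> c * w z" by (rule le)
    also have "\<dots> \<le> c * (\<epsilon> * E z)"
    proof -
      have "w z \<le> \<epsilon> * E z" using gz mult_pos_pos[OF \<epsilon> k] unfolding g_def right_diff_distrib by linarith
      then show ?thesis using c by simp
    qed
    finally have "\<epsilon> * E z * (4 * a\<^sup>2 * (norm y1)\<^sup>2 - 2 * a * N) \<le> \<epsilon> * E z * c"
      by (simp add: algebra_simps)
    then have A: "4 * a\<^sup>2 * (norm y1)\<^sup>2 - 2 * a * N \<le> c"
      using \<epsilon> E_pos[of z] by (simp add: mult_le_cancel_left_pos)
    have "r\<^sup>2 \<le> (norm y1)\<^sup>2" using zr r by (simp add: y1_def power_mono)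
    then have "4 * a\<^sup>2 * r\<^sup>2 \<le> 4 * a\<^sup>2 * (norm y1)\<^sup>2" by (intro mult_left_mono) auto
    moreover have "2 * a * r\<^sup>2 \<ge> c + 2 * N + 1"
      using r by (simp add: a_def field_simps)
    then have "(2 * a) * (2 * a * r\<^sup>2) \<ge> (2 * a) * (c + 2 * N + 1)"
      using a1 by (intro mult_left_mono) auto
    moreover have "(2 * a) * (c + 2 * N + 1) - 2 * a * N \<ge> 1 * (c + N + 1)"
    proof -
      have "(2 * a) * (c + N + 1) \<ge> 1 * (c + N + 1)" using a1 c N by (intro mult_right_mono) auto
      moreover have "(2 * a) * (c + 2 * N + 1) - 2 * a * N = (2 * a) * (c + N + 1)"
        by (simp add: algebra_simps)
      ultimately show ?thesis by linarith
    qed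
    ultimately show False using A N by (simp add: power2_eq_square algebra_simps)
  qed
  have "E x > k" using E_less Rr by simp
  then have "\<epsilon> * (E x - k) > 0" using \<epsilon> by simp
  then show ?thesis using g_nonneg[of x] by (simp add: g_def)
qed

lemma doubling_estimate:
  fixes u :: "real^'n \<Rightarrow> real"
  assumes u: "axis_diff2 u" and cont: "continuous_on UNIV u" and per: "periodic1 u"
    and r: "r > 0" and M: "M \<ge> 0"
    and D: "\<And>x. u (x + ray i r) - u (x - ray i r) \<le> D"
    and L: "\<And>x h. 0 < h \<Longrightarrow> h < r \<Longrightarrow> - M \<le> lap u (x + ray i h) - lap u (x - ray i h)"
    and h: "0 \<le> h" "h \<le> r"
  shows "u (x + ray i h) - u (x - ray i h) \<le> (D / r + M / 2 * r) * h"
proof -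
  obtain p q where pq: "axis_derivs u p q" using u unfolding axis_diff2_def by blast
  have key: "u (x + ray i h) - u (x - ray i h) \<le> (D / r + B * r) * h - B * h\<^sup>2"
    if B: "B > M / 2" and h: "0 \<le> h" "h \<le> r" for B x h
  proof (rule ccontr)
    define b where "b h = (D / r + B * r) * h - B * h\<^sup>2" for h
    define \<Phi> where "\<Phi> x h = u (x + ray i h) - u (x - ray i h) - b h" for x h
    assume "\<not> ?thesis"
    then have pos: "\<Phi> x h > 0" by (simp add: \<Phi>_def b_def)
    have "continuous_on (unit_cell \<times> {0..r}) (\<lambda>(x, h). \<Phi> x h)"
      unfolding \<Phi>_def b_def case_prod_beta
      by (intro continuous_intros continuous_on_compose2[OF cont]) auto
    moreover have "compact (unit_cell \<times> {0..r} :: ((real^'n) \<times> real) set)"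
      by (intro compact_Times compact_unit_cell) auto
    moreover have "(0, 0) \<in> (unit_cell \<times> {0..r} :: ((real^'n) \<times> real) set)"
      using zero_in_unit_cell r by auto
    ultimately obtain m where m: "m \<in> unit_cell \<times> {0..r}"
        "\<forall>y \<in> unit_cell \<times> {0..r}. (case y of (x, h) \<Rightarrow> \<Phi> x h) \<le> (case m of (x, h) \<Rightarrow> \<Phi> x h)"
      using continuous_attains_sup[of "unit_cell \<times> {0..r}" "\<lambda>(x, h). \<Phi> x h"] by blast
    obtain z s where zs: "m = (z, s)" by (cases m)
    have s: "0 \<le> s" "s \<le> r" using m(1) zs by auto
    have glob: "\<Phi> y t \<le> \<Phi> z s" if t: "0 \<le> t" "t \<le> r" for y t
    proof -
      obtain y' where y': "y' \<in> unit_cell" "\<And>u z. periodic1 u \<Longrightarrow> u (y + z) = u (y' + z)"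
        using unit_cell_representative[of y] by blast
      have "\<Phi> y t = \<Phi> y' t"
        using y'(2)[OF per, of "ray i t"] y'(2)[OF per, of "- ray i t"]
        by (simp add: \<Phi>_def)
      then show ?thesis using m(2) y'(1) t zs by fastforce
    qed
    have pos': "\<Phi> z s > 0" using glob[OF h, of x] pos by simp
    have "s \<noteq> 0" using pos' by (auto simp: \<Phi>_def b_def)
    moreover have "s \<noteq> r"
    proof
      assume "s = r"
      have "b r = D" using r by (simp add: b_def field_simps power2_eq_square)
      then show False using pos' D[of z] \<open>s = r\<close> by (simp add: \<Phi>_def)
    qed
    ultimately have s: "0 < s" "s < r" using s by auto
    have other: "q j (z + ray i s) - q j (z - ray i s) \<le> 0" for j
    proof -
      have "- (q j (z + ray i s) - q j (z - ray i s)) \<ge> 0"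
      proof (rule second_deriv_nonneg_at_min[where e=1 and a=0 and g="\<lambda>t. - \<Phi> (z + ray j t) s"
          and g'="\<lambda>t. - (p j ((z + ray i s) + ray j t) - p j ((z - ray i s) + ray j t))"])
        have eq: "\<Phi> (z + ray j t) s = u ((z + ray i s) + ray j t)
            - u ((z - ray i s) + ray j t) - b s" for t
          by (simp add: \<Phi>_def algebra_simps)
        show "((\<lambda>t. - \<Phi> (z + ray j t) s) has_real_derivative
          - (p j ((z + ray i s) + ray j t) - p j ((z - ray i s) + ray j t))) (at t)" for t
          unfolding eq by (auto intro!: derivative_eq_intros axis_derivs_first[OF pq])
        show "((\<lambda>t. - (p j ((z + ray i s) + ray j t) - p j ((z - ray i s) + ray j t)))
          has_real_derivative - (q j (z + ray i s) - q j (z - ray i s))) (at 0)"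
          using axis_derivs_second[OF pq, of j "z + ray i s" 0]
            axis_derivs_second[OF pq, of j "z - ray i s" 0]
          by (auto intro!: derivative_eq_intros)
      qed (use glob s in auto)
      then show ?thesis by simp
    qed
    have "- (q i (z + ray i s) - q i (z - ray i s) + 2 * B) \<ge> 0"
    proof (rule second_deriv_nonneg_at_min[where e="min s (r - s)" and a=s and g="\<lambda>t. - \<Phi> z t"
          and g'="\<lambda>t. - (p i (z + ray i t) + p i (z + ray i (- t)) - ((D / r + B * r) - 2 * B * t))"])
      have minus: "((\<lambda>t. u (z + ray i (- t))) has_real_derivative - p i (z + ray i (- t))) (at t)" for t
        using axis_derivs_first[OF pq, of z i "- t"] by (simp only: DERIV_mirror)
      have minus2: "((\<lambda>t. p i (z + ray i (- t))) has_real_derivative - q i (z + ray i (- t))) (at t)" for t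
        using axis_derivs_second[OF pq, of i z "- t"] by (simp only: DERIV_mirror)
      have eq: "\<Phi> z t = u (z + ray i t) - u (z + ray i (- t)) - ((D / r + B * r) * t - B * t\<^sup>2)" for t
        by (simp add: \<Phi>_def b_def)
      show "((\<lambda>t. - \<Phi> z t) has_real_derivative
        - (p i (z + ray i t) + p i (z + ray i (- t)) - ((D / r + B * r) - 2 * B * t))) (at t)" for t
        unfolding eq
        by (rule derivative_eq_intros axis_derivs_first[OF pq] minus refl | simp)+
      show "((\<lambda>t. - (p i (z + ray i t) + p i (z + ray i (- t)) - ((D / r + B * r) - 2 * B * t)))
        has_real_derivative - (q i (z + ray i s) - q i (z - ray i s) + 2 * B)) (at s)"
        by (rule derivative_eq_intros axis_derivs_second[OF pq] minus2 refl | simp)+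
      show "- \<Phi> z s \<le> - \<Phi> z t" if "\<bar>t - s\<bar> < min s (r - s)" for t
        using glob[of t z] that by auto
    qed (use s in auto)
    moreover have "(\<Sum>j\<in>UNIV - {i}. q j (z + ray i s) - q j (z - ray i s)) \<le> 0"
      by (intro sum_nonpos other)
    ultimately have "(\<Sum>j\<in>UNIV. q j (z + ray i s) - q j (z - ray i s)) \<le> - 2 * B"
      by (simp add: sum.remove[of UNIV i])
    then have "lap u (z + ray i s) - lap u (z - ray i s) \<le> - 2 * B"
      by (simp add: axis_derivs_lap[OF pq] sum_subtractf)
    then show False using L[OF s, of z] B by simp
  qed
  show ?thesis
  proof (rule field_le_epsilon)
    fix e :: real assume e: "e > 0"
    define B where "B = M / 2 + e / (r * r)"
    have B: "B > M / 2" using e r by (simp add: B_def)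
    have "B * h\<^sup>2 \<ge> 0" using B M by simp
    then have "u (x + ray i h) - u (x - ray i h) \<le> (D / r + B * r) * h"
      using key[OF B h, of x] by linarith
    also have "\<dots> = (D / r + M / 2 * r) * h + e * (h / r)"
      using r by (simp add: B_def field_simps)
    also have "e * (h / r) \<le> e * 1" using h r e by (intro mult_left_mono) auto
    finally show "u (x + ray i h) - u (x - ray i h) \<le> (D / r + M / 2 * r) * h + e"
      by simp
  qed
qed

section \<open>Lipschitz and Hoelder functions on the torus\<close>

definition int_dist :: "real \<Rightarrow> real" where
  "int_dist t = \<bar>t - of_int (round t)\<bar>"

lemma int_dist_le: "int_dist t \<le> \<bar>t - of_int m\<bar>"
  unfolding int_dist_def by (metis abs_minus_commute round_diff_minimal)

lemma int_dist_le_abs: "int_dist t \<le> \<bar>t\<bar>"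
  using int_dist_le[of t 0] by simp

lemma int_dist_nonneg: "int_dist t \<ge> 0"
  by (simp add: int_dist_def)

lemma int_dist_le_half: "int_dist t \<le> 1/2"
  unfolding int_dist_def using of_int_round_abs_le[of t] by (simp add: abs_minus_commute)

lemma int_dist_add: "int_dist (s + t) \<le> int_dist s + int_dist t"
  using int_dist_le[of "s + t" "round s + round t"] unfolding int_dist_def by simp

lemma int_dist_minus: "int_dist (- t) = int_dist t"
proof -
  have "int_dist (- t) \<le> int_dist t" for t
    using int_dist_le[of "- t" "- round t"] unfolding int_dist_def by simp
  from this[of t] this[of "- t"] show ?thesis by simp
qed

lemma int_dist_of_int: "int_dist (of_int m) = 0"
  by (simp add: int_dist_def)

definition per_dist :: "real^'n \<Rightarrow> real^'n \<Rightarrow> real" where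
  "per_dist x z = (\<Sum>j\<in>UNIV. int_dist (x $ j - z $ j))"

lemma per_dist_nonneg: "per_dist x z \<ge> 0"
  unfolding per_dist_def by (intro sum_nonneg int_dist_nonneg)

lemma per_dist_commute: "per_dist x z = per_dist z x"
  unfolding per_dist_def by (metis int_dist_minus minus_diff_eq)

lemma per_dist_triangle: "per_dist x z \<le> per_dist x y + per_dist y z"
proof -
  have "int_dist (x $ j - z $ j) \<le> int_dist (x $ j - y $ j) + int_dist (y $ j - z $ j)" for j
    using int_dist_add[of "x $ j - y $ j" "y $ j - z $ j"] by simp
  then show ?thesis unfolding per_dist_def sum.distrib[symmetric] by (intro sum_mono)
qed

lemma per_dist_le_norm: "per_dist x z \<le> real CARD('n) * norm (x - z)" for x z :: "real^'n"
proof -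
  have "int_dist (x $ j - z $ j) \<le> norm (x - z)" for j
    using int_dist_le_abs[of "x $ j - z $ j"] component_le_norm_cart[of "x - z" j] by simp
  then have "per_dist x z \<le> (\<Sum>j\<in>(UNIV::'n set). norm (x - z))"
    unfolding per_dist_def by (intro sum_mono)
  then show ?thesis by simp
qed

lemma per_dist_bound: "per_dist x z \<le> real CARD('n)" for x z :: "real^'n"
proof -
  have "per_dist x z \<le> (\<Sum>j\<in>(UNIV::'n set). 1)"
    unfolding per_dist_def using int_dist_le_half by (intro sum_mono) (smt (verit) field_sum_of_halves)
  then show ?thesis by simp
qed

lemma per_dist_period: "per_dist (x + axis i 1) x = 0"
proof -
  have "int_dist ((x + axis i 1) $ j - x $ j) = 0" for j
    using int_dist_of_int[of 0] int_dist_of_int[of 1] by (auto simp: axis_def)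
  then show ?thesis unfolding per_dist_def by simp
qed

definition per_lip :: "real \<Rightarrow> (real^'n \<Rightarrow> real) \<Rightarrow> bool" where
  "per_lip L u \<longleftrightarrow> (\<forall>x z. \<bar>u x - u z\<bar> \<le> L * per_dist x z)"

lemma per_lip_const: "L \<ge> 0 \<Longrightarrow> per_lip L (\<lambda>x. c)"
  unfolding per_lip_def by (simp add: per_dist_nonneg)

lemma per_lip_mono: "per_lip L u \<Longrightarrow> L \<le> L' \<Longrightarrow> per_lip L' u"
  unfolding per_lip_def by (meson mult_right_mono order_trans per_dist_nonneg)

lemma per_lip_periodic: "per_lip L u \<Longrightarrow> periodic1 u"
  unfolding per_lip_def periodic1_def
  by (metis abs_le_zero_iff eq_iff_diff_eq_0 mult_zero_right per_dist_period)

lemma per_lip_norm: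
  fixes u :: "real^'n \<Rightarrow> real"
  assumes "per_lip L u" "L \<ge> 0"
  shows "\<bar>u x - u z\<bar> \<le> L * real CARD('n) * norm (x - z)"
proof -
  have "\<bar>u x - u z\<bar> \<le> L * per_dist x z" using assms(1) by (simp add: per_lip_def)
  also have "\<dots> \<le> L * (real CARD('n) * norm (x - z))"
    using assms(2) by (intro mult_left_mono per_dist_le_norm)
  finally show ?thesis by (simp add: mult.assoc)
qed

lemma holder_of_lipschitz_bounded:
  assumes "0 < \<delta>" "\<delta> < 1" "A \<ge> 0"
    and 1: "\<And>x z. \<bar>u x - u z\<bar> \<le> A * norm (x - z)" and 2: "\<And>x z. \<bar>u x - u z\<bar> \<le> A"
  shows "holder \<delta> u"
  unfolding holder_def
proof (intro exI allI)
  fix x z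
  show "\<bar>u x - u z\<bar> \<le> A * dist x z powr \<delta>"
  proof (cases "dist x z \<le> 1")
    case True
    have "dist x z \<le> dist x z powr \<delta>"
    proof (cases "dist x z = 0")
      case False
      then show ?thesis using powr_mono'[of \<delta> 1 "dist x z"] True assms by simp
    qed simp
    then show ?thesis using 1[of x z] assms by (metis dist_norm mult_left_mono order_trans)
  next
    case False
    then have "1 \<le> dist x z powr \<delta>" using assms by (simp add: ge_one_powr_ge_zero)
    then have "A * 1 \<le> A * dist x z powr \<delta>" using assms by (intro mult_left_mono)
    then show ?thesis using 2[of x z] by simp
  qed
qed

lemma per_lip_Cper:
  fixes u :: "real^'n \<Rightarrow> real"
  assumes u: "per_lip L u" "L \<ge> 0" and \<delta>: "0 < \<delta>" "\<delta> < 1"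
  shows "u \<in> Cper \<delta>"
proof -
  have "\<bar>u x - u z\<bar> \<le> L * real CARD('n)" for x z
  proof -
    have "\<bar>u x - u z\<bar> \<le> L * per_dist x z" using u by (simp add: per_lip_def)
    also have "\<dots> \<le> L * real CARD('n)" using u by (intro mult_left_mono per_dist_bound)
    finally show ?thesis .
  qed
  then have "holder \<delta> u"
    using holder_of_lipschitz_bounded[OF \<delta>, of "L * real CARD('n)" u] per_lip_norm[OF u] u(2) by simp
  then show ?thesis using per_lip_periodic[OF u(1)] by (simp add: Cper_def)
qed

lemma holder_continuous:
  assumes "holder \<delta> u" "\<delta> > 0" shows "continuous_on UNIV u"
proof -
  obtain C where C: "\<And>x y. \<bar>u x - u y\<bar> \<le> C * dist x y powr \<delta>" using assms(1) by (auto simp: holder_def)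
  have "(u \<longlongrightarrow> u x) (at x)" for x
  proof -
    have "((\<lambda>y. C * dist y x powr \<delta>) \<longlongrightarrow> C * 0 powr \<delta>) (at x)"
      using assms(2) by (intro tendsto_mult tendsto_const tendsto_powr' tendsto_dist_iff[THEN iffD1, OF tendsto_ident_at]) auto
    then have "((\<lambda>y. C * dist y x powr \<delta>) \<longlongrightarrow> 0) (at x)" by simp
    then have "((\<lambda>y. u y - u x) \<longlongrightarrow> 0) (at x)"
      by (rule Lim_null_comparison[rotated]) (use C in auto)
    then show ?thesis by (simp add: LIM_zero_iff)
  qed
  then show ?thesis by (simp add: continuous_on_def)
qed

lemma Cper_continuous: "u \<in> Cper \<delta> \<Longrightarrow> \<delta> > 0 \<Longrightarrow> continuous_on UNIV u"
  unfolding Cper_def using holder_continuous by auto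

lemma Cper_bounded:
  assumes "u \<in> Cper \<delta>" "\<delta> > 0"
  obtains B where "B > 0" "\<And>x. \<bar>u x\<bar> \<le> B"
  using periodic_bounded[of u] Cper_continuous[OF assms] assms by (auto simp: Cper_def)

lemma Cper_const: "(\<lambda>x. c) \<in> Cper \<delta>"
  unfolding Cper_def holder_def periodic1_def by (auto intro!: exI[of _ 0])

lemma Cper_add:
  assumes "u \<in> Cper \<delta>" "v \<in> Cper \<delta>" shows "(\<lambda>x. u x + v x) \<in> Cper \<delta>"
proof -
  obtain A B where A: "\<And>x y. \<bar>u x - u y\<bar> \<le> A * dist x y powr \<delta>"
    and B: "\<And>x y. \<bar>v x - v y\<bar> \<le> B * dist x y powr \<delta>"
    using assms by (auto simp: Cper_def holder_def)
  have "\<bar>(u x + v x) - (u y + v y)\<bar> \<le> (A + B) * dist x y powr \<delta>" for x y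
    using A[of x y] B[of x y] by (simp add: algebra_simps)
  then show ?thesis using assms unfolding Cper_def holder_def periodic1_def by auto
qed

lemma Cper_mult:
  assumes u: "u \<in> Cper \<delta>" and v: "v \<in> Cper \<delta>" and \<delta>: "\<delta> > 0" shows "(\<lambda>x. u x * v x) \<in> Cper \<delta>"
proof -
  obtain A B where A: "\<And>x y. \<bar>u x - u y\<bar> \<le> A * dist x y powr \<delta>"
    and B: "\<And>x y. \<bar>v x - v y\<bar> \<le> B * dist x y powr \<delta>"
    using assms by (auto simp: Cper_def holder_def)
  obtain U where U: "\<And>x. \<bar>u x\<bar> \<le> U" using Cper_bounded[OF u \<delta>] by blast
  obtain V where V: "\<And>x. \<bar>v x\<bar> \<le> V" using Cper_bounded[OF v \<delta>] by blast
  have "\<bar>u x * v x - u y * v y\<bar> \<le> (U * B + V * A) * dist x y powr \<delta>" for x y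
  proof -
    have "u x * v x - u y * v y = u x * (v x - v y) + v y * (u x - u y)" by (simp add: algebra_simps)
    then have "\<bar>u x * v x - u y * v y\<bar> \<le> \<bar>u x\<bar> * \<bar>v x - v y\<bar> + \<bar>v y\<bar> * \<bar>u x - u y\<bar>"
      using abs_triangle_ineq[of "u x * (v x - v y)" "v y * (u x - u y)"] by (simp only: abs_mult)
    also have "\<dots> \<le> U * (B * dist x y powr \<delta>) + V * (A * dist x y powr \<delta>)"
      using U[of x] V[of y] A[of x y] B[of x y] by (intro add_mono mult_mono) auto
    finally show ?thesis by (simp add: algebra_simps)
  qed
  then have "holder \<delta> (\<lambda>x. u x * v x)" unfolding holder_def by blast
  moreover have "periodic1 (\<lambda>x. u x * v x)" using u v by (simp add: Cper_def periodic1_def)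
  ultimately show ?thesis by (simp add: Cper_def)
qed

lemma Cper_cmult: "u \<in> Cper \<delta> \<Longrightarrow> \<delta> > 0 \<Longrightarrow> (\<lambda>x. c * u x) \<in> Cper \<delta>"
  using Cper_mult[OF Cper_const] by blast

lemma Cper_diff: "u \<in> Cper \<delta> \<Longrightarrow> v \<in> Cper \<delta> \<Longrightarrow> \<delta> > 0 \<Longrightarrow> (\<lambda>x. u x - v x) \<in> Cper \<delta>"
  using Cper_add[of u \<delta> "\<lambda>x. (-1) * v x"] Cper_cmult[of v \<delta> "-1"] by simp

lemma per_lip_bounded:
  assumes "per_lip L u" "L \<ge> 0"
  obtains B where "B > 0" "\<And>x. \<bar>u x\<bar> \<le> B"
proof -
  have "u \<in> Cper (1/2)" by (rule per_lip_Cper[OF assms]) auto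
  then show ?thesis by (rule Cper_bounded) (auto intro: that)
qed

lemma Cper_lower_bound:
  assumes "q \<in> Cper \<delta>" "\<delta> > 0" "\<And>x. q x > 0"
  obtains q0 where "q0 > 0" "\<And>x. q0 \<le> q x"
proof -
  obtain y where "\<And>x. q y \<le> q x"
    using periodic_attains_min[of q] Cper_continuous[OF assms(1,2)] assms(1) by (auto simp: Cper_def)
  then show ?thesis using that[of "q y"] assms(3) by blast
qed

lemma per_lip_of_lap_bounded:
  fixes u :: "real^'n \<Rightarrow> real"
  assumes u: "axis_diff2 u" "continuous_on UNIV u" "periodic1 u"
    and M: "\<And>x. \<bar>u x\<bar> \<le> M" "\<And>x. \<bar>lap u x\<bar> \<le> M"
  shows "per_lip (3/2 * M) u"
proof -
  have M0: "M \<ge> 0" using M(1)[of 0] by simp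
  have half: "u (y + ray i t) - u y \<le> 3/2 * M * t" "u y - u (y + ray i t) \<le> 3/2 * M * t"
    if t: "0 \<le> t" "t \<le> 1" for y i t
  proof -
    have dbl: "w (y + ray i t) - w y \<le> 3/2 * M * t"
      if w: "axis_diff2 w" "continuous_on UNIV w" "periodic1 w" "\<And>x. \<bar>w x\<bar> \<le> M" "\<And>x. \<bar>lap w x\<bar> \<le> M" for w
    proof -
      have "w ((y + ray i (t/2)) + ray i (t/2)) - w ((y + ray i (t/2)) - ray i (t/2))
          \<le> (2 * M / 1 + 2 * M / 2 * 1) * (t/2)"
      proof (rule doubling_estimate[OF w(1-3)])
        fix x
        show "w (x + ray i 1) - w (x - ray i 1) \<le> 2 * M"
          using w(4)[of "x + ray i 1"] w(4)[of "x - ray i 1"] by linarith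
        show "- (2 * M) \<le> lap w (x + ray i h) - lap w (x - ray i h)" for h
          using w(5)[of "x + ray i h"] w(5)[of "x - ray i h"] by linarith
      qed (use t M0 in auto)
      then show ?thesis by (simp add: scaleR_add_left[symmetric] add.assoc)
    qed
    show "u (y + ray i t) - u y \<le> 3/2 * M * t" by (rule dbl[OF u M])
    have "-1 * u (y + ray i t) - -1 * u y \<le> 3/2 * M * t"
      by (rule dbl[OF axis_diff2_cmult[OF u(1)]])
        (use u M lap_cmult[OF u(1), of "-1"] in \<open>auto simp: periodic1_def intro: continuous_intros\<close>)
    then show "u y - u (y + ray i t) \<le> 3/2 * M * t" by simp
  qed
  have step2: "\<bar>u (y + ray i t) - u y\<bar> \<le> 3/2 * M * t" if "0 \<le> t" "t \<le> 1" for y i t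
    using half[OF that, of y i] by linarith
  have step3: "\<bar>u (y + ray i t) - u y\<bar> \<le> 3/2 * M * \<bar>t\<bar>" if "\<bar>t\<bar> \<le> 1" for y i t
  proof (cases "t \<ge> 0")
    case False
    then show ?thesis using step2[of "-t" "y + ray i t" i] that by (simp add: abs_minus_commute)
  qed (use step2 that in auto)
  show ?thesis unfolding per_lip_def
  proof (intro allI)
    fix x z :: "real^'n"
    define k where "k = (\<chi> j. real_of_int (round (x $ j - z $ j)))"
    define t where "t j = (x $ j - z $ j) - k $ j" for j
    have t: "\<bar>t j\<bar> = int_dist (x $ j - z $ j)" for j by (simp add: t_def k_def int_dist_def)
    have "\<bar>u (z + (\<Sum>j\<in>S. t j *\<^sub>R axis j 1)) - u z\<bar> \<le> (\<Sum>j\<in>S. 3/2 * M * \<bar>t j\<bar>)" if "finite S" for S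
      using that
    proof (induction S)
      case (insert a S)
      have "\<bar>t a\<bar> \<le> 1" using int_dist_le_half[of "x $ a - z $ a"] t[of a] by simp
      from step3[OF this, of "z + (\<Sum>j\<in>S. t j *\<^sub>R axis j 1)" a] insert.IH
      have "\<bar>u ((z + (\<Sum>j\<in>S. t j *\<^sub>R axis j 1)) + t a *\<^sub>R axis a 1) - u z\<bar>
          \<le> 3/2 * M * \<bar>t a\<bar> + (\<Sum>j\<in>S. 3/2 * M * \<bar>t j\<bar>)"
        by linarith
      moreover have "(z + (\<Sum>j\<in>S. t j *\<^sub>R axis j 1)) + t a *\<^sub>R axis a 1 = z + (\<Sum>j\<in>insert a S. t j *\<^sub>R axis j 1)"
        using insert.hyps by (simp add: add.assoc add.commute)
      ultimately show ?case using insert.hyps by simp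
    qed simp
    from this[of UNIV] have 1: "\<bar>u (z + (\<Sum>j\<in>UNIV. t j *\<^sub>R axis j 1)) - u z\<bar> \<le> 3/2 * M * per_dist x z"
      by (simp add: per_dist_def t sum_distrib_left)
    have "(\<Sum>j\<in>UNIV. t j *\<^sub>R axis j 1) = (\<chi> j. t j)"
      using basis_expansion[of "\<chi> j. t j"] by (simp add: scalar_mult_eq_scaleR)
    then have "x = (z + (\<Sum>j\<in>UNIV. t j *\<^sub>R axis j 1)) + k"
      by (simp add: vec_eq_iff t_def)
    then have "u x = u (z + (\<Sum>j\<in>UNIV. t j *\<^sub>R axis j 1))"
      using periodic1_shift[OF u(3), of k] by (metis Ints_of_int k_def vec_lambda_beta)
    with 1 show "\<bar>u x - u z\<bar> \<le> 3/2 * M * per_dist x z" by simp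
  qed
qed

lemma C2_periodic_per_lip:
  assumes u: "C2 u" "periodic1 u"
  obtains L where "L \<ge> 0" "per_lip L u"
proof -
  obtain B where B: "B > 0" "\<And>x. \<bar>u x\<bar> \<le> B" using periodic_bounded[OF u(2) C2_continuous[OF u(1)]] by blast
  have "lap u (x + axis i 1) = lap u x" for x i
    using lap_translate[OF C2_axis_diff2[OF u(1)], of "axis i 1" x] u(2) by (simp add: periodic1_def)
  then have "periodic1 (lap u)" by (simp add: periodic1_def)
  then obtain M where M: "\<And>x. \<bar>lap u x\<bar> \<le> M"
    using periodic_bounded[OF _ C2_lap_continuous[OF u(1)]] by blast
  have "per_lip (3/2 * max B M) u"
    using per_lip_of_lap_bounded[OF C2_axis_diff2[OF u(1)] C2_continuous[OF u(1)] u(2), of "max B M"] B M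
    by (simp add: le_max_iff_disj)
  then show ?thesis using that[of "3/2 * max B M"] B by simp
qed

section \<open>Resolvent estimates and trigonometric polynomials\<close>

lemma resolvent_upper_bound:
  assumes v: "axis_diff2 v" "continuous_on UNIV v" and B: "\<And>x. v x \<le> B" and s: "s > 0"
    and C: "\<And>x. v x - s * lap v x \<le> C"
  shows "v x \<le> C"
proof -
  have "C - v x \<ge> 0"
  proof (rule max_principle[where w="\<lambda>x. C - v x" and c="1/s" and B="B - C"])
    show "axis_diff2 (\<lambda>x. C - v x)" by (intro axis_diff2_diff axis_diff2_const v)
    show "continuous_on UNIV (\<lambda>x. C - v x)" by (intro continuous_intros v)
    show "lap (\<lambda>x. C - v x) x \<le> 1/s * (C - v x)" for x
      using C[of x] s by (simp add: lap_diff axis_diff2_const v lap_const field_simps)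
  qed (use B s in auto)
  then show ?thesis by simp
qed

lemma resolvent_abs_bound:
  assumes v: "axis_diff2 v" "continuous_on UNIV v" and B: "\<And>x. \<bar>v x\<bar> \<le> B" and s: "s > 0"
    and C: "\<And>x. \<bar>v x - s * lap v x\<bar> \<le> C"
  shows "\<bar>v x\<bar> \<le> C"
proof -
  have "v x \<le> C"
    by (rule resolvent_upper_bound[OF v _ s, where B=B]) (use B C in \<open>auto simp: abs_le_iff\<close>)
  moreover have "-1 * v x \<le> C"
  proof (rule resolvent_upper_bound[OF _ _ _ s, where B=B])
    show "axis_diff2 (\<lambda>x. -1 * v x)" by (rule axis_diff2_cmult[OF v(1)])
    show "continuous_on UNIV (\<lambda>x. -1 * v x)" by (intro continuous_intros v)
    show "-1 * v x \<le> B" for x using B[of x] by (simp add: abs_le_iff)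
    show "-1 * v x - s * lap (\<lambda>x. -1 * v x) x \<le> C" for x
      using C[of x] lap_cmult[OF v(1), of "-1" x] by (simp add: abs_le_iff)
  qed
  ultimately show ?thesis by (simp add: abs_le_iff)
qed

lemma deriv_le_of_symmetric_difference:
  fixes g :: "real \<Rightarrow> real"
  assumes g: "(g has_real_derivative p) (at 0)" and r: "r > 0"
    and K: "\<And>h. 0 < h \<Longrightarrow> h < r \<Longrightarrow> g h - g (- h) \<le> K * h"
  shows "p \<le> K / 2"
proof -
  have "((\<lambda>h. g (- h)) has_real_derivative - p) (at 0)"
    using g DERIV_mirror[of g p 0] by simp
  then have "((\<lambda>h. g h - g (- h)) has_real_derivative (p - - p)) (at 0)"
    using g by (intro DERIV_diff)
  then have "((\<lambda>h. (g h - g (- h)) / h) \<longlongrightarrow> 2 * p) (at 0)"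
    by (simp add: DERIV_def)
  then have lim: "((\<lambda>h. (g h - g (- h)) / h) \<longlongrightarrow> 2 * p) (at_right 0)"
    by (rule filterlim_mono) (auto simp: at_within_le_at)
  have "eventually (\<lambda>h. (g h - g (- h)) / h \<le> K) (at_right 0)"
    unfolding eventually_at_right_field
    using K r by (intro exI[of _ r]) (auto simp: pos_divide_le_eq)
  from tendsto_upperbound[OF lim this] show ?thesis by simp
qed

lemma resolvent_gradient_upper:
  assumes pq: "axis_derivs v p q" and v: "continuous_on UNIV v" "periodic1 v" and s: "s > 0"
    and f: "\<And>x. f x = v x - s * lap v x"
    and D: "\<And>x h. 0 \<le> h \<Longrightarrow> h \<le> sqrt s \<Longrightarrow> \<bar>f (x + ray i h) - f (x - ray i h)\<bar> \<le> D"
  shows "p i x \<le> D / sqrt s"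
proof -
  have ax: "axis_diff2 v" using pq unfolding axis_diff2_def by blast
  obtain B where B: "\<And>x. \<bar>v x\<bar> \<le> B" using periodic_bounded[OF v(2,1)] by blast
  have D0: "D \<ge> 0" using D[of 0 0] s by simp
  have vd: "\<bar>v (x + ray i h) - v (x - ray i h)\<bar> \<le> D" if h: "0 \<le> h" "h \<le> sqrt s" for x h
  proof -
    define w where "w = (\<lambda>x. v (x + ray i h) - v (x + ray i (- h)))"
    have "\<bar>w x\<bar> \<le> D"
    proof (rule resolvent_abs_bound[OF _ _ _ s, where B="B + B"])
      show "axis_diff2 w" unfolding w_def by (intro axis_diff2_diff axis_diff2_translate ax)
      show "continuous_on UNIV w" unfolding w_def
        by (intro continuous_intros continuous_on_compose2[OF v(1)]) auto
      show "\<bar>w x\<bar> \<le> B + B" for x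
        using B[of "x + ray i h"] B[of "x + ray i (- h)"] unfolding w_def by linarith
      fix x
      have "lap w x = lap v (x + ray i h) - lap v (x + ray i (- h))"
        unfolding w_def by (simp only: lap_diff axis_diff2_translate ax lap_translate)
      then have "w x - s * lap w x = f (x + ray i h) - f (x - ray i h)"
        by (simp add: f right_diff_distrib) (simp add: w_def)
      then show "\<bar>w x - s * lap w x\<bar> \<le> D" using D[OF h] by simp
    qed
    then show ?thesis by (simp add: w_def)
  qed
  have dbl: "v (x + ray i h) - v (x - ray i h) \<le> (D / sqrt s + (2 * D / s) / 2 * sqrt s) * h"
    if h: "0 \<le> h" "h \<le> sqrt s" for x h
  proof (rule doubling_estimate[OF ax v _ _ _ _ h])
    show "v (x + ray i (sqrt s)) - v (x - ray i (sqrt s)) \<le> D" for x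
      using vd[of "sqrt s" x] s by (simp add: abs_le_iff)
    show "- (2 * D / s) \<le> lap v (x + ray i h) - lap v (x - ray i h)"
      if "0 < h" "h < sqrt s" for x h
    proof -
      have l: "lap v y = (v y - f y) / s" for y using f[of y] s by (simp add: field_simps)
      have "- (2 * D) \<le> (v (x + ray i h) - f (x + ray i h)) - (v (x - ray i h) - f (x - ray i h))"
        using vd[of h x] D[of h x] that by (auto simp: abs_le_iff)
      from divide_right_mono[OF this, of s] s show ?thesis by (simp add: l diff_divide_distrib)
    qed
  qed (use s D0 in auto)
  have "(2 * D / s) / 2 * sqrt s = D / sqrt s"
    using s by (simp add: field_simps)
  then have "D / sqrt s + (2 * D / s) / 2 * sqrt s = 2 * D / sqrt s" by simp
  then have "v (x + ray i h) - v (x - ray i h) \<le> (2 * D / sqrt s) * h"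
    if "0 \<le> h" "h \<le> sqrt s" for x h
    using dbl[OF that, of x] by (simp only:)
  then have "p i x \<le> (2 * D / sqrt s) / 2"
    using axis_derivs_first[OF pq, of x i 0] s
    by (intro deriv_le_of_symmetric_difference[where r="sqrt s" and g="\<lambda>t. v (x + ray i t)"]) auto
  then show ?thesis by simp
qed

lemma resolvent_gradient:
  assumes pq: "axis_derivs v p q" and v: "continuous_on UNIV v" "periodic1 v" and s: "s > 0"
    and f: "\<And>x. f x = v x - s * lap v x"
    and D: "\<And>x h. 0 \<le> h \<Longrightarrow> h \<le> sqrt s \<Longrightarrow> \<bar>f (x + ray i h) - f (x - ray i h)\<bar> \<le> D"
  shows "\<bar>p i x\<bar> \<le> D / sqrt s"
proof -
  have ax: "axis_diff2 v" using pq unfolding axis_diff2_def by blast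
  have "-1 * p i x \<le> D / sqrt s"
  proof (rule resolvent_gradient_upper[OF axis_derivs_cmult[OF pq, of "-1"] _ _ s, where f="\<lambda>x. -1 * f x"])
    show "continuous_on UNIV (\<lambda>x. -1 * v x)" by (intro continuous_intros v)
    show "periodic1 (\<lambda>x. -1 * v x)" using v(2) by (simp add: periodic1_def)
    show "-1 * f x = -1 * v x - s * lap (\<lambda>x. -1 * v x) x" for x
      using lap_cmult[OF ax, of "-1" x] f[of x] by simp
    show "\<bar>-1 * f (x + ray i h) - -1 * f (x - ray i h)\<bar> \<le> D" if "0 \<le> h" "h \<le> sqrt s" for x h
      using D[OF that, of x] by (simp add: abs_le_iff)
  qed
  moreover have "p i x \<le> D / sqrt s" by (rule resolvent_gradient_upper[OF pq v s f D])
  ultimately show ?thesis by (simp add: abs_le_iff)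
qed

type_synonym 'n trig_terms = "(real \<times> (real^'n) \<times> real) list"

definition trig :: "'n::finite trig_terms \<Rightarrow> real^'n \<Rightarrow> real" where
  "trig ts x = (\<Sum>(a, k, \<theta>)\<leftarrow>ts. a * cos (k \<bullet> x + \<theta>))"

definition trig_wf :: "'n::finite trig_terms \<Rightarrow> bool" where
  "trig_wf ts \<longleftrightarrow> (\<forall>(a, k, \<theta>)\<in>set ts. \<forall>i. \<exists>m::int. k $ i = 2 * pi * of_int m)"

definition multiplier :: "(real^'n \<Rightarrow> real) \<Rightarrow> 'n::finite trig_terms \<Rightarrow> 'n trig_terms" where
  "multiplier w ts = map (\<lambda>(a, k, \<theta>). (w k * a, k, \<theta>)) ts"

definition trig_deriv :: "'n \<Rightarrow> 'n::finite trig_terms \<Rightarrow> 'n trig_terms" where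
  "trig_deriv i ts = map (\<lambda>(a, k, \<theta>). (a * k $ i, k, \<theta> + pi / 2)) ts"

lemma trig_Nil: "trig [] x = 0"
  and trig_Cons: "trig ((a, k, \<theta>) # ts) x = a * cos (k \<bullet> x + \<theta>) + trig ts x"
  and trig_append: "trig (ts @ us) x = trig ts x + trig us x"
  by (auto simp: trig_def)

lemma trig_wf_append: "trig_wf (ts @ us) \<longleftrightarrow> trig_wf ts \<and> trig_wf us"
  unfolding trig_wf_def set_append by blast

lemma trig_wf_multiplier: "trig_wf ts \<Longrightarrow> trig_wf (multiplier w ts)"
  by (fastforce simp: trig_wf_def multiplier_def)

lemma trig_wf_deriv: "trig_wf ts \<Longrightarrow> trig_wf (trig_deriv i ts)"
  by (fastforce simp: trig_wf_def trig_deriv_def)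

lemma multiplier_multiplier: "multiplier w (multiplier v ts) = multiplier (\<lambda>k. w k * v k) ts"
  by (auto simp: multiplier_def)

lemma trig_deriv_multiplier: "trig_deriv i (multiplier w ts) = multiplier w (trig_deriv i ts)"
  by (auto simp: multiplier_def trig_deriv_def)

lemma trig_deriv_append: "trig_deriv i (ts @ us) = trig_deriv i ts @ trig_deriv i us"
  and multiplier_append: "multiplier w (ts @ us) = multiplier w ts @ multiplier w us"
  by (auto simp: multiplier_def trig_deriv_def)

lemma trig_multiplier_linear:
  "trig (multiplier (\<lambda>k. c * w k + d * v k) ts) x
    = c * trig (multiplier w ts) x + d * trig (multiplier v ts) x"
  by (induction ts) (auto simp: multiplier_def trig_def algebra_simps)

lemma trig_multiplier_const: "trig (multiplier (\<lambda>k. c) ts) x = c * trig ts x"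
  by (induction ts) (auto simp: multiplier_def trig_def algebra_simps)

lemma inner_cart_sum: "k \<bullet> h = (\<Sum>i\<in>UNIV. k $ i * h $ i)" for k h :: "real^'n"
  by (simp add: inner_vec_def)

lemma trig_has_derivative:
  "(trig ts has_derivative (\<lambda>h. \<Sum>i\<in>UNIV. trig (trig_deriv i ts) x * h $ i)) (at x)"
proof (induction ts)
  case Nil
  have "trig [] = (\<lambda>x. 0)" by (simp add: trig_Nil fun_eq_iff)
  then show ?case by (simp add: trig_deriv_def trig_Nil)
next
  case (Cons t ts)
  obtain a k \<theta> where t: "t = (a, k, \<theta>)" by (cases t) auto
  have "trig (t # ts) = (\<lambda>x. a * cos (k \<bullet> x + \<theta>) + trig ts x)"
    by (simp add: trig_Cons t fun_eq_iff)
  moreover have "((\<lambda>x. a * cos (k \<bullet> x + \<theta>)) has_derivative (\<lambda>h. a * (- sin (k \<bullet> x + \<theta>) * (k \<bullet> h)))) (at x)"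
    by (auto intro!: derivative_eq_intros)
  moreover have "a * (- sin (k \<bullet> x + \<theta>) * (k \<bullet> h)) = (\<Sum>i\<in>UNIV. (a * k $ i * cos (k \<bullet> x + (\<theta> + pi / 2))) * h $ i)" for h
    unfolding add.assoc[symmetric] cos_add inner_cart_sum[of k h]
    by (simp add: sum_distrib_left mult_ac)
  ultimately have "(trig (t # ts) has_derivative (\<lambda>h. (\<Sum>i\<in>UNIV. (a * k $ i * cos (k \<bullet> x + (\<theta> + pi / 2))) * h $ i) +
      (\<Sum>i\<in>UNIV. trig (trig_deriv i ts) x * h $ i))) (at x)"
    using has_derivative_add[OF _ Cons] by simp
  moreover have "trig (trig_deriv i (t # ts)) x =
      a * k $ i * cos (k \<bullet> x + (\<theta> + pi / 2)) + trig (trig_deriv i ts) x" for i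
    by (simp add: t trig_deriv_def trig_Cons)
  ultimately show ?case by (simp add: distrib_right sum.distrib)
qed

lemma trig_continuous: "continuous_on UNIV (trig ts)"
  by (meson trig_has_derivative continuous_at_imp_continuous_on has_derivative_continuous)

lemma trig_axis_derivs:
  "axis_derivs (trig ts) (\<lambda>i. trig (trig_deriv i ts)) (\<lambda>i. trig (trig_deriv i (trig_deriv i ts)))"
proof -
  have "((\<lambda>t. trig ts (x + ray i t)) has_real_derivative trig (trig_deriv i ts) x) (at 0)"
    for ts and x :: "real^'a" and i
  proof -
    have "(\<Sum>j\<in>UNIV. trig (trig_deriv j ts) x * axis i 1 $ j) = trig (trig_deriv i ts) x"
      by (simp add: axis_def if_distrib cong: if_cong)
    then show ?thesis using has_derivative_along_axis[OF trig_has_derivative[of ts x], of i]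
      by (simp add: has_real_derivative_iff_has_vector_derivative)
  qed
  then show ?thesis unfolding axis_derivs_def by blast
qed

lemma trig_axis_diff2: "axis_diff2 (trig ts)"
  unfolding axis_diff2_def using trig_axis_derivs by blast

lemma trig_deriv_deriv:
  "trig (trig_deriv i (trig_deriv i ts)) x = - trig (multiplier (\<lambda>k. (k $ i)\<^sup>2) ts) x"
  by (induction ts)
    (auto simp: trig_deriv_def trig_def multiplier_def cos_add sin_add power2_eq_square algebra_simps)

lemma trig_lap: "lap (trig ts) x = - trig (multiplier (\<lambda>k. k \<bullet> k) ts) x"
proof -
  have "(\<Sum>i\<in>UNIV. trig (multiplier (\<lambda>k. (k $ i)\<^sup>2) ts) x) = trig (multiplier (\<lambda>k. k \<bullet> k) ts) x"
    by (induction ts)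
      (auto simp: trig_def multiplier_def sum.distrib inner_cart_sum power2_eq_square sum_distrib_right)
  then show ?thesis
    by (simp add: axis_derivs_lap[OF trig_axis_derivs] trig_deriv_deriv sum_negf)
qed

lemma trig_periodic:
  fixes ts :: "'n::finite trig_terms"
  assumes "trig_wf ts" shows "periodic1 (trig ts)"
  unfolding periodic1_def
proof (intro allI)
  fix x :: "real^'n" and i
  show "trig ts (x + axis i 1) = trig ts x"
    using assms
  proof (induction ts)
    case (Cons t ts)
    obtain a k \<theta> where t: "t = (a, k, \<theta>)" by (cases t) auto
    obtain m :: int where m: "k $ i = 2 * pi * of_int m" using Cons.prems t by (auto simp: trig_wf_def dest: spec[of _ i])
    have "cos (k \<bullet> (x + axis i 1) + \<theta>) = cos ((k \<bullet> x + \<theta>) + 2 * pi * of_int m)"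
      by (simp add: inner_add_right inner_axis m algebra_simps)
    also have "\<dots> = cos (k \<bullet> x + \<theta>)" unfolding cos_add[of _ "2 * pi * of_int m"] by simp
    finally show ?case using Cons by (auto simp: t trig_Cons trig_wf_def)
  qed (simp add: trig_Nil)
qed

definition resolvent :: "real \<Rightarrow> 'n::finite trig_terms \<Rightarrow> 'n trig_terms" where
  "resolvent s = multiplier (\<lambda>k. 1 / (1 + s * (k \<bullet> k)))"

lemma resolvent_eq:
  assumes "s > 0"
  shows "trig (resolvent s ts) x - s * lap (trig (resolvent s ts)) x = trig ts x"
proof -
  have "trig (resolvent s ts) x + s * trig (multiplier (\<lambda>k. k \<bullet> k) (resolvent s ts)) x =
      trig (multiplier (\<lambda>k. 1 * (1 / (1 + s * (k \<bullet> k))) + s * (k \<bullet> k * (1 / (1 + s * (k \<bullet> k))))) ts) x"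
    unfolding resolvent_def multiplier_multiplier trig_multiplier_linear by simp
  also have "(\<lambda>k. 1 * (1 / (1 + s * (k \<bullet> k))) + s * (k \<bullet> k * (1 / (1 + s * (k \<bullet> k))))) = (\<lambda>k::real^'a. 1)"
  proof
    fix k :: "real^'a"
    have "1 + s * (k \<bullet> k) > 0" using assms by (simp add: add_pos_nonneg)
    then show "1 * (1 / (1 + s * (k \<bullet> k))) + s * (k \<bullet> k * (1 / (1 + s * (k \<bullet> k)))) = 1"
      by (simp add: field_simps)
  qed
  finally show ?thesis by (simp add: trig_lap trig_multiplier_const)
qed

lemma trig_wf_resolvent: "trig_wf ts \<Longrightarrow> trig_wf (resolvent s ts)"
  unfolding resolvent_def by (rule trig_wf_multiplier)

lemma resolvent_trig_bound:
  assumes "trig_wf ts" "s > 0" "\<And>x. \<bar>trig ts x\<bar> \<le> C"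
  shows "\<bar>trig (resolvent s ts) x\<bar> \<le> C"
proof -
  obtain B where "\<And>x. \<bar>trig (resolvent s ts) x\<bar> \<le> B"
    using periodic_bounded[OF trig_periodic[OF trig_wf_resolvent[OF assms(1)]] trig_continuous] by blast
  from resolvent_abs_bound[OF trig_axis_diff2 trig_continuous this assms(2), of C x]
  show ?thesis using assms by (simp add: resolvent_eq)
qed

lemma resolvent_trig_gradient:
  assumes "trig_wf ts" "s > 0"
    "\<And>x h. 0 \<le> h \<Longrightarrow> h \<le> sqrt s \<Longrightarrow> \<bar>trig ts (x + ray i h) - trig ts (x - ray i h)\<bar> \<le> D"
  shows "\<bar>trig (trig_deriv i (resolvent s ts)) x\<bar> \<le> D / sqrt s"
  by (rule resolvent_gradient[OF trig_axis_derivs trig_continuous trig_periodic, where f="trig ts"])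
    (use assms in \<open>auto simp: resolvent_eq trig_wf_resolvent\<close>)

lemma resolvent_trig_gradient_sup:
  assumes "trig_wf ts" "s > 0" "\<And>x. \<bar>trig ts x\<bar> \<le> C"
  shows "\<bar>trig (trig_deriv i (resolvent s ts)) x\<bar> \<le> 2 * C / sqrt s"
proof (rule resolvent_trig_gradient[OF assms(1,2)])
  fix x h
  show "\<bar>trig ts (x + ray i h) - trig ts (x - ray i h)\<bar> \<le> 2 * C"
    using assms(3)[of "x + ray i h"] assms(3)[of "x - ray i h"] by linarith
qed

definition is_trig :: "(real^'n \<Rightarrow> real) \<Rightarrow> bool" where
  "is_trig f \<longleftrightarrow> (\<exists>ts. trig_wf ts \<and> f = trig ts)"

lemma is_trig_term:
  fixes k :: "real^'n"
  assumes "\<And>i. \<exists>m::int. k $ i = 2 * pi * of_int m"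
  shows "is_trig (\<lambda>x. a * cos (k \<bullet> x + \<theta>))"
  unfolding is_trig_def
  by (intro exI[of _ "[(a, k, \<theta>)]"]) (use assms in \<open>auto simp: trig_wf_def trig_Cons trig_Nil\<close>)

lemma is_trig_const: "is_trig (\<lambda>x::real^'n. c)"
proof -
  have "is_trig (\<lambda>x::real^'n. c * cos (0 \<bullet> x + 0))"
    by (rule is_trig_term) (auto intro: exI[of _ 0])
  then show ?thesis by simp
qed

lemma is_trig_cos_sin:
  fixes j :: "'n::finite"
  shows "is_trig (\<lambda>x. cos (2 * pi * x $ j))" "is_trig (\<lambda>x. sin (2 * pi * x $ j))"
proof -
  have k: "\<exists>m::int. ((2 * pi) *\<^sub>R axis j 1) $ i = 2 * pi * of_int m" for i
    by (intro exI[of _ "if i = j then 1 else 0"]) (simp add: axis_def)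
  have i: "((2 * pi) *\<^sub>R axis j 1) \<bullet> x = 2 * pi * x $ j" for x :: "real^'n"
    by (simp add: inner_axis')
  show "is_trig (\<lambda>x. cos (2 * pi * x $ j))"
    using is_trig_term[OF k, of 1 0] by (simp add: i del: inner_scaleR_left)
  show "is_trig (\<lambda>x. sin (2 * pi * x $ j))"
    using is_trig_term[OF k, of 1 "- pi / 2"] by (simp add: i cos_diff del: inner_scaleR_left)
qed

lemma is_trig_add:
  assumes "is_trig f" "is_trig g" shows "is_trig (\<lambda>x. f x + g x)"
proof -
  obtain ts us where "trig_wf ts" "f = trig ts" "trig_wf us" "g = trig us"
    using assms unfolding is_trig_def by blast
  then show ?thesis unfolding is_trig_def
    by (intro exI[of _ "ts @ us"]) (simp add: trig_wf_append trig_append fun_eq_iff)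
qed

lemma is_trig_cmult:
  assumes "is_trig f" shows "is_trig (\<lambda>x. c * f x)"
proof -
  obtain ts where "trig_wf ts" "f = trig ts" using assms unfolding is_trig_def by blast
  then show ?thesis unfolding is_trig_def
    by (intro exI[of _ "multiplier (\<lambda>k. c) ts"]) (simp add: trig_wf_multiplier trig_multiplier_const fun_eq_iff)
qed

lemma is_trig_sum:
  "finite S \<Longrightarrow> (\<And>j. j \<in> S \<Longrightarrow> is_trig (f j)) \<Longrightarrow> is_trig (\<lambda>x. \<Sum>j\<in>S. f j x)"
  by (induction S rule: finite_induct) (auto intro: is_trig_const is_trig_add)

lemma is_trig_mult:
  fixes f g :: "real^'n \<Rightarrow> real"
  assumes "is_trig f" "is_trig g" shows "is_trig (\<lambda>x. f x * g x)"
proof -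
  have terms: "is_trig (\<lambda>x. (a * cos (k \<bullet> x + \<theta>)) * (b * cos (l \<bullet> x + \<phi>)))"
    if k: "\<forall>i. \<exists>m::int. k $ i = 2 * pi * of_int m" and l: "\<forall>i. \<exists>m::int. l $ i = 2 * pi * of_int m"
    for a b \<theta> \<phi> and k l :: "real^'n"
  proof -
    have "\<exists>m::int. (k - l) $ i = 2 * pi * of_int m" "\<exists>m::int. (k + l) $ i = 2 * pi * of_int m" for i
    proof -
      obtain m n :: int where "k $ i = 2 * pi * of_int m" "l $ i = 2 * pi * of_int n" using k l by blast
      then have "(k - l) $ i = 2 * pi * of_int (m - n)" "(k + l) $ i = 2 * pi * of_int (m + n)"
        by (simp_all add: algebra_simps)
      then show "\<exists>m::int. (k - l) $ i = 2 * pi * of_int m" "\<exists>m::int. (k + l) $ i = 2 * pi * of_int m"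
        by blast+
    qed
    then have "is_trig (\<lambda>x. (a * b / 2) * cos ((k - l) \<bullet> x + (\<theta> - \<phi>)) + (a * b / 2) * cos ((k + l) \<bullet> x + (\<theta> + \<phi>)))"
      by (intro is_trig_add is_trig_term)
    moreover have "(a * b / 2) * cos ((k - l) \<bullet> x + (\<theta> - \<phi>)) + (a * b / 2) * cos ((k + l) \<bullet> x + (\<theta> + \<phi>))
        = (a * cos (k \<bullet> x + \<theta>)) * (b * cos (l \<bullet> x + \<phi>))" for x
    proof -
      have 1: "(k - l) \<bullet> x + (\<theta> - \<phi>) = (k \<bullet> x + \<theta>) - (l \<bullet> x + \<phi>)"
        and 2: "(k + l) \<bullet> x + (\<theta> + \<phi>) = (k \<bullet> x + \<theta>) + (l \<bullet> x + \<phi>)"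
        by (simp_all add: inner_diff_left inner_add_left)
      show ?thesis unfolding 1 2 cos_diff[of "k \<bullet> x + \<theta>"] cos_add[of "k \<bullet> x + \<theta>"] by (simp add: field_simps)
    qed
    ultimately show ?thesis by simp
  qed
  have one: "is_trig (\<lambda>x. (a * cos (k \<bullet> x + \<theta>)) * trig us x)"
    if k: "\<forall>i. \<exists>m::int. k $ i = 2 * pi * of_int m" and us: "trig_wf us" for a \<theta> us and k :: "real^'n"
    using us
  proof (induction us)
    case Nil
    then show ?case by (simp add: trig_Nil is_trig_const)
  next
    case (Cons t us)
    obtain b l \<phi> where t: "t = (b, l, \<phi>)" by (cases t) auto
    have "\<forall>i. \<exists>m::int. l $ i = 2 * pi * of_int m" "trig_wf us"
      using Cons.prems t by (auto simp: trig_wf_def)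
    from is_trig_add[OF terms[OF k this(1), of a \<theta> b \<phi>] Cons.IH[OF this(2)]]
    show ?case by (simp add: t trig_Cons distrib_left)
  qed
  have "is_trig (\<lambda>x. trig ts x * trig us x)" if "trig_wf ts" "trig_wf us" for ts us :: "'n trig_terms"
    using that
  proof (induction ts)
    case Nil
    then show ?case by (simp add: trig_Nil is_trig_const)
  next
    case (Cons t ts)
    obtain b l \<phi> where t: "t = (b, l, \<phi>)" by (cases t) auto
    have "\<forall>i. \<exists>m::int. l $ i = 2 * pi * of_int m" "trig_wf ts"
      using Cons.prems t by (auto simp: trig_wf_def)
    from is_trig_add[OF one[OF this(1) Cons.prems(2), of b \<phi>] Cons.IH[OF this(2) Cons.prems(2)]]
    show ?case by (simp add: t trig_Cons distrib_right)
  qed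
  then show ?thesis using assms unfolding is_trig_def[of f] is_trig_def[of g] by auto
qed

definition torus_map :: "real^'n \<Rightarrow> (real^'n) \<times> (real^'n)" where
  "torus_map x = ((\<chi> j. cos (2 * pi * x $ j)), (\<chi> j. sin (2 * pi * x $ j)))"

lemma torus_map_eqD:
  assumes "torus_map x = torus_map y" "periodic1 f" shows "f x = f y"
proof -
  have "(x - y) $ j \<in> \<int>" for j
  proof -
    have "cos (2 * pi * x $ j) = cos (2 * pi * y $ j)" "sin (2 * pi * x $ j) = sin (2 * pi * y $ j)"
      using assms(1) by (auto simp: torus_map_def vec_eq_iff)
    then obtain m :: int where "2 * pi * x $ j = 2 * pi * y $ j + 2 * pi * of_int m"
      using sin_cos_eq_iff[of "2 * pi * x $ j" "2 * pi * y $ j"] by (auto simp: mult_ac)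
    then have "2 * pi * (x $ j - y $ j) = 2 * pi * of_int m" by (simp add: algebra_simps)
    then show ?thesis by simp
  qed
  then show ?thesis using periodic1_shift[OF assms(2), of "x - y" y] by simp
qed

lemma is_trig_polynomial_torus_map:
  assumes "real_polynomial_function g" shows "is_trig (\<lambda>x. g (torus_map x))"
  using assms
proof (induction g rule: real_polynomial_function.induct)
  case (linear g)
  then have l: "linear g" by (rule bounded_linear.linear)
  have "g (torus_map x) = (\<Sum>j\<in>UNIV. g (axis j 1, 0) * cos (2 * pi * x $ j)) + (\<Sum>j\<in>UNIV. g (0, axis j 1) * sin (2 * pi * x $ j))" for x
  proof -
    have v: "v = (\<Sum>j\<in>UNIV. v $ j *\<^sub>R axis j 1)" for v :: "real^'a"
      using basis_expansion[of v] by (simp add: scalar_mult_eq_scaleR)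
    have "(\<Sum>j\<in>S. (a j *\<^sub>R axis j (1::real), b j *\<^sub>R axis j (1::real))) = ((\<Sum>j\<in>S. a j *\<^sub>R axis j 1), (\<Sum>j\<in>S. b j *\<^sub>R axis j 1))"
      for S :: "'a set" and a b :: "'a \<Rightarrow> real"
      by (induction S rule: infinite_finite_induct) (auto simp: zero_prod_def)
    then have "torus_map x = (\<Sum>j\<in>UNIV. (cos (2 * pi * x $ j) *\<^sub>R axis j 1, sin (2 * pi * x $ j) *\<^sub>R axis j 1))"
      unfolding torus_map_def
      using v[of "\<chi> j. cos (2 * pi * x $ j)"] v[of "\<chi> j. sin (2 * pi * x $ j)"] by simp
    also have "\<dots> = (\<Sum>j\<in>UNIV. cos (2 * pi * x $ j) *\<^sub>R (axis j 1, 0) + sin (2 * pi * x $ j) *\<^sub>R (0, axis j 1))"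
      by simp
    finally show ?thesis
      by (simp only: linear_sum[OF l] linear_add[OF l] linear_scale[OF l] sum.distrib real_scaleR_def mult.commute)
  qed
  moreover have "is_trig (\<lambda>x. (\<Sum>j\<in>UNIV. g (axis j 1, 0) * cos (2 * pi * x $ j)) + (\<Sum>j\<in>UNIV. g (0, axis j 1) * sin (2 * pi * x $ j)))"
    by (intro is_trig_add is_trig_sum is_trig_cmult is_trig_cos_sin) auto
  ultimately show ?case by simp
qed (auto intro: is_trig_const is_trig_add is_trig_mult)

lemma trig_dense:
  fixes f :: "real^'n \<Rightarrow> real"
  assumes f: "periodic1 f" "continuous_on UNIV f" and e: "e > 0"
  obtains ts where "trig_wf ts" "\<And>x. \<bar>f x - trig ts x\<bar> < e"
proof -
  define S where "S = torus_map ` (unit_cell :: (real^'n) set)"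
  define F where "F z = f (SOME x. torus_map x = z)" for z
  have F: "F (torus_map x) = f x" for x
    unfolding F_def by (rule torus_map_eqD[OF _ f(1)]) (rule someI[of _ x], simp)
  have tc: "continuous_on unit_cell torus_map"
    unfolding torus_map_def by (intro continuous_intros)
  have "compact S" unfolding S_def by (rule compact_continuous_image[OF tc compact_unit_cell])
  moreover have "continuous_on S F"
    unfolding continuous_on_open
  proof (intro allI impI)
    fix B assume B: "openin (top_of_set (F ` S)) B"
    have im: "F ` S = f ` unit_cell" unfolding S_def image_image F ..
    have "openin (top_of_set unit_cell) (unit_cell \<inter> f -` B)"
      using B unfolding im
      using continuous_on_subset[OF f(2), of unit_cell] unfolding continuous_on_open by blast
    moreover have "unit_cell \<inter> f -` B = unit_cell \<inter> torus_map -` (S \<inter> F -` B)"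
      by (auto simp: S_def F) (metis F)
    ultimately show "openin (top_of_set S) (S \<inter> F -` B)"
      using Abstract_Topology_2.continuous_imp_quotient_map[OF tc S_def[symmetric] compact_unit_cell, of "S \<inter> F -` B"] by simp
  qed
  ultimately obtain g where g: "real_polynomial_function g" "\<And>z. z \<in> S \<Longrightarrow> \<bar>F z - g z\<bar> < e"
    using Stone_Weierstrass_real_polynomial_function[of S F e] e by blast
  obtain ts where ts: "trig_wf ts" "(\<lambda>x. g (torus_map x)) = trig ts"
    using is_trig_polynomial_torus_map[OF g(1)] unfolding is_trig_def by blast
  have "\<bar>f x - trig ts x\<bar> < e" for x
  proof -
    obtain y where y: "y \<in> unit_cell" "\<And>u z. periodic1 u \<Longrightarrow> u (x + z) = u (y + z)"
      using unit_cell_representative[of x] by blast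
    have "f x = f y" "trig ts x = trig ts y"
      using y(2)[OF f(1), of 0] y(2)[OF trig_periodic[OF ts(1)], of 0] by auto
    moreover have "\<bar>F (torus_map y) - g (torus_map y)\<bar> < e" using g(2) y(1) by (auto simp: S_def)
    moreover have "g (torus_map y) = trig ts y" using ts(2) by metis
    ultimately show ?thesis by (simp add: F)
  qed
  then show ?thesis using that ts(1) by blast
qed

lemma uniform_limit_geometric:
  fixes g :: "nat \<Rightarrow> 'a \<Rightarrow> real"
  assumes "0 \<le> \<theta>" "\<theta> < 1" "\<And>n x. \<bar>g (Suc n) x - g n x\<bar> \<le> A * \<theta> ^ n"
  obtains l where "uniform_limit UNIV g l sequentially"
proof -
  have "summable (\<lambda>n. A * \<theta> ^ n)" using assms by (intro summable_mult summable_geometric) auto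
  then have "uniform_limit UNIV (\<lambda>n x. \<Sum>k<n. g (Suc k) x - g k x) (\<lambda>x. \<Sum>k. g (Suc k) x - g k x) sequentially"
    using assms(3) by (intro Weierstrass_m_test[where M="\<lambda>n. A * \<theta> ^ n"]) auto
  then have "uniform_limit UNIV (\<lambda>n x. g 0 x + (\<Sum>k<n. g (Suc k) x - g k x)) (\<lambda>x. g 0 x + (\<Sum>k. g (Suc k) x - g k x)) sequentially"
    by (intro uniform_limit_intros)
  moreover have "g 0 x + (\<Sum>k<n. g (Suc k) x - g k x) = g n x" for n x
    using sum_lessThan_telescope[of "\<lambda>k. g k x" n] by simp
  ultimately show ?thesis using that by simp
qed

lemma has_derivative_uniform_limit:
  fixes g :: "nat \<Rightarrow> real^'n \<Rightarrow> real"
  assumes d: "\<And>n x. (g n has_derivative (\<lambda>h. \<Sum>i\<in>UNIV. G n i x * h $ i)) (at x)"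
    and P: "\<And>i. uniform_limit UNIV (\<lambda>n. G n i) (P i) sequentially"
    and l: "\<And>x. (\<lambda>n. g n x) \<longlonglongrightarrow> l x"
  shows "(l has_derivative (\<lambda>h. \<Sum>i\<in>UNIV. P i x * h $ i)) (at x)"
proof -
  have "\<exists>g'. \<forall>x\<in>UNIV. (\<lambda>n. g n x) \<longlonglongrightarrow> g' x \<and> (g' has_derivative (\<lambda>h. \<Sum>i\<in>UNIV. P i x * h $ i)) (at x within UNIV)"
  proof (rule has_derivative_sequence[where f'="\<lambda>n x h. \<Sum>i\<in>UNIV. G n i x * h $ i" and ?x0.0=0 and l="l 0"])
    fix e :: real assume e: "e > 0"
    define e' where "e' = e / real CARD('n)"
    have e': "e' > 0" using e by (simp add: e'_def)
    have "\<forall>\<^sub>F n in sequentially. \<forall>i\<in>UNIV. \<forall>x\<in>UNIV. dist (G n i x) (P i x) < e'"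
      using P e' by (intro eventually_ball_finite) (auto simp: uniform_limit_iff)
    then show "\<forall>\<^sub>F n in sequentially. \<forall>x\<in>UNIV. \<forall>h. norm ((\<Sum>i\<in>UNIV. G n i x * h $ i) - (\<Sum>i\<in>UNIV. P i x * h $ i)) \<le> e * norm h"
    proof (rule eventually_mono, intro ballI allI)
      fix n and x h :: "real^'n"
      assume A: "\<forall>i\<in>UNIV. \<forall>x\<in>UNIV. dist (G n i x) (P i x) < e'"
      have "norm ((\<Sum>i\<in>UNIV. G n i x * h $ i) - (\<Sum>i\<in>UNIV. P i x * h $ i)) = \<bar>\<Sum>i\<in>UNIV. (G n i x - P i x) * h $ i\<bar>"
        by (simp add: sum_subtractf left_diff_distrib)
      also have "\<dots> \<le> (\<Sum>i\<in>UNIV. \<bar>(G n i x - P i x) * h $ i\<bar>)" by (rule sum_abs)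
      also have "\<dots> \<le> (\<Sum>i\<in>(UNIV::'n set). e' * norm h)"
      proof (rule sum_mono)
        fix i :: 'n
        have "\<bar>G n i x - P i x\<bar> \<le> e'" using A by (auto simp: dist_real_def intro: less_imp_le)
        then show "\<bar>(G n i x - P i x) * h $ i\<bar> \<le> e' * norm h"
          unfolding abs_mult using e' by (intro mult_mono component_le_norm_cart) auto
      qed
      also have "\<dots> = e * norm h" by (simp add: e'_def)
      finally show "norm ((\<Sum>i\<in>UNIV. G n i x * h $ i) - (\<Sum>i\<in>UNIV. P i x * h $ i)) \<le> e * norm h" .
    qed
  qed (use d l in auto)
  then obtain g' where g': "\<And>x. (\<lambda>n. g n x) \<longlonglongrightarrow> g' x" "\<And>x. (g' has_derivative (\<lambda>h. \<Sum>i\<in>UNIV. P i x * h $ i)) (at x)"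
    by auto
  have "g' = l" using LIMSEQ_unique[OF g'(1) l] by blast
  then show ?thesis using g'(2) by simp
qed

lemma C2_partialsI:
  fixes u :: "real^'n \<Rightarrow> real"
  assumes P: "\<And>x. (u has_derivative (\<lambda>h. \<Sum>i\<in>UNIV. P i x * h $ i)) (at x)"
    and Q: "\<And>i x. (P i has_derivative (\<lambda>h. \<Sum>j\<in>UNIV. Q i j x * h $ j)) (at x)"
    and c: "\<And>i j. continuous_on UNIV (Q i j)"
  shows "C2 u" "lap u x = (\<Sum>i\<in>UNIV. Q i i x)"
proof -
  define b :: "'n \<Rightarrow> 'n \<Rightarrow> (real^'n) \<Rightarrow>\<^sub>L (real^'n)" where "b i j = Blinfun (\<lambda>h. h $ j *\<^sub>R axis i 1)" for i j
  have b: "b i j h = h $ j *\<^sub>R axis i 1" for i j h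
    unfolding b_def by (intro bounded_linear_Blinfun_apply fun_cong[of _ _ h])
      (auto intro!: bounded_linear_intros bounded_linear_vec_nth)
  define q where "q x = (\<Sum>i\<in>UNIV. \<Sum>j\<in>UNIV. Q i j x *\<^sub>R b i j)" for x
  define p where "p x = (\<Sum>i\<in>UNIV. P i x *\<^sub>R axis i (1::real))" for x
  have q: "q x h = (\<Sum>i\<in>UNIV. (\<Sum>j\<in>UNIV. Q i j x * h $ j) *\<^sub>R axis i 1)" for x h
    unfolding q_def by (simp add: blinfun.sum_left blinfun.scaleR_left b scaleR_sum_left)
  have sum_axis: "(\<Sum>i\<in>UNIV. a i *\<^sub>R axis i 1) $ k = a k" for a :: "'n \<Rightarrow> real" and k
    using basis_expansion[of "\<chi> i. a i"] by (simp add: scalar_mult_eq_scaleR)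
  have "p x \<bullet> h = (\<Sum>i\<in>UNIV. P i x * h $ i)" for x h
    unfolding inner_cart_sum p_def sum_axis ..
  then have 1: "(u has_derivative (\<lambda>h. p x \<bullet> h)) (at x)" for x using P by simp
  have 2: "(p has_derivative blinfun_apply (q x)) (at x)" for x
    unfolding p_def[abs_def] q[abs_def]
    by (intro has_derivative_sum has_derivative_scaleR_left Q)
  have 3: "continuous_on UNIV q" unfolding q_def[abs_def] by (intro continuous_intros c)
  show "C2 u" by (rule C2I(1)[OF 1 2 3])
  have "(\<Sum>j\<in>UNIV. Q i j x * axis i 1 $ j) = Q i i x" for i
    by (simp add: axis_def if_distrib cong: if_cong)
  then show "lap u x = (\<Sum>i\<in>UNIV. Q i i x)"
    unfolding axis_derivs_lap[OF C2I(2)[OF 1 2 3]] q sum_axis by (simp only:)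
qed

section \<open>Second-order regularity\<close>

definition trig_minus :: "'n::finite trig_terms \<Rightarrow> 'n trig_terms \<Rightarrow> 'n trig_terms" where
  "trig_minus us ts = us @ multiplier (\<lambda>k. -1) ts"

lemma trig_minus: "trig (trig_minus us ts) x = trig us x - trig ts x"
  by (simp add: trig_minus_def trig_append trig_multiplier_const)

lemma trig_wf_minus: "trig_wf us \<Longrightarrow> trig_wf ts \<Longrightarrow> trig_wf (trig_minus us ts)"
  by (simp add: trig_minus_def trig_wf_append trig_wf_multiplier)

lemma resolvent_trig_minus: "resolvent s (trig_minus us ts) = trig_minus (resolvent s us) (resolvent s ts)"
  by (simp add: trig_minus_def resolvent_def multiplier_append multiplier_multiplier mult.commute)

lemma trig_deriv_trig_minus: "trig_deriv i (trig_minus us ts) = trig_minus (trig_deriv i us) (trig_deriv i ts)"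
  by (simp add: trig_minus_def trig_deriv_append trig_deriv_multiplier)

lemma trig_deriv_resolvent: "trig_deriv i (resolvent s ts) = resolvent s (trig_deriv i ts)"
  by (simp add: resolvent_def trig_deriv_multiplier)

lemma resolvent_difference:
  assumes "\<sigma> > 0" "s > 0" "s' > 0"
  shows "trig (resolvent \<sigma> (resolvent s' ts)) x - trig (resolvent \<sigma> (resolvent s ts)) x
    = (s - s') / \<sigma> * (trig (resolvent s (resolvent s' ts)) x
        - trig (resolvent \<sigma> (resolvent s (resolvent s' ts))) x)"
proof -
  define r where "r t = (\<lambda>k::real^'a. 1 / (1 + t * (k \<bullet> k)))" for t
  have "1 * (r \<sigma> k * r s' k) + (-1) * (r \<sigma> k * r s k) =
      (s - s') / \<sigma> * (r s k * r s' k) + (- ((s - s') / \<sigma>)) * (r \<sigma> k * (r s k * r s' k))" for k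
  proof -
    have "1 + \<sigma> * (k \<bullet> k) > 0" "1 + s * (k \<bullet> k) > 0" "1 + s' * (k \<bullet> k) > 0"
      using assms by (simp_all add: add_pos_nonneg)
    then show ?thesis using assms unfolding r_def by (simp add: divide_simps) (simp add: algebra_simps)
  qed
  then have "(\<lambda>k. 1 * (r \<sigma> k * r s' k) + (-1) * (r \<sigma> k * r s k)) =
      (\<lambda>k. (s - s') / \<sigma> * (r s k * r s' k) + (- ((s - s') / \<sigma>)) * (r \<sigma> k * (r s k * r s' k)))"
    by blast
  then have "trig (multiplier (\<lambda>k. 1 * (r \<sigma> k * r s' k) + (-1) * (r \<sigma> k * r s k)) ts) x =
      trig (multiplier (\<lambda>k. (s - s') / \<sigma> * (r s k * r s' k) + (- ((s - s') / \<sigma>)) * (r \<sigma> k * (r s k * r s' k))) ts) x"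
    by (simp only:)
  then show ?thesis
    unfolding trig_multiplier_linear
    by (simp add: resolvent_def r_def[symmetric] multiplier_multiplier right_diff_distrib)
qed

lemma resolvent_second_deriv_bound:
  assumes ts: "trig_wf ts" and \<sigma>: "\<sigma> > 0" and s: "s > 0"
    and D: "\<And>x. \<bar>trig (trig_deriv i (resolvent s ts)) x\<bar> \<le> D"
  shows "\<bar>trig (trig_deriv j (trig_deriv i (resolvent \<sigma> (resolvent s ts)))) x\<bar> \<le> 2 * D / sqrt \<sigma>"
proof -
  have "\<bar>trig (trig_deriv j (resolvent \<sigma> (trig_deriv i (resolvent s ts)))) x\<bar> \<le> 2 * D / sqrt \<sigma>"
    by (rule resolvent_trig_gradient_sup[OF _ \<sigma> D]) (intro trig_wf_deriv trig_wf_resolvent ts)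
  then show ?thesis by (simp add: trig_deriv_resolvent)
qed

text \<open>The factor \<open>s - s'\<close> in the resolvent identity compensates the blow-up of the second
  derivatives of \<open>resolvent s (resolvent s' ts)\<close>; a Hoelder modulus \<open>D\<close> at scale \<open>sqrt s'\<close> is what remains.\<close>

lemma resolvent_scale_change_bound:
  assumes ts: "trig_wf ts" and \<sigma>: "\<sigma> > 0" and s': "s' > 0"
    and D: "\<And>x h. 0 \<le> h \<Longrightarrow> h \<le> sqrt s' \<Longrightarrow> \<bar>trig ts (x + ray i h) - trig ts (x - ray i h)\<bar> \<le> D"
  shows "\<bar>trig (trig_deriv j (trig_deriv i (resolvent \<sigma> (resolvent s' ts)))) x
      - trig (trig_deriv j (trig_deriv i (resolvent \<sigma> (resolvent (4 * s') ts)))) x\<bar> \<le> 6 * D / \<sigma>"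
proof -
  define H where "H = resolvent (4 * s') (resolvent s' (trig_deriv j (trig_deriv i ts)))"
  have wf: "trig_wf H" unfolding H_def by (intro trig_wf_deriv trig_wf_resolvent ts)
  have s4: "4 * s' > 0" using s' by simp
  have H: "\<bar>trig H x\<bar> \<le> D / s'" for x
  proof -
    have "\<bar>trig (trig_deriv j (trig_deriv i (resolvent (4 * s') (resolvent s' ts)))) x\<bar> \<le> 2 * (D / sqrt s') / sqrt (4 * s')"
      by (rule resolvent_second_deriv_bound[OF ts s4 s' resolvent_trig_gradient[OF ts s' D]])
    also have "2 * (D / sqrt s') / sqrt (4 * s') = D / s'"
      using s' by (simp add: real_sqrt_mult field_simps)
    finally show ?thesis by (simp add: H_def trig_deriv_resolvent)
  qed
  have "\<bar>trig H x - trig (resolvent \<sigma> H) x\<bar> \<le> D / s' + D / s'"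
    using H[of x] resolvent_trig_bound[OF wf \<sigma> H, of x] by linarith
  then have "(4 * s' - s') / \<sigma> * \<bar>trig H x - trig (resolvent \<sigma> H) x\<bar> \<le> (4 * s' - s') / \<sigma> * (D / s' + D / s')"
    using s' \<sigma> by (intro mult_left_mono) auto
  also have "\<dots> = 6 * D / \<sigma>" using s' by (simp add: field_simps)
  finally have "\<bar>(4 * s' - s') / \<sigma> * (trig H x - trig (resolvent \<sigma> H) x)\<bar> \<le> 6 * D / \<sigma>"
    using s' \<sigma> by (simp add: abs_mult)
  then show ?thesis
    using resolvent_difference[OF \<sigma> s4 s', of "trig_deriv j (trig_deriv i ts)" x]
    by (simp add: trig_deriv_resolvent H_def)
qed

lemma resolvent_near_identity:
  assumes ts: "trig_wf ts"
  obtains L where "\<And>s x. s > 0 \<Longrightarrow> \<bar>trig (resolvent s ts) x - trig ts x\<bar> \<le> s * L"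
proof -
  have wf: "trig_wf (multiplier (\<lambda>k. k \<bullet> k) ts)" by (rule trig_wf_multiplier[OF ts])
  obtain L where L: "\<And>x. \<bar>trig (multiplier (\<lambda>k. k \<bullet> k) ts) x\<bar> \<le> L"
    using periodic_bounded[OF trig_periodic[OF wf] trig_continuous] by blast
  have "\<bar>trig (resolvent s ts) x - trig ts x\<bar> \<le> s * L" if s: "s > 0" for s x
  proof -
    have "trig (resolvent s ts) x - trig ts x = s * lap (trig (resolvent s ts)) x"
      using resolvent_eq[OF s, of ts x] by simp
    also have "\<dots> = - s * trig (resolvent s (multiplier (\<lambda>k. k \<bullet> k) ts)) x"
      by (simp add: trig_lap resolvent_def multiplier_multiplier mult.commute)
    finally have "\<bar>trig (resolvent s ts) x - trig ts x\<bar> = s * \<bar>trig (resolvent s (multiplier (\<lambda>k. k \<bullet> k) ts)) x\<bar>"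
      using s by (simp add: abs_mult)
    then show ?thesis using resolvent_trig_bound[OF wf s L, of x] s by simp
  qed
  then show ?thesis using that by blast
qed

lemma uniform_limit_of_bounded_differences:
  fixes F G :: "nat \<Rightarrow> 'a \<Rightarrow> real"
  assumes F: "uniform_limit UNIV F f sequentially" and C: "C > 0"
    and G: "\<And>m n e x. (\<And>y. \<bar>F m y - F n y\<bar> \<le> e) \<Longrightarrow> \<bar>G m x - G n x\<bar> \<le> C * e"
  obtains g where "uniform_limit UNIV G g sequentially"
proof -
  have "uniformly_Cauchy_on UNIV G"
    unfolding uniformly_Cauchy_on_def
  proof (intro allI impI)
    fix e :: real assume e: "e > 0"
    define e' where "e' = e / (4 * C)"
    have "e' > 0" using e C by (simp add: e'_def)
    then obtain N where N: "\<And>n x. n \<ge> N \<Longrightarrow> \<bar>F n x - f x\<bar> < e'"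
      using F unfolding uniform_limit_sequentially_iff dist_real_def by blast
    have "dist (G m x) (G n x) < e" if "m \<ge> N" "n \<ge> N" for m n x
    proof -
      have "\<bar>F m y - F n y\<bar> \<le> 2 * e'" for y using N[OF that(1), of y] N[OF that(2), of y] by linarith
      from G[OF this, of x] have "\<bar>G m x - G n x\<bar> \<le> e / 2" using C by (simp add: e'_def)
      then show ?thesis using e by (simp add: dist_real_def)
    qed
    then show "\<exists>M. \<forall>x\<in>UNIV. \<forall>m\<ge>M. \<forall>n\<ge>M. dist (G m x) (G n x) < e" by blast
  qed
  then show ?thesis using that Cauchy_uniformly_convergent unfolding uniformly_convergent_on_def by blast
qed

theorem resolvent_equation_solvable:
  fixes f :: "real^'n \<Rightarrow> real"
  assumes f: "f \<in> Cper \<delta>" and \<delta>: "0 < \<delta>" "\<delta> < 1" and \<sigma>: "\<sigma> > 0"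
  shows "\<exists>u. C2 u \<and> periodic1 u \<and> (\<forall>x. u x - \<sigma> * lap u x = f x)"
proof -
  have fc: "continuous_on UNIV f" and fp: "periodic1 f"
    using f \<delta> Cper_continuous[OF f] by (auto simp: Cper_def)
  obtain K0 where K0: "\<And>x y. \<bar>f x - f y\<bar> \<le> K0 * dist x y powr \<delta>"
    using f by (auto simp: Cper_def holder_def)
  define K where "K = max K0 0"
  have K: "\<bar>f x - f y\<bar> \<le> K * dist x y powr \<delta>" for x y
    using K0[of x y] mult_right_mono[of K0 K "dist x y powr \<delta>"] by (simp add: K_def)
  have Kpos: "K \<ge> 0" by (simp add: K_def)
  have "\<exists>ts. trig_wf ts \<and> (\<forall>x. \<bar>f x - trig ts x\<bar> < (1/4)^n)" for n :: nat
    using trig_dense[OF fp fc, of "(1/4)^n"] by (metis zero_less_power zero_less_divide_1_iff zero_less_numeral)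
  then obtain ts where wf: "\<And>n. trig_wf (ts n)" and ts: "\<And>n x. \<bar>f x - trig (ts n) x\<bar> < (1/4)^n"
    by metis
  define s :: "nat \<Rightarrow> real" where "s n = (1/4)^n" for n
  have s: "s n > 0" for n by (simp add: s_def)
  have sqrt_s: "sqrt (s n) = (1/2)^n" for n
    by (simp add: s_def real_sqrt_power real_sqrt_divide)
  define F where "F n = resolvent (s n) (ts n)" for n
  define U where "U n = resolvent \<sigma> (F n)" for n
  have wfF: "trig_wf (F n)" and wfU: "trig_wf (U n)" for n
    unfolding F_def U_def by (intro trig_wf_resolvent wf)+
  have F_lim: "uniform_limit UNIV (\<lambda>n. trig (F n)) f sequentially"
    unfolding uniform_limit_sequentially_iff
  proof (intro allI impI)
    fix e :: real assume e: "e > 0"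
    obtain m where m: "(1/4)^m < e / 8"
      using real_arch_pow_inv[of "e / 8" "1/4"] e by auto
    obtain L where L: "\<And>s x. s > 0 \<Longrightarrow> \<bar>trig (resolvent s (ts m)) x - trig (ts m) x\<bar> \<le> s * L"
      using resolvent_near_identity[OF wf] by blast
    have "L \<ge> 0" using L[of 1 0] by (simp add: order_trans[OF abs_ge_zero])
    obtain N0 where N0: "(1/4)^N0 < e / (8 * (L + 1))"
      using real_arch_pow_inv[of "e / (8 * (L + 1))" "1/4"] e \<open>L \<ge> 0\<close> by auto
    have "dist (trig (F n) x) (f x) < e" if n: "n \<ge> max m N0" for n x
    proof -
      have sn: "s n \<le> (1/4)^m" "s n \<le> (1/4)^N0"
        using n by (auto simp: s_def intro!: power_decreasing)
      have "\<bar>trig (trig_minus (ts n) (ts m)) y\<bar> \<le> e / 4" for y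
        using ts[of y n] ts[of y m] sn(1) m unfolding trig_minus s_def by linarith
      from resolvent_trig_bound[OF trig_wf_minus[OF wf wf] s[of n] this]
      have 1: "\<bar>trig (F n) x - trig (resolvent (s n) (ts m)) x\<bar> \<le> e / 4"
        by (simp add: resolvent_trig_minus trig_minus F_def)
      have "s n * L \<le> (e / (8 * (L + 1))) * L" using sn N0 \<open>L \<ge> 0\<close> by (intro mult_right_mono) auto
      also have "\<dots> \<le> e / 8" using \<open>L \<ge> 0\<close> e by (simp add: field_simps)
      finally have 2: "\<bar>trig (resolvent (s n) (ts m)) x - trig (ts m) x\<bar> \<le> e / 8"
        using L[OF s[of n], of x] by simp
      show ?thesis using 1 2 ts[of x m] m e unfolding dist_real_def by linarith
    qed
    then show "\<exists>N. \<forall>n\<ge>N. \<forall>x\<in>UNIV. dist (trig (F n) x) (f x) < e" by blast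
  qed
  obtain u where u: "uniform_limit UNIV (\<lambda>n. trig (U n)) u sequentially"
  proof (rule uniform_limit_of_bounded_differences[OF F_lim, of 1 "\<lambda>n. trig (U n)"])
    fix m n e x assume "\<And>y. \<bar>trig (F m) y - trig (F n) y\<bar> \<le> e"
    then have "\<bar>trig (trig_minus (F m) (F n)) y\<bar> \<le> e" for y by (simp add: trig_minus)
    from resolvent_trig_bound[OF trig_wf_minus[OF wfF wfF] \<sigma> this]
    show "\<bar>trig (U m) x - trig (U n) x\<bar> \<le> 1 * e" by (simp add: U_def resolvent_trig_minus trig_minus)
  qed auto
  have "\<exists>p. uniform_limit UNIV (\<lambda>n. trig (trig_deriv i (U n))) p sequentially" for i
  proof -
    obtain p where "uniform_limit UNIV (\<lambda>n. trig (trig_deriv i (U n))) p sequentially"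
    proof (rule uniform_limit_of_bounded_differences[OF F_lim, of "2 / sqrt \<sigma>" "\<lambda>n. trig (trig_deriv i (U n))"])
      fix m n e x assume "\<And>y. \<bar>trig (F m) y - trig (F n) y\<bar> \<le> e"
      then have "\<bar>trig (trig_minus (F m) (F n)) y\<bar> \<le> e" for y by (simp add: trig_minus)
      from resolvent_trig_gradient_sup[OF trig_wf_minus[OF wfF wfF] \<sigma> this]
      show "\<bar>trig (trig_deriv i (U m)) x - trig (trig_deriv i (U n)) x\<bar> \<le> 2 / sqrt \<sigma> * e"
        by (simp add: U_def resolvent_trig_minus trig_deriv_trig_minus trig_minus)
    qed (use \<sigma> in auto)
    then show ?thesis by blast
  qed
  then obtain P where P: "\<And>i. uniform_limit UNIV (\<lambda>n. trig (trig_deriv i (U n))) (P i) sequentially"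
    by metis
  define \<theta> where "\<theta> = (1/2::real) powr \<delta>"
  have \<theta>: "1/2 \<le> \<theta>" "\<theta> < 1"
    using powr_mono'[of \<delta> 1 "1/2"] \<delta> powr01_less_one[of "1/2" \<delta>] by (auto simp: \<theta>_def)
  have \<theta>n: "(1/2)^n \<le> \<theta>^n" "(1/4)^n \<le> \<theta>^n" for n
    using \<theta> by (auto intro!: power_mono)
  define A where "A = 16 / sqrt \<sigma> + 6 * (K + 2) / \<sigma>"
  have second: "\<bar>trig (trig_deriv j (trig_deriv i (U (Suc n)))) x - trig (trig_deriv j (trig_deriv i (U n))) x\<bar> \<le> A * \<theta> ^ n" for i j n x
  proof -
    define s' where "s' = s (Suc n)"
    have s': "s' > 0" "4 * s' = s n" using s by (simp_all add: s'_def s_def)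
    have sq: "sqrt s' = (1/2)^n / 2" unfolding s'_def sqrt_s by simp
    define V where "V = resolvent \<sigma> (resolvent s' (ts n))"
    have near: "\<bar>trig (trig_minus (ts (Suc n)) (ts n)) y\<bar> \<le> 2 * (1/4)^n" for y
    proof -
      have "(1/4::real)^Suc n \<le> (1/4)^n" by (simp add: power_decreasing)
      then show ?thesis using ts[of y n] ts[of y "Suc n"] unfolding trig_minus by linarith
    qed
    from resolvent_second_deriv_bound[OF trig_wf_minus[OF wf wf] \<sigma> s'(1)
        resolvent_trig_gradient_sup[OF trig_wf_minus[OF wf wf] s'(1) near]]
    have "\<bar>trig (trig_deriv j (trig_deriv i (U (Suc n)))) x - trig (trig_deriv j (trig_deriv i V)) x\<bar>
        \<le> 2 * (2 * (2 * (1/4)^n) / sqrt s') / sqrt \<sigma>"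
      by (simp only: U_def F_def V_def s'_def resolvent_trig_minus trig_deriv_trig_minus trig_minus)
    also have "2 * (2 * (2 * (1/4)^n) / sqrt s') / sqrt \<sigma> = 16 / sqrt \<sigma> * (1/2)^n"
    proof -
      have "(1/4::real)^n = (1/2)^n * (1/2)^n" by (simp add: power_mult_distrib[symmetric])
      then show ?thesis using \<sigma> by (simp add: sq field_simps)
    qed
    also have "\<dots> \<le> 16 / sqrt \<sigma> * \<theta>^n" using \<theta>n \<sigma> by (intro mult_left_mono) auto
    finally have 1: "\<bar>trig (trig_deriv j (trig_deriv i (U (Suc n)))) x - trig (trig_deriv j (trig_deriv i V)) x\<bar> \<le> 16 / sqrt \<sigma> * \<theta>^n" .
    have "\<bar>trig (trig_deriv j (trig_deriv i (resolvent \<sigma> (resolvent s' (ts n))))) x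
      - trig (trig_deriv j (trig_deriv i (resolvent \<sigma> (resolvent (4 * s') (ts n))))) x\<bar> \<le> 6 * ((K + 2) * \<theta>^n) / \<sigma>"
    proof (rule resolvent_scale_change_bound[OF wf \<sigma> s'(1)])
      fix y :: "real^'n" and h assume h: "0 \<le> h" "h \<le> sqrt s'"
      have "dist (y + ray i h) (y - ray i h) = 2 * h"
      proof -
        have "(y + ray i h) - (y - ray i h) = (2 * h) *\<^sub>R axis i (1::real)"
          by (simp add: algebra_simps scaleR_2[symmetric])
        then show ?thesis using h by (simp add: dist_norm norm_axis_1)
      qed
      then have "\<bar>f (y + ray i h) - f (y - ray i h)\<bar> \<le> K * (2 * h) powr \<delta>"
        using K[of "y + ray i h" "y - ray i h"] by simp
      also have "\<dots> \<le> K * ((1/2)^n) powr \<delta>"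
        using h \<delta> Kpos sq by (intro mult_left_mono powr_mono2) auto
      also have "((1/2)^n) powr \<delta> = \<theta>^n" by (simp add: \<theta>_def powr_power powr_powr flip: powr_realpow)
          (simp add: mult.commute)
      finally have "\<bar>trig (ts n) (y + ray i h) - trig (ts n) (y - ray i h)\<bar> \<le> K * \<theta>^n + 2 * (1/4)^n"
        using ts[of "y + ray i h" n] ts[of "y - ray i h" n] by linarith
      also have "\<dots> \<le> (K + 2) * \<theta>^n" using \<theta>n(2)[of n] by (simp add: distrib_right)
      finally show "\<bar>trig (ts n) (y + ray i h) - trig (ts n) (y - ray i h)\<bar> \<le> (K + 2) * \<theta>^n" .
    qed
    then have 2: "\<bar>trig (trig_deriv j (trig_deriv i V)) x - trig (trig_deriv j (trig_deriv i (U n))) x\<bar> \<le> 6 * ((K + 2) * \<theta>^n) / \<sigma>"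
      by (simp only: s'(2) U_def F_def V_def)
    have "A * \<theta>^n = 16 / sqrt \<sigma> * \<theta>^n + 6 * ((K + 2) * \<theta>^n) / \<sigma>"
      by (simp add: A_def distrib_right)
    then show ?thesis using 1 2 by linarith
  qed
  have "\<exists>q. uniform_limit UNIV (\<lambda>n. trig (trig_deriv j (trig_deriv i (U n)))) q sequentially" for i j
  proof -
    obtain q where "uniform_limit UNIV (\<lambda>n. trig (trig_deriv j (trig_deriv i (U n)))) q sequentially"
      by (rule uniform_limit_geometric[OF _ \<theta>(2) second[of j i]]) (use \<theta> in auto)
    then show ?thesis by blast
  qed
  then have "\<forall>i. \<exists>Q. \<forall>j. uniform_limit UNIV (\<lambda>n. trig (trig_deriv j (trig_deriv i (U n)))) (Q j) sequentially"
    by (intro allI choice)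
  then obtain Q where Q: "\<And>i j. uniform_limit UNIV (\<lambda>n. trig (trig_deriv j (trig_deriv i (U n)))) (Q i j) sequentially"
    unfolding choice_iff by blast
  have pt: "(\<lambda>n. trig (U n) x) \<longlonglongrightarrow> u x" "(\<lambda>n. trig (trig_deriv i (U n)) x) \<longlonglongrightarrow> P i x"
    "(\<lambda>n. trig (trig_deriv j (trig_deriv i (U n))) x) \<longlonglongrightarrow> Q i j x" "(\<lambda>n. trig (F n) x) \<longlonglongrightarrow> f x" for x i j
    using tendsto_uniform_limitI[OF u] tendsto_uniform_limitI[OF P] tendsto_uniform_limitI[OF Q]
      tendsto_uniform_limitI[OF F_lim] by auto
  have dP: "(u has_derivative (\<lambda>h. \<Sum>i\<in>UNIV. P i x * h $ i)) (at x)" for x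
    by (rule has_derivative_uniform_limit[OF trig_has_derivative P pt(1)])
  have dQ: "(P i has_derivative (\<lambda>h. \<Sum>j\<in>UNIV. Q i j x * h $ j)) (at x)" for i x
    by (rule has_derivative_uniform_limit[OF trig_has_derivative Q pt(2)])
  have cQ: "continuous_on UNIV (Q i j)" for i j
    by (rule uniform_limit_theorem[OF _ Q]) (auto simp: trig_continuous)
  have "u x - \<sigma> * lap u x = f x" for x
  proof -
    have "(\<lambda>n. trig (U n) x - \<sigma> * (\<Sum>i\<in>UNIV. trig (trig_deriv i (trig_deriv i (U n))) x)) \<longlonglongrightarrow> u x - \<sigma> * (\<Sum>i\<in>UNIV. Q i i x)"
      by (intro tendsto_intros pt)
    moreover have "trig (U n) x - \<sigma> * (\<Sum>i\<in>UNIV. trig (trig_deriv i (trig_deriv i (U n))) x) = trig (F n) x" for n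
      using resolvent_eq[OF \<sigma>, of "F n" x] by (simp add: axis_derivs_lap[OF trig_axis_derivs] U_def)
    ultimately show ?thesis
      using LIMSEQ_unique[OF pt(4)] by (simp add: C2_partialsI(2)[OF dP dQ cQ])
  qed
  moreover have "periodic1 u"
    unfolding periodic1_def
  proof (intro allI)
    fix x i
    have "trig (U n) (x + axis i 1) = trig (U n) x" for n
      using trig_periodic[OF wfU] by (simp add: periodic1_def)
    then show "u (x + axis i 1) = u x" using LIMSEQ_unique[OF pt(1)[of "x + axis i 1"]] pt(1)[of x] by simp
  qed
  ultimately show ?thesis using C2_partialsI(1)[OF dP dQ cQ] by blast
qed

section \<open>A fixed point theorem\<close>

lemma brouwer_cube_approximate:
  fixes F :: "(nat \<Rightarrow> real) \<Rightarrow> nat \<Rightarrow> real"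
  assumes ab: "a < b" and C: "C \<ge> 0" and e: "e > 0"
    and into: "\<And>y i. (\<And>j. j < n \<Longrightarrow> a \<le> y j \<and> y j \<le> b) \<Longrightarrow> i < n \<Longrightarrow> a \<le> F y i \<and> F y i \<le> b"
    and lip: "\<And>y y' i e. (\<And>j. j < n \<Longrightarrow> a \<le> y j \<and> y j \<le> b) \<Longrightarrow> (\<And>j. j < n \<Longrightarrow> a \<le> y' j \<and> y' j \<le> b)
        \<Longrightarrow> (\<And>j. j < n \<Longrightarrow> \<bar>y j - y' j\<bar> \<le> e) \<Longrightarrow> i < n \<Longrightarrow> \<bar>F y i - F y' i\<bar> \<le> C * e"
  obtains y where "\<And>j. j < n \<Longrightarrow> a \<le> y j \<and> y j \<le> b" "\<And>i. i < n \<Longrightarrow> \<bar>F y i - y i\<bar> \<le> e"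
proof -
  obtain p :: nat where p: "(C + 1) * (b - a) / e < real p" using reals_Archimedean2 by blast
  have "0 \<le> (C + 1) * (b - a) / e" using ab C e by simp
  then have p0: "0 < p" using p by (cases p) auto
  define \<eta> where "\<eta> = (b - a) / real p"
  have \<eta>: "\<eta> > 0" "(C + 1) * \<eta> \<le> e" using p p0 ab e by (auto simp: \<eta>_def field_simps)
  define pt :: "(nat \<Rightarrow> nat) \<Rightarrow> nat \<Rightarrow> real" where "pt x j = a + \<eta> * real (x j)" for x j
  have pt_cube: "a \<le> pt x j \<and> pt x j \<le> b" if "x j \<le> p" for x j
  proof -
    have "\<eta> * real (x j) \<le> \<eta> * real p" using \<eta> that by (intro mult_left_mono) auto
    also have "\<dots> = b - a" using p0 by (simp add: \<eta>_def)
    finally show ?thesis using \<eta> by (simp add: pt_def)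
  qed
  define label where "label x i = (if pt x i \<le> F (pt x) i \<and> x i \<noteq> p then 0 else (1::nat))" for x i
  have l1: "\<forall>x. (\<forall>i<n. x i \<le> p) \<longrightarrow> (\<forall>i<n. label x i = 0 \<or> label x i = 1)"
    by (simp add: label_def)
  have l2: "\<forall>x. (\<forall>i<n. x i \<le> p) \<longrightarrow> (\<forall>i<n. x i = 0 \<longrightarrow> label x i = 0)"
  proof (intro allI impI)
    fix x i assume "\<forall>i<n. x i \<le> p" "i < n" "x i = 0"
    then have "pt x i \<le> F (pt x) i" using into[of "pt x" i] pt_cube by (simp add: pt_def)
    then show "label x i = 0" using p0 \<open>x i = 0\<close> by (simp add: label_def)
  qed
  have l3: "\<forall>x. (\<forall>i<n. x i \<le> p) \<longrightarrow> (\<forall>i<n. x i = p \<longrightarrow> label x i = 1)"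
    by (simp add: label_def)
  obtain q where q: "\<forall>i<n. q i < p"
    and rs: "\<forall>i<n. \<exists>r s. (\<forall>j<n. q j \<le> r j \<and> r j \<le> q j + 1) \<and> (\<forall>j<n. q j \<le> s j \<and> s j \<le> q j + 1) \<and> label r i \<noteq> label s i"
    by (rule kuhn_lemma[OF p0 l1 l2 l3])
  have near: "r j \<le> p" "pt q j \<le> pt r j" "pt r j \<le> pt q j + \<eta>" if "q j \<le> r j \<and> r j \<le> q j + 1" "j < n" for r j
  proof -
    show "r j \<le> p" using that q by (metis Suc_eq_plus1 Suc_leI order_trans)
    show "pt q j \<le> pt r j" using that \<eta> by (simp add: pt_def)
    have "\<eta> * real (r j) \<le> \<eta> * (real (q j) + 1)" using that \<eta> by (intro mult_left_mono) auto
    then show "pt r j \<le> pt q j + \<eta>" by (simp add: pt_def algebra_simps)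
  qed
  have Fnear: "\<bar>F (pt q) i - F (pt r) i\<bar> \<le> C * \<eta>"
    if r: "\<forall>j<n. q j \<le> r j \<and> r j \<le> q j + 1" and i: "i < n" for r i
  proof (rule lip[OF _ _ _ i])
    fix j assume j: "j < n"
    show "a \<le> pt q j \<and> pt q j \<le> b" using pt_cube q j by (simp add: less_imp_le)
    show "a \<le> pt r j \<and> pt r j \<le> b" using pt_cube near(1) r j by blast
    show "\<bar>pt q j - pt r j\<bar> \<le> \<eta>" using near(2,3)[of j r] r j by auto
  qed
  have key: "\<bar>F (pt q) i - pt q i\<bar> \<le> e"
    if r: "\<forall>j<n. q j \<le> r j \<and> r j \<le> q j + 1" and s: "\<forall>j<n. q j \<le> s j \<and> s j \<le> q j + 1"
      and l: "label r i = 0" "label s i \<noteq> 0" and i: "i < n" for r s i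
  proof -
    have 1: "pt r i \<le> F (pt r) i" using l by (simp add: label_def split: if_splits)
    have 2: "F (pt s) i \<le> pt s i"
    proof (cases "s i = p")
      case True
      then have "pt s i = b" using p0 by (simp add: pt_def \<eta>_def)
      moreover have "F (pt s) i \<le> b" using into[of "pt s" i] pt_cube near(1) s i by blast
      ultimately show ?thesis by simp
    next
      case False
      then show ?thesis using l by (simp add: label_def split: if_splits)
    qed
    have "C * \<eta> + \<eta> \<le> e" using \<eta>(2) by (simp add: distrib_right)
    then show ?thesis
      using 1 2 Fnear[OF r i] Fnear[OF s i] near(2,3)[of i r] near(2,3)[of i s] r s i \<eta>(1) by (auto simp: abs_le_iff)
  qed
  show ?thesis
  proof (rule that[of "pt q"])
    show "a \<le> pt q j \<and> pt q j \<le> b" if "j < n" for j using pt_cube q that by (simp add: less_imp_le)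
    show "\<bar>F (pt q) i - pt q i\<bar> \<le> e" if i: "i < n" for i
    proof -
      obtain r s where r: "\<forall>j<n. q j \<le> r j \<and> r j \<le> q j + 1" and s: "\<forall>j<n. q j \<le> s j \<and> s j \<le> q j + 1"
        and l: "label r i \<noteq> label s i" using rs i by blast
      show ?thesis
      proof (cases "label r i = 0")
        case True
        then show ?thesis using key[OF r s _ _ i] l by simp
      next
        case False
        then have "label s i = 0" using l by (simp add: label_def split: if_splits)
        then show ?thesis using key[OF s r _ False i] by simp
      qed
    qed
  qed
qed

definition lip_between :: "real \<Rightarrow> (real^'n \<Rightarrow> real) \<Rightarrow> (real^'n \<Rightarrow> real) \<Rightarrow> (real^'n \<Rightarrow> real) set" where
  "lip_between L lo hi = {u. per_lip L u \<and> (\<forall>x. lo x \<le> u x \<and> u x \<le> hi x)}"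

lemma Min_image_diff_le:
  fixes f g :: "'a \<Rightarrow> real"
  assumes "finite I" "I \<noteq> {}" "\<And>i. i \<in> I \<Longrightarrow> \<bar>f i - g i\<bar> \<le> D"
  shows "\<bar>Min (f ` I) - Min (g ` I)\<bar> \<le> D"
proof -
  have "Min (f ` I) \<le> Min (g ` I) + D" if fg: "\<And>i. i \<in> I \<Longrightarrow> \<bar>f i - g i\<bar> \<le> D" for f g :: "'a \<Rightarrow> real"
  proof -
    have "Min (g ` I) \<in> g ` I" using assms(1,2) by (intro Min_in) auto
    then obtain i where i: "i \<in> I" "Min (g ` I) = g i" by blast
    have "Min (f ` I) \<le> f i" using assms(1) i by simp
    then show ?thesis using fg[OF i(1)] i(2) by simp
  qed
  from this[of f g] this[of g f] assms(3) show ?thesis by (simp add: abs_le_iff)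
qed

lemma per_dist_net:
  assumes "\<eta> > 0"
  obtains zs :: "(real^'n) list" where "zs \<noteq> []" "\<And>x. \<exists>i<length zs. per_dist x (zs ! i) \<le> \<eta>"
proof -
  define e where "e = \<eta> / real CARD('n)"
  have e: "e > 0" using assms by (simp add: e_def)
  obtain Z where Z: "finite Z" "(unit_cell :: (real^'n) set) \<subseteq> (\<Union>z\<in>Z. ball z e)"
    using compact_unit_cell e unfolding compact_eq_totally_bounded by blast
  obtain zs where zs: "set zs = Z" using finite_list[OF Z(1)] by blast
  have net: "\<exists>i<length zs. per_dist x (zs ! i) \<le> \<eta>" for x
  proof -
    obtain y where y: "y \<in> unit_cell" "\<And>u z. periodic1 u \<Longrightarrow> u (x + z) = u (y + z)"
      using unit_cell_representative[of x] by blast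
    obtain z where z: "z \<in> Z" "dist z y < e" using Z(2) y(1) by auto
    have "per_lip 1 (\<lambda>x. per_dist x z)"
      unfolding per_lip_def using per_dist_triangle per_dist_commute by (smt (verit, best) mult_1)
    from y(2)[OF per_lip_periodic[OF this], of 0] have "per_dist x z = per_dist y z" by simp
    also have "\<dots> \<le> real CARD('n) * norm (y - z)" by (rule per_dist_le_norm)
    also have "\<dots> \<le> real CARD('n) * e" using z(2) by (intro mult_left_mono) (auto simp: dist_norm norm_minus_commute)
    also have "\<dots> = \<eta>" by (simp add: e_def)
    finally show ?thesis using z(1) zs by (metis in_set_conv_nth)
  qed
  moreover have "zs \<noteq> []" using net[of 0] by auto
  ultimately show ?thesis using that by blast
qed

lemma max_min_diff_le:
  fixes a b c a' b' c' :: real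
  assumes "\<bar>a - a'\<bar> \<le> D" "\<bar>b - b'\<bar> \<le> D" "\<bar>c - c'\<bar> \<le> D"
  shows "\<bar>max a (min b c) - max a' (min b' c')\<bar> \<le> D"
  using assms by (simp add: max_def min_def abs_if split: if_splits)

text \<open>The clamped McShane extension makes \<open>lip_between L lo hi\<close> a nonexpansive image of a
  finite-dimensional cube, so that Brouwer's theorem yields approximate fixed points.\<close>

lemma lip_between_approximate_fixed_point:
  fixes lo hi :: "real^'n \<Rightarrow> real"
  assumes L: "L \<ge> 0" and lo: "per_lip L lo" and hi: "per_lip L hi" and le: "\<And>x. lo x \<le> hi x"
    and T: "\<And>u. u \<in> lip_between L lo hi \<Longrightarrow> T u \<in> lip_between L lo hi"
    and C: "C \<ge> 0" and lip: "\<And>u v e x. u \<in> lip_between L lo hi \<Longrightarrow> v \<in> lip_between L lo hi \<Longrightarrow>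
      (\<And>x. \<bar>u x - v x\<bar> \<le> e) \<Longrightarrow> \<bar>T u x - T v x\<bar> \<le> C * e"
    and e: "e > 0"
  obtains u where "u \<in> lip_between L lo hi" "\<And>x. \<bar>T u x - u x\<bar> \<le> e"
proof -
  define \<eta> where "\<eta> = e / (4 * (L + 1))"
  have \<eta>: "\<eta> > 0" "2 * L * \<eta> \<le> e / 2" using L e by (auto simp: \<eta>_def field_simps)
  obtain zs :: "(real^'n) list" where zs: "zs \<noteq> []" "\<And>x. \<exists>i<length zs. per_dist x (zs ! i) \<le> \<eta>"
    using per_dist_net[OF \<eta>(1)] by blast
  define n where "n = length zs"
  have I: "finite {..<n}" "{..<n} \<noteq> {}" using zs(1) by (auto simp: n_def)
  define m where "m y x = Min ((\<lambda>i. y i + L * per_dist x (zs ! i)) ` {..<n})" for y x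
  define E where "E y x = max (lo x) (min (hi x) (m y x))" for y x
  have E_in: "E y \<in> lip_between L lo hi" for y
  proof -
    have m_lip: "\<bar>m y x - m y z\<bar> \<le> L * per_dist x z" for x z
      unfolding m_def
    proof (rule Min_image_diff_le[OF I])
      fix i
      have "\<bar>per_dist x (zs ! i) - per_dist z (zs ! i)\<bar> \<le> per_dist x z"
        using per_dist_triangle[of x "zs ! i" z] per_dist_triangle[of z "zs ! i" x] per_dist_commute[of x z] by linarith
      then have "L * \<bar>per_dist x (zs ! i) - per_dist z (zs ! i)\<bar> \<le> L * per_dist x z"
        using L by (intro mult_left_mono)
      moreover have "\<bar>(y i + L * per_dist x (zs ! i)) - (y i + L * per_dist z (zs ! i))\<bar> = L * \<bar>per_dist x (zs ! i) - per_dist z (zs ! i)\<bar>"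
        using L by (simp add: abs_mult flip: right_diff_distrib)
      ultimately show "\<bar>(y i + L * per_dist x (zs ! i)) - (y i + L * per_dist z (zs ! i))\<bar> \<le> L * per_dist x z" by simp
    qed
    have "per_lip L (E y)"
      unfolding per_lip_def E_def using lo hi m_lip
      by (intro allI max_min_diff_le) (auto simp: per_lip_def)
    then show ?thesis using le by (auto simp: lip_between_def E_def)
  qed
  have E_diff: "\<bar>E y x - E y' x\<bar> \<le> e" if "\<And>j. j < n \<Longrightarrow> \<bar>y j - y' j\<bar> \<le> e" for y y' e x
  proof -
    have "\<bar>m y x - m y' x\<bar> \<le> e" unfolding m_def by (rule Min_image_diff_le[OF I]) (use that in auto)
    moreover have "0 \<le> e" using that[of 0] I by (auto intro: order_trans[OF abs_ge_zero])
    ultimately show ?thesis unfolding E_def by (intro max_min_diff_le) auto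
  qed
  have E_approx: "\<bar>E (\<lambda>i. v (zs ! i)) x - v x\<bar> \<le> e / 2" if v: "v \<in> lip_between L lo hi" for v x
  proof -
    have vl: "\<bar>v x - v z\<bar> \<le> L * per_dist x z" for z using v by (simp add: lip_between_def per_lip_def)
    have 1: "v x \<le> m (\<lambda>i. v (zs ! i)) x"
      unfolding m_def using I vl by (subst Min_ge_iff) (auto simp: abs_le_iff algebra_simps)
    obtain i where i: "i < n" "per_dist x (zs ! i) \<le> \<eta>" using zs(2) n_def by blast
    have "m (\<lambda>i. v (zs ! i)) x \<le> v (zs ! i) + L * per_dist x (zs ! i)"
      unfolding m_def using i by (intro Min_le) auto
    also have "\<dots> \<le> v x + 2 * (L * per_dist x (zs ! i))" using vl[of "zs ! i"] by linarith
    also have "\<dots> \<le> v x + 2 * (L * \<eta>)" using i L by (simp add: mult_left_mono)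
    finally have 2: "m (\<lambda>i. v (zs ! i)) x \<le> v x + e / 2" using \<eta> by simp
    have "lo x \<le> v x" "v x \<le> hi x" using v by (auto simp: lip_between_def)
    then show ?thesis using 1 2 by (auto simp: E_def max_def min_def)
  qed
  obtain B1 where B1: "B1 > 0" "\<And>x. \<bar>lo x\<bar> \<le> B1"
    by (rule per_lip_bounded[OF lo L]) (rule that)
  obtain B2 where B2: "B2 > 0" "\<And>x. \<bar>hi x\<bar> \<le> B2"
    by (rule per_lip_bounded[OF hi L]) (rule that)
  define B where "B = max B1 B2"
  have B: "B > 0" "\<And>x. - B \<le> lo x" "\<And>x. hi x \<le> B"
    using B1 B2 by (auto simp: B_def abs_le_iff le_max_iff_disj minus_le_iff)
  have "- B < B" using B by simp
  then obtain y where y: "\<And>i. i < n \<Longrightarrow> \<bar>T (E y) (zs ! i) - y i\<bar> \<le> e / 2"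
  proof (rule brouwer_cube_approximate[where F="\<lambda>y i. T (E y) (zs ! i)" and n=n and C=C and e="e/2"])
    show "- B \<le> T (E y) (zs ! i) \<and> T (E y) (zs ! i) \<le> B" for y i
      using T[OF E_in[of y]] B by (auto simp: lip_between_def intro: order_trans)
    show "\<bar>T (E y) (zs ! i) - T (E y') (zs ! i)\<bar> \<le> C * e'"
      if "\<And>j. j < n \<Longrightarrow> \<bar>y j - y' j\<bar> \<le> e'" for y y' i e'
      by (rule lip[OF E_in E_in E_diff[OF that]])
  qed (use C e in auto)
  have "\<bar>T (E y) x - E y x\<bar> \<le> e" for x
    using E_approx[OF T[OF E_in[of y]], of x] E_diff[of "\<lambda>i. T (E y) (zs ! i)" y "e / 2" x, OF y] by linarith
  then show ?thesis using that E_in by blast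
qed

lemma lip_between_compact:
  fixes lo hi :: "real^'n \<Rightarrow> real"
  assumes L: "L \<ge> 0" and lo: "per_lip L lo" and hi: "per_lip L hi"
    and w: "\<And>n::nat. w n \<in> lip_between L lo hi"
  obtains u and r :: "nat \<Rightarrow> nat" where "u \<in> lip_between L lo hi" "strict_mono r"
    "uniform_limit UNIV (\<lambda>n. w (r n)) u sequentially"
proof -
  obtain B1 where B1: "B1 > 0" "\<And>x. \<bar>lo x\<bar> \<le> B1"
    by (rule per_lip_bounded[OF lo L]) (rule that)
  obtain B2 where B2: "B2 > 0" "\<And>x. \<bar>hi x\<bar> \<le> B2"
    by (rule per_lip_bounded[OF hi L]) (rule that)
  have wl: "per_lip L (w n)" "lo x \<le> w n x" "w n x \<le> hi x" for n x
    using w by (auto simp: lip_between_def)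
  define A where "A = L * real CARD('n) + 1"
  have A: "A > 0" using L by (simp add: A_def add_nonneg_pos)
  obtain g r where r: "strict_mono (r :: nat \<Rightarrow> nat)"
    and g: "\<And>e. 0 < e \<Longrightarrow> \<exists>N. \<forall>n x. n \<ge> N \<and> x \<in> unit_cell \<longrightarrow> norm (w (r n) x - g x) < e"
  proof (rule Arzela_Ascoli[OF compact_unit_cell, of w "B1 + B2"])
    show "norm (w n x) \<le> B1 + B2" for n x
      using wl(2,3)[where n=n and x=x] B1(2)[of x] B2(2)[of x] by simp
    fix x :: "real^'n" and e :: real assume e: "e > 0"
    have "\<bar>w n x - w n y\<bar> < e" if "norm (x - y) < e / A" for n y
    proof -
      have "\<bar>w n x - w n y\<bar> \<le> L * real CARD('n) * norm (x - y)" by (rule per_lip_norm[OF wl(1) L])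
      also have "\<dots> \<le> A * norm (x - y)" by (intro mult_right_mono) (auto simp: A_def)
      also have "\<dots> < e" using that A by (simp add: field_simps)
      finally show ?thesis .
    qed
    then show "\<exists>d>0. \<forall>n y. y \<in> unit_cell \<and> norm (x - y) < d \<longrightarrow> norm (w n x - w n y) < e"
      using e A by (intro exI[of _ "e / A"]) auto
  qed blast
  have "\<forall>x::real^'n. \<exists>y. y \<in> unit_cell \<and> (\<forall>v. periodic1 v \<longrightarrow> v x = v y)"
  proof
    fix x :: "real^'n"
    obtain y where "y \<in> unit_cell" "\<And>u z. periodic1 u \<Longrightarrow> u (x + z) = u (y + z)"
      using unit_cell_representative[of x] by blast
    then show "\<exists>y. y \<in> unit_cell \<and> (\<forall>v. periodic1 v \<longrightarrow> v x = v y)"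
      by (metis add.right_neutral)
  qed
  then obtain Y where Y: "\<And>x::real^'n. Y x \<in> unit_cell" "\<And>x v. periodic1 v \<Longrightarrow> v x = v (Y x)"
    by metis
  define u where "u x = g (Y x)" for x
  have lim: "uniform_limit UNIV (\<lambda>n. w (r n)) u sequentially"
    unfolding uniform_limit_sequentially_iff
  proof (intro allI impI)
    fix e :: real assume "e > 0"
    then obtain N where N: "\<And>n x. n \<ge> N \<Longrightarrow> x \<in> unit_cell \<Longrightarrow> norm (w (r n) x - g x) < e" using g by blast
    have "dist (w (r n) x) (u x) < e" if "n \<ge> N" for n x
      using N[OF that Y(1), of x] Y(2)[OF per_lip_periodic[OF wl(1)], of "r n" x] by (simp add: u_def dist_norm)
    then show "\<exists>N. \<forall>n\<ge>N. \<forall>x\<in>UNIV. dist (w (r n) x) (u x) < e" by blast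
  qed
  have pt: "(\<lambda>n. w (r n) x) \<longlonglongrightarrow> u x" for x using tendsto_uniform_limitI[OF lim] by simp
  have "u \<in> lip_between L lo hi"
    unfolding lip_between_def per_lip_def
  proof (intro CollectI conjI allI)
    fix x z
    have "(\<lambda>n. \<bar>w (r n) x - w (r n) z\<bar>) \<longlonglongrightarrow> \<bar>u x - u z\<bar>" by (intro tendsto_intros pt)
    then show "\<bar>u x - u z\<bar> \<le> L * per_dist x z"
      by (rule LIMSEQ_le_const2) (use wl(1) in \<open>auto simp: per_lip_def\<close>)
    show "lo x \<le> u x" by (rule LIMSEQ_le_const[OF pt]) (use wl in auto)
    show "u x \<le> hi x" by (rule LIMSEQ_le_const2[OF pt]) (use wl in auto)
  qed
  then show ?thesis using that r lim by blast
qed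

theorem lip_between_fixed_point:
  fixes lo hi :: "real^'n \<Rightarrow> real"
  assumes L: "L \<ge> 0" and lo: "per_lip L lo" and hi: "per_lip L hi" and le: "\<And>x. lo x \<le> hi x"
    and T: "\<And>u. u \<in> lip_between L lo hi \<Longrightarrow> T u \<in> lip_between L lo hi"
    and C: "C \<ge> 0" and lip: "\<And>u v e x. u \<in> lip_between L lo hi \<Longrightarrow> v \<in> lip_between L lo hi \<Longrightarrow>
      (\<And>x. \<bar>u x - v x\<bar> \<le> e) \<Longrightarrow> \<bar>T u x - T v x\<bar> \<le> C * e"
  obtains u where "u \<in> lip_between L lo hi" "T u = u"
proof -
  have "\<exists>u. u \<in> lip_between L lo hi \<and> (\<forall>x. \<bar>T u x - u x\<bar> \<le> 1 / Suc n)" for n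
  proof -
    obtain u where "u \<in> lip_between L lo hi" "\<And>x. \<bar>T u x - u x\<bar> \<le> 1 / Suc n"
      by (rule lip_between_approximate_fixed_point[OF L lo hi le T C lip, where e="1 / Suc n"]) auto
    then show ?thesis by blast
  qed
  then obtain w where w: "\<And>n. w n \<in> lip_between L lo hi" "\<And>n x. \<bar>T (w n) x - w n x\<bar> \<le> 1 / Suc n"
    by metis
  obtain u r where u: "u \<in> lip_between L lo hi" and r: "strict_mono r"
    and lim: "uniform_limit UNIV (\<lambda>n. w (r n)) u sequentially"
    by (rule lip_between_compact[OF L lo hi w(1)])
  have "\<bar>T u x - u x\<bar> \<le> 0 + e" if e: "e > 0" for e x
  proof -
    define e' where "e' = e / (C + 3)"
    have e': "e' > 0" using e C by (simp add: e'_def)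
    then obtain N where N: "\<And>n x. n \<ge> N \<Longrightarrow> \<bar>w (r n) x - u x\<bar> < e'"
      using lim unfolding uniform_limit_sequentially_iff dist_real_def by blast
    obtain M where M: "1 / real (Suc M) < e'" using nat_approx_posE[OF e'] by blast
    define n where "n = max N M"
    have "n \<le> r n" by (rule seq_suble[OF r])
    then have "1 / real (Suc (r n)) \<le> 1 / real (Suc M)" by (intro divide_left_mono) (auto simp: n_def)
    then have 1: "\<bar>T (w (r n)) x - w (r n) x\<bar> \<le> e'" using w(2)[of "r n" x] M by linarith
    have 2: "\<bar>w (r n) x - u x\<bar> \<le> e'" for x using N[of n x] by (simp add: n_def less_imp_le)
    have 3: "\<bar>T (w (r n)) x - T u x\<bar> \<le> C * e'" by (rule lip[OF w(1) u 2])
    have "\<bar>T u x - u x\<bar> \<le> C * e' + 2 * e'" using 1 2[of x] 3 by linarith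
    also have "\<dots> \<le> (C + 3) * e'" using e' by (simp add: algebra_simps)
    also have "\<dots> = e" using C by (simp add: e'_def)
    finally show ?thesis by simp
  qed
  then have "\<bar>T u x - u x\<bar> \<le> 0" for x by (rule field_le_epsilon)
  then have "T u = u" by (simp add: fun_eq_iff)
  then show ?thesis using that u by blast
qed

section \<open>Linear elliptic equations with variable coefficient\<close>

lemma elliptic_nonneg:
  assumes d: "d > 0" and w: "axis_diff2 w" "continuous_on UNIV w" "\<And>x. w x \<ge> - B"
    and q: "q0 > 0" "\<And>x. q0 \<le> q x" and le: "\<And>x. - d * lap w x + q x * w x \<ge> 0"
  shows "w x \<ge> 0"
proof (rule max_principle[OF w, where c="q0 / d"])
  show "lap w x \<le> q0 / d * w x" if "w x < 0" for x
  proof -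
    have "q x * w x \<le> q0 * w x" using q(2)[of x] that by (intro mult_right_mono_neg) auto
    then have "d * lap w x \<le> q0 * w x" using le[of x] by simp
    then show ?thesis using d by (simp add: field_simps)
  qed
qed (use d q in auto)

lemma elliptic_comparison:
  assumes d: "d > 0" and u: "axis_diff2 u" "continuous_on UNIV u" "bounded (range u)"
    and v: "axis_diff2 v" "continuous_on UNIV v" "bounded (range v)"
    and q: "q0 > 0" "\<And>x. q0 \<le> q x"
    and le: "\<And>x. - d * lap u x + q x * u x \<le> - d * lap v x + q x * v x"
  shows "u x \<le> v x"
proof -
  obtain A B where A: "\<And>x. \<bar>u x\<bar> \<le> A" and B: "\<And>x. \<bar>v x\<bar> \<le> B"
    using u(3) v(3) by (auto simp: bounded_iff)
  have "v x - u x \<ge> 0"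
  proof (rule elliptic_nonneg[OF d _ _ _ q, where B="A + B"])
    show "axis_diff2 (\<lambda>x. v x - u x)" by (intro axis_diff2_diff u v)
    show "continuous_on UNIV (\<lambda>x. v x - u x)" by (intro continuous_intros u v)
    show "v x - u x \<ge> - (A + B)" for x using A[of x] B[of x] by linarith
    show "- d * lap (\<lambda>x. v x - u x) x + q x * (v x - u x) \<ge> 0" for x
      using le[of x] by (simp add: lap_diff u v algebra_simps)
  qed
  then show ?thesis by simp
qed

lemma elliptic_abs_bound:
  fixes w :: "real^'n \<Rightarrow> real"
  assumes d: "d > 0" and w: "axis_diff2 w" "continuous_on UNIV w" "bounded (range w)"
    and q: "q0 > 0" "\<And>x. q0 \<le> q x" and le: "\<And>x. \<bar>- d * lap w x + q x * w x\<bar> \<le> B"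
  shows "\<bar>w x\<bar> \<le> B / q0"
proof -
  have B0: "B \<ge> 0" using le[of 0] by simp
  have c: "B \<le> q x * (B / q0)" for x
    using q(2)[of x] q(1) B0 by (simp add: field_simps mult_left_mono)
  have const: "axis_diff2 (\<lambda>x::real^'n. k)" "continuous_on UNIV (\<lambda>x::real^'n. k)" "bounded (range (\<lambda>x::real^'n. k))" for k :: real
    by (auto simp: axis_diff2_const)
  have "w x \<le> B / q0"
    by (rule elliptic_comparison[OF d w const q]) (use le c in \<open>auto simp: lap_const abs_le_iff intro: order_trans\<close>)
  moreover have "- (B / q0) \<le> w x"
  proof (rule elliptic_comparison[OF d const w q])
    show "- d * lap (\<lambda>x. - (B / q0)) x + q x * - (B / q0) \<le> - d * lap w x + q x * w x" for x
      using le[of x] c[of x] by (simp add: lap_const)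
  qed
  ultimately show ?thesis by (simp add: abs_le_iff)
qed

lemma C2_periodic_facts:
  assumes "C2 u" "periodic1 u"
  shows "axis_diff2 u" "continuous_on UNIV u" "bounded (range u)"
proof -
  show "axis_diff2 u" "continuous_on UNIV u" using assms C2_axis_diff2 C2_continuous by blast+
  then obtain B where "\<And>x. \<bar>u x\<bar> \<le> B" using periodic_bounded[OF assms(2)] by blast
  then show "bounded (range u)" by (auto simp: bounded_iff)
qed

lemma C2_periodic_Cper:
  assumes "C2 u" "periodic1 u" "0 < \<delta>" "\<delta> < 1" shows "u \<in> Cper \<delta>"
  using C2_periodic_per_lip[OF assms(1,2)] per_lip_Cper assms(3,4) by metis

definition elliptic_sol :: "real \<Rightarrow> (real^'n \<Rightarrow> real) \<Rightarrow> (real^'n \<Rightarrow> real) \<Rightarrow> (real^'n \<Rightarrow> real) \<Rightarrow> bool" where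
  "elliptic_sol d q f u \<longleftrightarrow> C2 u \<and> periodic1 u \<and> (\<forall>x. - d * lap u x + q x * u x = f x)"

lemma elliptic_sol_bound:
  assumes d: "d > 0" and q: "q0 > 0" "\<And>x. q0 \<le> q x" and u: "elliptic_sol d q f u" and f: "\<And>x. \<bar>f x\<bar> \<le> B"
  shows "\<bar>u x\<bar> \<le> B / q0"
  by (rule elliptic_abs_bound[OF d C2_periodic_facts, where ?q0.0=q0 and q=q]) (use u f q in \<open>auto simp: elliptic_sol_def\<close>)

lemma elliptic_sol_mono:
  assumes d: "d > 0" and q: "q0 > 0" "\<And>x. q0 \<le> q x"
    and u: "elliptic_sol d q f u" and v: "elliptic_sol d q g v" and fg: "\<And>x. f x \<le> g x"
  shows "u x \<le> v x"
  by (rule elliptic_comparison[OF d C2_periodic_facts C2_periodic_facts, where ?q0.0=q0 and q=q])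
    (use u v fg q in \<open>auto simp: elliptic_sol_def\<close>)

lemma elliptic_sol_nonneg:
  assumes d: "d > 0" and q: "q0 > 0" "\<And>x. q0 \<le> q x" and u: "elliptic_sol d q f u" and f: "\<And>x. f x \<ge> 0"
  shows "u x \<ge> 0"
proof -
  have u': "C2 u" "periodic1 u" "\<And>x. - d * lap u x + q x * u x = f x" using u by (auto simp: elliptic_sol_def)
  obtain B where B: "\<And>x. \<bar>u x\<bar> \<le> B" using C2_periodic_facts(3)[OF u'(1,2)] by (auto simp: bounded_iff)
  show ?thesis
  proof (rule elliptic_nonneg[OF d C2_periodic_facts(1,2)[OF u'(1,2)] _ q])
    show "- B \<le> u x" for x using B[of x] by simp
    show "- d * lap u x + q x * u x \<ge> 0" for x using u'(3) f by simp
  qed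
qed

lemma elliptic_sol_diff:
  assumes d: "d > 0" and q: "q0 > 0" "\<And>x. q0 \<le> q x"
    and u: "elliptic_sol d q f u" and v: "elliptic_sol d q g v" and fg: "\<And>x. \<bar>f x - g x\<bar> \<le> e"
  shows "\<bar>u x - v x\<bar> \<le> e / q0"
proof -
  note uf = C2_periodic_facts[of u] and vf = C2_periodic_facts[of v]
  have uv: "C2 u" "periodic1 u" "C2 v" "periodic1 v" using u v by (auto simp: elliptic_sol_def)
  show ?thesis
  proof (rule elliptic_abs_bound[OF d _ _ _ q, where w="\<lambda>x. u x - v x"])
    show "axis_diff2 (\<lambda>x. u x - v x)" by (intro axis_diff2_diff uf vf uv)
    show "continuous_on UNIV (\<lambda>x. u x - v x)" by (intro continuous_intros uf vf uv)
    show "bounded (range (\<lambda>x. u x - v x))" by (intro bounded_minus_comp uf vf uv)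
    show "\<bar>- d * lap (\<lambda>x. u x - v x) x + q x * (u x - v x)\<bar> \<le> e" for x
    proof -
      have "- d * lap (\<lambda>x. u x - v x) x + q x * (u x - v x) = f x - g x"
        using u v by (auto simp: lap_diff[OF uf(1) vf(1)] uv elliptic_sol_def algebra_simps)
      then show ?thesis using fg by simp
    qed
  qed
qed

lemma elliptic_sol_unique:
  assumes "d > 0" "q0 > 0" "\<And>x. q0 \<le> q x" "elliptic_sol d q f u" "elliptic_sol d q f v"
  shows "u = v"
  using elliptic_sol_mono[OF assms(1-5)] elliptic_sol_mono[OF assms(1-3,5,4)] by (auto intro!: ext antisym)

definition lip_const :: "real \<Rightarrow> real \<Rightarrow> real \<Rightarrow> real \<Rightarrow> real" where
  "lip_const d q0 Q B = 3/2 * (B / q0 + (B + Q * (B / q0)) / d)"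

lemma elliptic_sol_per_lip:
  assumes d: "d > 0" and q: "q0 > 0" "\<And>x. q0 \<le> q x" "\<And>x. q x \<le> Q"
    and u: "elliptic_sol d q f u" and f: "\<And>x. \<bar>f x\<bar> \<le> B"
  shows "per_lip (lip_const d q0 Q B) u" "lip_const d q0 Q B \<ge> 0"
proof -
  have B0: "B \<ge> 0" using f[of 0] by simp
  have Q: "Q \<ge> 0" using q(1) q(2)[of 0] q(3)[of 0] by simp
  have ub: "\<bar>u x\<bar> \<le> B / q0" for x by (rule elliptic_sol_bound[OF d q(1,2) u f])
  have lb: "\<bar>lap u x\<bar> \<le> (B + Q * (B / q0)) / d" for x
  proof -
    have "d * lap u x = q x * u x - f x" using u by (simp add: elliptic_sol_def) (smt (verit))
    moreover have "\<bar>q x * u x\<bar> \<le> Q * (B / q0)"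
      unfolding abs_mult using q(1) q(2)[of x] q(3)[of x] ub[of x] Q by (intro mult_mono) auto
    ultimately have "\<bar>d * lap u x\<bar> \<le> B + Q * (B / q0)" using f[of x] by linarith
    then show ?thesis using d by (simp add: abs_mult field_simps)
  qed
  have nn: "0 \<le> B / q0" "0 \<le> (B + Q * (B / q0)) / d" using B0 Q d q(1) by auto
  show "lip_const d q0 Q B \<ge> 0" unfolding lip_const_def by (intro mult_nonneg_nonneg add_nonneg_nonneg nn) simp
  have uu: "C2 u" "periodic1 u" using u by (auto simp: elliptic_sol_def)
  show "per_lip (lip_const d q0 Q B) u"
    unfolding lip_const_def
  proof (rule per_lip_of_lap_bounded[OF C2_periodic_facts(1,2)[OF uu] uu(2)])
    show "\<bar>u x\<bar> \<le> B / q0 + (B + Q * (B / q0)) / d" for x using ub[of x] nn by linarith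
    show "\<bar>lap u x\<bar> \<le> B / q0 + (B + Q * (B / q0)) / d" for x using lb[of x] nn by linarith
  qed
qed

lemma elliptic_sol_const_exists:
  assumes d: "d > 0" and Q: "Q > 0" and f: "f \<in> Cper \<delta>" and \<delta>: "0 < \<delta>" "\<delta> < 1"
  shows "\<exists>u. elliptic_sol d (\<lambda>x. Q) f u"
proof -
  obtain u where u: "C2 u" "periodic1 u" "\<And>x. u x - d / Q * lap u x = 1 / Q * f x"
    using resolvent_equation_solvable[OF Cper_cmult[OF f \<delta>(1), of "1/Q"] \<delta>, of "d / Q"] d Q by auto
  have "- d * lap u x + Q * u x = f x" for x
    using u(3)[of x] Q by (simp add: field_simps)
  then show ?thesis using u by (auto simp: elliptic_sol_def)
qed

lemma elliptic_sol_exists: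
  fixes q f :: "real^'n \<Rightarrow> real"
  assumes d: "d > 0" and q: "q \<in> Cper \<delta>" "\<And>x. q x > 0" and f: "f \<in> Cper \<delta>" and \<delta>: "0 < \<delta>" "\<delta> < 1"
  shows "\<exists>u. elliptic_sol d q f u"
proof -
  obtain q0 where q0: "q0 > 0" "\<And>x. q0 \<le> q x" using Cper_lower_bound[OF q(1) \<delta>(1) q(2)] by blast
  obtain Q where Q: "Q > 0" "\<And>x. \<bar>q x\<bar> \<le> Q" using Cper_bounded[OF q(1) \<delta>(1)] by auto
  have qQ: "q x \<le> Q" for x using Q(2)[of x] by simp
  obtain B where B: "B > 0" "\<And>x. \<bar>f x\<bar> \<le> B" using Cper_bounded[OF f \<delta>(1)] by auto
  define M where "M = B / q0"
  have M: "M > 0" using B q0 by (simp add: M_def)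
  define L where "L = lip_const d Q Q (Q * M)"
  define g where "g u = (\<lambda>x. (Q - q x) * u x + f x)" for u :: "real^'n \<Rightarrow> real"
  define T where "T u = (SOME v. elliptic_sol d (\<lambda>x. Q) (g u) v)" for u
  define X where "X = lip_between L (\<lambda>x::real^'n. - M) (\<lambda>x. M)"
  have "0 \<le> Q * M" using Q M by simp
  then have L0: "L \<ge> 0" using d Q M unfolding L_def lip_const_def
    by (intro mult_nonneg_nonneg add_nonneg_nonneg divide_nonneg_pos) auto
  have T: "elliptic_sol d (\<lambda>x. Q) (g u) (T u)" if "u \<in> X" for u
  proof -
    have "u \<in> Cper \<delta>" using that L0 per_lip_Cper[OF _ _ \<delta>] by (auto simp: X_def lip_between_def)
    then have "g u \<in> Cper \<delta>" unfolding g_def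
      by (intro Cper_add Cper_mult Cper_diff Cper_const q(1) f \<delta>)
    from elliptic_sol_const_exists[OF d Q(1) this \<delta>] show ?thesis unfolding T_def by (rule someI_ex)
  qed
  have gb: "\<bar>g u x\<bar> \<le> Q * M" if "u \<in> X" for u x
  proof -
    have "\<bar>(Q - q x) * u x\<bar> \<le> (Q - q0) * M"
      unfolding abs_mult using q0(2)[of x] qQ[of x] that
      by (intro mult_mono) (auto simp: X_def lip_between_def abs_le_iff minus_le_iff)
    moreover have "(Q - q0) * M + B = Q * M" using q0 by (simp add: M_def field_simps)
    ultimately show ?thesis using B(2)[of x] unfolding g_def by linarith
  qed
  obtain u where u: "u \<in> X" "T u = u"
    unfolding X_def
  proof (rule lip_between_fixed_point[OF L0, where C=1 and T=T])
    show "per_lip L (\<lambda>x::real^'n. - M)" "per_lip L (\<lambda>x::real^'n. M)" using L0 by (auto intro: per_lip_const)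
    show "- M \<le> M" using M by simp
    show "T u \<in> lip_between L (\<lambda>x. - M) (\<lambda>x. M)" if "u \<in> lip_between L (\<lambda>x. - M) (\<lambda>x. M)" for u
    proof -
      have u: "u \<in> X" using that by (simp add: X_def)
      have "\<bar>T u x\<bar> \<le> Q * M / Q" for x
        by (rule elliptic_sol_bound[OF d Q(1) _ T[OF u] gb[OF u]]) simp
      moreover have "per_lip L (T u)" unfolding L_def
        by (rule elliptic_sol_per_lip(1)[OF d Q(1) _ _ T[OF u] gb[OF u]]) auto
      ultimately show ?thesis using Q by (auto simp: lip_between_def abs_le_iff minus_le_iff)
    qed
    show "\<bar>T u x - T v x\<bar> \<le> 1 * e"
      if uv: "u \<in> lip_between L (\<lambda>x. - M) (\<lambda>x. M)" "v \<in> lip_between L (\<lambda>x. - M) (\<lambda>x. M)"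
        and e: "\<And>x. \<bar>u x - v x\<bar> \<le> e" for u v e x
    proof -
      have "\<bar>g u x - g v x\<bar> \<le> Q * e" for x
      proof -
        have "g u x - g v x = (Q - q x) * (u x - v x)" by (simp add: g_def algebra_simps)
        then show ?thesis using e[of x] qQ[of x] q(2)[of x] unfolding abs_mult
          by (simp only: abs_mult) (intro mult_mono, auto)
      qed
      then have "\<bar>T u x - T v x\<bar> \<le> Q * e / Q"
        using uv by (intro elliptic_sol_diff[OF d Q(1) _ T T]) (auto simp: X_def)
      then show ?thesis using Q by simp
    qed
  qed auto
  have "elliptic_sol d (\<lambda>x. Q) (g u) u" using T[OF u(1)] u(2) by simp
  then have "elliptic_sol d q f u"
    unfolding elliptic_sol_def g_def by (simp add: algebra_simps)
  then show ?thesis by blast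
qed

section \<open>The principal eigenvalue\<close>

lemma Sup_range_upper:
  fixes w :: "'a \<Rightarrow> real"
  shows "bounded (range w) \<Longrightarrow> w x \<le> Sup (range w)"
  by (intro cSup_upper bounded_imp_bdd_above) auto

lemma Sup_range_least:
  fixes w :: "'a \<Rightarrow> real"
  shows "(\<And>x. w x \<le> B) \<Longrightarrow> Sup (range w) \<le> B"
  by (intro cSup_least) auto

lemma Sup_range_diff_le:
  fixes v w :: "'a \<Rightarrow> real"
  assumes "bounded (range v)" "bounded (range w)" "\<And>x. \<bar>v x - w x\<bar> \<le> e"
  shows "\<bar>Sup (range v) - Sup (range w)\<bar> \<le> e"
proof -
  have "v x \<le> Sup (range w) + e" "w x \<le> Sup (range v) + e" for x
    using Sup_range_upper[OF assms(1), of x] Sup_range_upper[OF assms(2), of x] assms(3)[of x] by linarith+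
  then have "Sup (range v) \<le> Sup (range w) + e" "Sup (range w) \<le> Sup (range v) + e"
    by (auto intro: Sup_range_least)
  then show ?thesis by linarith
qed

lemma per_lip_divide:
  assumes "per_lip K w" "K \<ge> 0" "0 < \<epsilon>" "\<epsilon> \<le> D"
  shows "per_lip (K / \<epsilon>) (\<lambda>x. (w x + c) / D)"
  unfolding per_lip_def
proof (intro allI)
  fix x z
  have "(w x + c) / D - (w z + c) / D = (w x - w z) / D" by (simp add: diff_divide_distrib[symmetric])
  then have "\<bar>(w x + c) / D - (w z + c) / D\<bar> = \<bar>w x - w z\<bar> / D" using assms by simp
  also have "\<dots> \<le> (K * per_dist x z) / \<epsilon>"
    using assms per_dist_nonneg[of x z] by (intro frac_le) (auto simp: per_lip_def)
  finally show "\<bar>(w x + c) / D - (w z + c) / D\<bar> \<le> K / \<epsilon> * per_dist x z" by simp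
qed

text \<open>Adding \<open>\<epsilon>\<close> keeps the normalised resolvent away from the zero function; comparison with
  constants then bounds \<open>\<kappa>\<close> from below independently of \<open>\<epsilon>\<close>.\<close>

lemma approximate_eigenfunction:
  fixes q :: "real^'n \<Rightarrow> real"
  assumes d: "d > 0" and \<delta>: "0 < \<delta>" "\<delta> < 1" and q: "q \<in> Cper \<delta>" "\<And>x. 1 \<le> q x" "\<And>x. q x \<le> Q"
    and \<epsilon>: "0 < \<epsilon>" "\<epsilon> \<le> 1"
  obtains u w \<kappa> z where "u \<in> lip_between (lip_const d 1 Q 1 * Q) (\<lambda>x. 0) (\<lambda>x. 1)" "u z = 1"
    "elliptic_sol d q u w" "\<And>x. \<kappa> * u x = w x + \<epsilon>" "1 / Q \<le> \<kappa>" "\<kappa> \<le> 2"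
proof -
  define K where "K = lip_const d 1 Q 1"
  have Q1: "Q \<ge> 1" using q(2)[of 0] q(3)[of 0] by simp
  have K: "K \<ge> 0" using d Q1 by (simp add: K_def lip_const_def)
  define X where "X = lip_between (K / \<epsilon>) (\<lambda>x::real^'n. 0) (\<lambda>x. 1)"
  have K\<epsilon>: "K / \<epsilon> \<ge> 0" using K \<epsilon> by simp
  have X: "per_lip (K / \<epsilon>) u" "0 \<le> u x" "u x \<le> 1" if "u \<in> X" for u x
    using that by (auto simp: X_def lip_between_def)
  have Xb: "bounded (range u)" if "u \<in> X" for u
    using X[OF that] by (auto simp: bounded_iff intro!: exI[of _ 1])
  define r where "r u = (\<lambda>x. u x + (1 - Sup (range u)))" for u :: "real^'n \<Rightarrow> real"
  have rX: "r u \<in> X" if "u \<in> X" for u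
  proof -
    have "Sup (range u) \<le> 1" using X(3)[OF that] by (rule Sup_range_least)
    moreover have "u x \<le> Sup (range u)" for x by (rule Sup_range_upper[OF Xb[OF that]])
    ultimately show ?thesis using X[OF that] by (auto simp: X_def lip_between_def r_def per_lip_def)
  qed
  define G where "G u = (SOME w. elliptic_sol d q u w)" for u
  have G: "elliptic_sol d q u (G u)" if "u \<in> X" for u
  proof -
    have "u \<in> Cper \<delta>" using X(1)[OF that] K\<epsilon> by (intro per_lip_Cper[OF _ _ \<delta>]) auto
    moreover have "q x > 0" for x using q(2)[of x] by simp
    ultimately have "\<exists>w. elliptic_sol d q u w" by (intro elliptic_sol_exists[OF d q(1) _ _ \<delta>])
    then show ?thesis unfolding G_def by (rule someI_ex)
  qed
  have one: "0 < (1::real)" by simp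
  have Xabs: "\<bar>u x\<bar> \<le> 1" if "u \<in> X" for u x using X[OF that] by (simp add: abs_le_iff)
  have G1: "\<bar>G u x\<bar> \<le> 1" if "u \<in> X" for u x
    using elliptic_sol_bound[OF d one q(2) G[OF that] Xabs[OF that], of x] by simp
  have G0: "0 \<le> G u x" if "u \<in> X" for u x
    by (rule elliptic_sol_nonneg[OF d one q(2) G[OF that] X(2)[OF that]])
  have GK: "per_lip K (G u)" if "u \<in> X" for u
    unfolding K_def by (rule elliptic_sol_per_lip(1)[OF d one q(2,3) G[OF that] Xabs[OF that]])
  define D where "D u = Sup (range (\<lambda>x. G (r u) x + \<epsilon>))" for u
  have Db: "bounded (range (\<lambda>x. G (r u) x + \<epsilon>))" if "u \<in> X" for u
  proof -
    have "\<bar>G (r u) x + \<epsilon>\<bar> \<le> 1 + \<epsilon>" for x using G1[OF rX[OF that], of x] \<epsilon> by linarith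
    then show ?thesis by (auto simp: bounded_iff)
  qed
  have D_up: "G (r u) x + \<epsilon> \<le> D u" if "u \<in> X" for u x
    unfolding D_def by (rule Sup_range_upper[OF Db[OF that]])
  have D\<epsilon>: "\<epsilon> \<le> D u" if "u \<in> X" for u
    using D_up[OF that, of 0] G0[OF rX[OF that], of 0] by simp
  define T where "T u = (\<lambda>x. (G (r u) x + \<epsilon>) / D u)" for u
  have T01: "0 \<le> T u x" "T u x \<le> 1" if "u \<in> X" for u x
  proof -
    have "D u > 0" using D\<epsilon>[OF that] \<epsilon> by simp
    then show "0 \<le> T u x" "T u x \<le> 1"
      using D_up[OF that, of x] G0[OF rX[OF that], of x] \<epsilon> by (auto simp: T_def)
  qed
  obtain u where u: "u \<in> X" "T u = u"
    unfolding X_def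
  proof (rule lip_between_fixed_point[OF K\<epsilon>, where C="4 / \<epsilon>" and T=T])
    show "per_lip (K / \<epsilon>) (\<lambda>x::real^'n. 0)" "per_lip (K / \<epsilon>) (\<lambda>x::real^'n. 1)"
      using K\<epsilon> by (auto intro: per_lip_const)
    show "T u \<in> lip_between (K / \<epsilon>) (\<lambda>x. 0) (\<lambda>x. 1)" if "u \<in> lip_between (K / \<epsilon>) (\<lambda>x. 0) (\<lambda>x. 1)" for u
    proof -
      have u: "u \<in> X" using that by (simp add: X_def)
      have "per_lip (K / \<epsilon>) (T u)" unfolding T_def
        by (rule per_lip_divide[OF GK[OF rX[OF u]] K \<epsilon>(1) D\<epsilon>[OF u]])
      then show ?thesis using T01[OF u] by (simp add: lip_between_def)
    qed
    show "\<bar>T u x - T v x\<bar> \<le> 4 / \<epsilon> * e"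
      if "u \<in> lip_between (K / \<epsilon>) (\<lambda>x. 0) (\<lambda>x. 1)" "v \<in> lip_between (K / \<epsilon>) (\<lambda>x. 0) (\<lambda>x. 1)"
        and e: "\<And>x. \<bar>u x - v x\<bar> \<le> e" for u v e x
    proof -
      have uv: "u \<in> X" "v \<in> X" using that by (auto simp: X_def)
      have "\<bar>r u y - r v y\<bar> \<le> 2 * e" for y
        using e[of y] Sup_range_diff_le[OF Xb[OF uv(1)] Xb[OF uv(2)] e] unfolding r_def by linarith
      from elliptic_sol_diff[OF d one q(2) G[OF rX[OF uv(1)]] G[OF rX[OF uv(2)]] this]
      have Ge: "\<bar>(G (r u) y + \<epsilon>) - (G (r v) y + \<epsilon>)\<bar> \<le> 2 * e" for y by simp
      have De: "\<bar>D u - D v\<bar> \<le> 2 * e"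
        unfolding D_def by (rule Sup_range_diff_le[OF Db[OF uv(1)] Db[OF uv(2)] Ge])
      have Dp: "D u > 0" "D v > 0" using D\<epsilon>[OF uv(1)] D\<epsilon>[OF uv(2)] \<epsilon> by auto
      have "T u x - T v x = ((G (r u) x + \<epsilon>) - (G (r v) x + \<epsilon>) + T v x * (D v - D u)) / D u"
        using Dp by (simp add: T_def field_simps)
      also have "\<bar>\<dots>\<bar> \<le> (4 * e) / \<epsilon>"
        unfolding abs_divide
      proof (rule frac_le)
        have "\<bar>T v x * (D v - D u)\<bar> \<le> 1 * (2 * e)"
          unfolding abs_mult using T01[OF uv(2), of x] De by (intro mult_mono) (auto simp: abs_minus_commute)
        then show "\<bar>(G (r u) x + \<epsilon>) - (G (r v) x + \<epsilon>) + T v x * (D v - D u)\<bar> \<le> 4 * e"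
          using Ge[of x] by linarith
        show "0 \<le> 4 * e" using e[of x] by simp
      qed (use \<epsilon> D\<epsilon>[OF uv(1)] in auto)
      finally show ?thesis by simp
    qed
  qed (use \<epsilon> in auto)
  define \<kappa> where "\<kappa> = D u"
  have \<kappa>: "\<kappa> > 0" using D\<epsilon>[OF u(1)] \<epsilon> by (simp add: \<kappa>_def)
  have eq: "\<kappa> * u x = G (r u) x + \<epsilon>" for x
    using fun_cong[OF u(2), of x] \<kappa> by (simp add: T_def \<kappa>_def field_simps)
  have GC: "C2 (G (r u))" "periodic1 (G (r u))" using G[OF rX[OF u(1)]] by (auto simp: elliptic_sol_def)
  obtain z where z: "\<And>x. G (r u) x \<le> G (r u) z" using periodic_attains_max[OF GC(2) C2_continuous[OF GC(1)]] by blast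
  have "\<kappa> \<le> G (r u) z + \<epsilon>" unfolding \<kappa>_def D_def by (rule Sup_range_least) (use z in simp)
  then have "\<kappa> * u z \<ge> \<kappa> * 1" using eq[of z] by simp
  then have uz: "u z = 1" using \<kappa> X(3)[OF u(1), of z] by simp
  then have "Sup (range u) = 1"
    using Sup_range_upper[OF Xb[OF u(1)], of z] Sup_range_least[of u 1] X(3)[OF u(1)] by simp
  then have ru: "r u = u" by (simp add: r_def)
  define w where "w = G u"
  have w: "elliptic_sol d q u w" unfolding w_def by (rule G[OF u(1)])
  have eqw: "\<kappa> * u x = w x + \<epsilon>" for x using eq[of x] by (simp add: ru w_def)
  have k2: "\<kappa> \<le> 2" using eqw[of z] uz G1[OF u(1), of z] \<epsilon> by (simp add: w_def abs_le_iff)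
  have ulip: "per_lip (K / \<epsilon>) u" by (rule X(1)[OF u(1)])
  have up: "u \<in> Cper \<delta>" using ulip K\<epsilon> by (intro per_lip_Cper[OF _ _ \<delta>])
  obtain y where y: "\<And>x. u y \<le> u x"
    using periodic_attains_min[of u] Cper_continuous[OF up \<delta>(1)] up by (auto simp: Cper_def)
  have "\<kappa> * u y > 0" using eqw[of y] G0[OF u(1), of y] \<epsilon> by (simp add: w_def)
  then have uy: "u y > 0" using \<kappa> by (simp add: zero_less_mult_iff)
  have wC: "C2 w" "periodic1 w" using w by (auto simp: elliptic_sol_def)
  have wy: "u y / Q \<le> w x" for x
  proof (rule elliptic_comparison[OF d _ _ _ C2_periodic_facts[OF wC], where ?q0.0=1 and q=q and u="\<lambda>x. u y / Q"])
    show "- d * lap (\<lambda>x. u y / Q) x + q x * (u y / Q) \<le> - d * lap w x + q x * w x" for x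
    proof -
      have "q x * (u y / Q) \<le> Q * (u y / Q)" using q(3) uy Q1 by (intro mult_right_mono) auto
      also have "\<dots> = u y" using Q1 by simp
      also have "\<dots> \<le> - d * lap w x + q x * w x" using w y by (simp add: elliptic_sol_def)
      finally show ?thesis by (simp add: lap_const)
    qed
  qed (use q in \<open>auto simp: axis_diff2_const\<close>)
  have "1 / Q * u y \<le> \<kappa> * u y" using eqw[of y] wy[of y] \<epsilon> by simp
  then have kQ: "1 / Q \<le> \<kappa>" using uy by (simp only: mult_le_cancel_right_pos)
  have "per_lip (K / (1 / Q)) (\<lambda>x. (w x + \<epsilon>) / \<kappa>)"
    by (rule per_lip_divide[OF _ K _ kQ]) (use GK[OF u(1)] Q1 in \<open>auto simp: w_def\<close>)
  moreover have "(\<lambda>x. (w x + \<epsilon>) / \<kappa>) = u" using eqw \<kappa> by (simp add: fun_eq_iff field_simps)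
  ultimately have "per_lip (K * Q) u" by simp
  then have "u \<in> lip_between (lip_const d 1 Q 1 * Q) (\<lambda>x. 0) (\<lambda>x. 1)"
    using X(2,3)[OF u(1)] by (simp add: lip_between_def K_def)
  then show ?thesis by (rule that[OF _ uz w eqw kQ k2])
qed

definition eigenpair :: "real \<Rightarrow> (real^'n \<Rightarrow> real) \<Rightarrow> real \<Rightarrow> (real^'n \<Rightarrow> real) \<Rightarrow> bool" where
  "eigenpair d c l \<phi> \<longleftrightarrow> C2 \<phi> \<and> periodic1 \<phi> \<and> (\<forall>x. \<phi> x > 0) \<and>
      (\<forall>x. - d * lap \<phi> x - c x * \<phi> x = l * \<phi> x)"

lemma eigenpair_exists:
  fixes c :: "real^'n \<Rightarrow> real"
  assumes d: "d > 0" and \<delta>: "0 < \<delta>" "\<delta> < 1" and c: "c \<in> Cper \<delta>"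
  shows "\<exists>l \<phi>. eigenpair d c l \<phi>"
proof -
  obtain C where C: "C > 0" "\<And>x. \<bar>c x\<bar> \<le> C" using Cper_bounded[OF c \<delta>(1)] by auto
  define m where "m = C + 1"
  define Q where "Q = 2 * C + 1"
  define q where "q = (\<lambda>x. m - c x)"
  have q: "q \<in> Cper \<delta>" "\<And>x. 1 \<le> q x" "\<And>x. q x \<le> Q"
    using C(2) by (auto simp: q_def m_def Q_def abs_le_iff intro!: Cper_diff Cper_const c \<delta>)
  have Q0: "Q > 0" using C by (simp add: Q_def)
  define L where "L = lip_const d 1 Q 1 * Q"
  have L0: "L \<ge> 0" using d Q0 by (simp add: L_def lip_const_def)
  define X where "X = lip_between L (\<lambda>x::real^'n. 0) (\<lambda>x. 1)"
  have "\<exists>u w \<kappa> z. u \<in> X \<and> u z = 1 \<and> elliptic_sol d q u w \<and> (\<forall>x. \<kappa> * u x = w x + 1 / Suc n) \<and> \<kappa> \<in> {1 / Q..2}" for n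
  proof -
    obtain u w \<kappa> z where "u \<in> X" "u z = 1" "elliptic_sol d q u w" "\<And>x. \<kappa> * u x = w x + 1 / Suc n" "1 / Q \<le> \<kappa>" "\<kappa> \<le> 2"
      unfolding X_def L_def
      by (rule approximate_eigenfunction[OF d \<delta> q, where \<epsilon>="1 / Suc n"]) auto
    then show ?thesis by (intro exI[of _ u] exI[of _ w] exI[of _ \<kappa>] exI[of _ z]) auto
  qed
  then obtain u w \<kappa> z where u: "\<And>n. u n \<in> X" "\<And>n. u n (z n) = 1" and w: "\<And>n. elliptic_sol d q (u n) (w n)"
    and eq: "\<And>n x. \<kappa> n * u n x = w n x + 1 / Suc n" and \<kappa>: "\<And>n. \<kappa> n \<in> {1 / Q..2}"
    by metis
  have "seq_compact {1 / Q..2}" by (intro compact_imp_seq_compact compact_Icc)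
  then obtain k r1 where k: "k \<in> {1 / Q..2}" and r1: "strict_mono r1" "(\<kappa> \<circ> r1) \<longlonglongrightarrow> k"
    using \<kappa> unfolding seq_compact_def by blast
  obtain v r2 where v: "v \<in> X" and r2: "strict_mono r2" and lim: "uniform_limit UNIV (\<lambda>n. u (r1 (r2 n))) v sequentially"
    unfolding X_def
    by (rule lip_between_compact[of L "\<lambda>x. 0" "\<lambda>x. 1" "\<lambda>n. u (r1 n)"]) (use L0 u in \<open>auto simp: X_def intro: per_lip_const\<close>)
  define s where "s n = r1 (r2 n)" for n
  have s: "strict_mono s" using strict_mono_o[OF r1(1) r2] by (simp add: s_def[abs_def] o_def)
  have ks: "(\<lambda>n. \<kappa> (s n)) \<longlonglongrightarrow> k"
    using LIMSEQ_subseq_LIMSEQ[OF r1(2) r2] by (simp add: o_def s_def)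
  have lim: "uniform_limit UNIV (\<lambda>n. u (s n)) v sequentially" using lim by (simp add: s_def)
  have vC: "v \<in> Cper \<delta>" using v L0 by (auto simp: X_def lip_between_def intro: per_lip_Cper[OF _ _ \<delta>])
  have qpos: "q x > 0" for x using q(2)[of x] by simp
  obtain W where W: "elliptic_sol d q v W" using elliptic_sol_exists[OF d q(1) qpos vC \<delta>] by blast
  have one: "0 < (1::real)" by simp
  have uv: "(\<lambda>n. u (s n) x) \<longlonglongrightarrow> v x" for x using tendsto_uniform_limitI[OF lim] by simp
  have wW: "(\<lambda>n. w (s n) x) \<longlonglongrightarrow> W x" for x
  proof (rule LIMSEQ_I)
    fix e :: real assume "e > 0"
    then have "e / 2 > 0" by simp
    then obtain N where N: "\<And>n x. n \<ge> N \<Longrightarrow> \<bar>u (s n) x - v x\<bar> < e / 2"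
      using lim unfolding uniform_limit_sequentially_iff dist_real_def by blast
    have "norm (w (s n) x - W x) < e" if "n \<ge> N" for n
      using elliptic_sol_diff[OF d one q(2) w[of "s n"] W, of "e / 2" x] N[OF that] \<open>e > 0\<close>
      by (simp add: less_imp_le)
    then show "\<exists>N. \<forall>n\<ge>N. norm (w (s n) x - W x) < e" by blast
  qed
  have inv0: "(\<lambda>n. 1 / real (Suc (s n))) \<longlonglongrightarrow> 0"
    using LIMSEQ_subseq_LIMSEQ[OF LIMSEQ_Suc[OF lim_1_over_n] s] by (simp add: o_def)
  have kW: "k * v x = W x" for x
  proof -
    have "(\<lambda>n. \<kappa> (s n) * u (s n) x) \<longlonglongrightarrow> k * v x" by (intro tendsto_mult ks uv)
    moreover have "(\<lambda>n. w (s n) x + 1 / real (Suc (s n))) \<longlonglongrightarrow> W x + 0" by (intro tendsto_add wW inv0)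
    ultimately show ?thesis using LIMSEQ_unique unfolding eq by auto
  qed
  have k0: "k > 0" using k Q0 by (auto intro: less_le_trans[of 0 "1 / Q"])
  have v0: "v x \<ge> 0" for x using v by (simp add: X_def lip_between_def)
  obtain N where "\<And>n x. n \<ge> N \<Longrightarrow> \<bar>u (s n) x - v x\<bar> < 1 / 2"
    using lim unfolding uniform_limit_sequentially_iff dist_real_def
    by (meson zero_less_divide_1_iff zero_less_numeral UNIV_I)
  from this[of N "z (s N)"] have "v (z (s N)) > 0" using u(2)[of "s N"] by linarith
  then have pos: "W (z (s N)) > 0" using kW[of "z (s N)"] k0 by (simp flip: kW)
  have WC: "C2 W" "periodic1 W" "\<And>x. - d * lap W x + q x * W x = v x" using W by (auto simp: elliptic_sol_def)
  have W0: "W x \<ge> 0" for x using kW[of x] k0 v0[of x] by (simp flip: kW)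
  have "W x > 0" for x
  proof (rule strong_max_principle[OF C2_periodic_facts(1,2)[OF WC(1,2)] W0 _ _ pos, where c="Q / d"])
    show "lap W x \<le> Q / d * W x" for x
    proof -
      have "q x * W x \<le> Q * W x" using q(3) W0 by (intro mult_right_mono)
      then have "d * lap W x \<le> Q * W x" using WC(3)[of x] v0[of x] by simp
      then show ?thesis using d by (simp add: field_simps)
    qed
  qed (use Q0 d in auto)
  moreover have "- d * lap W x - c x * W x = (1 / k - m) * W x" for x
    using WC(3)[of x] kW[of x] k0 by (simp add: q_def field_simps)
  ultimately have "eigenpair d c (1 / k - m) W" using WC by (simp add: eigenpair_def)
  then show ?thesis by blast
qed

lemma lap_nonneg_at_min:
  assumes w: "axis_diff2 w" and min: "\<And>x. w z \<le> w x"
  shows "lap w z \<ge> 0"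
proof -
  obtain p q where pq: "axis_derivs w p q" using w unfolding axis_diff2_def by blast
  have "q i z \<ge> 0" for i
  proof (rule second_deriv_nonneg_at_min[where e=1 and a=0 and g="\<lambda>t. w (z + ray i t)"
        and g'="\<lambda>t. p i (z + ray i t)"])
    show "((\<lambda>t. w (z + ray i t)) has_real_derivative p i (z + ray i t)) (at t)" for t
      by (rule axis_derivs_first[OF pq])
    show "((\<lambda>t. p i (z + ray i t)) has_real_derivative q i z) (at 0)"
      using axis_derivs_second[OF pq, of i z 0] by simp
  qed (use min in auto)
  then show ?thesis by (simp add: axis_derivs_lap[OF pq] sum_nonneg)
qed

lemma eigenvalue_le:
  assumes d: "d > 0" and \<phi>: "eigenpair d c l \<phi>" and \<psi>: "eigenpair d c m \<psi>"
  shows "m \<le> l"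
proof -
  have C: "C2 \<phi>" "periodic1 \<phi>" "\<And>x. \<phi> x > 0" "C2 \<psi>" "periodic1 \<psi>" "\<And>x. \<psi> x > 0"
    and e\<phi>: "\<And>x. - d * lap \<phi> x - c x * \<phi> x = l * \<phi> x" and e\<psi>: "\<And>x. - d * lap \<psi> x - c x * \<psi> x = m * \<psi> x"
    using \<phi> \<psi> by (auto simp: eigenpair_def)
  have ne: "\<psi> x \<noteq> 0" for x using C(6)[of x] by simp
  have "continuous_on UNIV (\<lambda>x. \<phi> x / \<psi> x)"
    using ne by (intro continuous_intros C2_continuous C) auto
  moreover have "periodic1 (\<lambda>x. \<phi> x / \<psi> x)" using C(2,5) by (simp add: periodic1_def)
  ultimately obtain z where z: "\<And>x. \<phi> x / \<psi> x \<le> \<phi> z / \<psi> z" using periodic_attains_max by blast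
  define k where "k = \<phi> z / \<psi> z"
  have kz: "k * \<psi> z = \<phi> z" using ne by (simp add: k_def)
  have ge: "k * \<psi> x - \<phi> x \<ge> 0" for x using z[of x] C(6)[of x] by (simp add: k_def[symmetric] pos_divide_le_eq)
  note a = C2_axis_diff2[OF C(1)] C2_axis_diff2[OF C(4)]
  have "lap (\<lambda>x. k * \<psi> x - \<phi> x) z \<ge> 0"
    by (rule lap_nonneg_at_min) (use ge kz in \<open>auto intro!: axis_diff2_diff axis_diff2_cmult a\<close>)
  then have "k * lap \<psi> z - lap \<phi> z \<ge> 0" by (simp add: lap_diff lap_cmult axis_diff2_cmult a)
  then have "d * (k * lap \<psi> z - lap \<phi> z) \<ge> 0" using d by simp
  moreover have "d * (k * lap \<psi> z - lap \<phi> z) = (l - m) * \<phi> z"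
  proof -
    have "k * (- d * lap \<psi> z - c z * \<psi> z) = k * (m * \<psi> z)" using e\<psi>[of z] by simp
    then have "k * d * lap \<psi> z = - (c z + m) * (k * \<psi> z)" by (simp add: algebra_simps)
    then have "k * d * lap \<psi> z = - (c z + m) * \<phi> z" by (simp add: kz)
    moreover have "d * lap \<phi> z = - (c z + l) * \<phi> z" using e\<phi>[of z] by (simp add: algebra_simps)
    ultimately show ?thesis by (simp add: algebra_simps)
  qed
  ultimately have "0 \<le> (l - m) * \<phi> z" by simp
  then show ?thesis using C(3)[of z] by (simp add: zero_le_mult_iff)
qed

lemma princ_eig_eigenpair:
  assumes "d > 0" "0 < \<delta>" "\<delta> < 1" "c \<in> Cper \<delta>"
  shows "\<exists>\<phi>. eigenpair d c (princ_eig d c) \<phi>"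
proof -
  obtain l \<phi> where l: "eigenpair d c l \<phi>" using eigenpair_exists[OF assms] by blast
  have "princ_eig d c = l"
    unfolding princ_eig_def eigenpair_def[symmetric]
    using l eigenvalue_le[OF assms(1)] by (blast intro: the_equality antisym)
  then show ?thesis using l by blast
qed

section \<open>The nonlinear system\<close>

definition bdd_nonneg_subsol :: "real \<Rightarrow> (real^'n \<Rightarrow> real) \<Rightarrow> (real^'n \<Rightarrow> real) \<Rightarrow> (real^'n \<Rightarrow> real) \<Rightarrow> bool" where
  "bdd_nonneg_subsol d g a J \<longleftrightarrow> C2 J \<and> bounded (range J) \<and> (\<forall>x. J x \<ge> 0) \<and>
      (\<forall>x. - d * lap J x \<le> g x * J x - a x * (J x)\<^sup>2)"

lemma logistic_mono:
  fixes \<Lambda> g a s t M :: real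
  assumes "0 \<le> s" "s \<le> t" "t \<le> M" "0 \<le> a" "0 \<le> \<Lambda> + g - 2 * a * M"
  shows "(\<Lambda> + g - a * s) * s \<le> (\<Lambda> + g - a * t) * t"
proof -
  have "a * (s + t) \<le> a * (2 * M)" using assms by (intro mult_left_mono) auto
  then have "0 \<le> (t - s) * (\<Lambda> + g - a * (s + t))" using assms by (intro mult_nonneg_nonneg) auto
  also have "\<dots> = (\<Lambda> + g - a * t) * t - (\<Lambda> + g - a * s) * s"
    by (simp add: algebra_simps)
  finally show ?thesis by simp
qed

lemma per_lip_Inf:
  fixes Z :: "(real^'n \<Rightarrow> real) set"
  assumes Z: "Z \<noteq> {}" "\<And>v. v \<in> Z \<Longrightarrow> per_lip L v" "\<And>v x. v \<in> Z \<Longrightarrow> b \<le> v x"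
  shows "per_lip L (\<lambda>x. INF v\<in>Z. v x)"
proof -
  have bdd: "bdd_below ((\<lambda>v. v x) ` Z)" for x using Z(3) by (intro bdd_belowI[of _ b]) auto
  have "(INF v\<in>Z. v x) - L * per_dist x z \<le> (INF v\<in>Z. v z)" for x z
  proof (rule cINF_greatest[OF Z(1)])
    fix v assume v: "v \<in> Z"
    have "(INF v\<in>Z. v x) \<le> v x" by (rule cINF_lower[OF bdd v])
    then show "(INF v\<in>Z. v x) - L * per_dist x z \<le> v z"
      using Z(2)[OF v] unfolding per_lip_def by (smt (verit))
  qed
  from this[where x=x and z=z for x z] show ?thesis
    unfolding per_lip_def abs_le_iff by (metis add.commute diff_le_eq minus_diff_eq per_dist_commute)
qed

text \<open>Knaster--Tarski: the greatest solution is the infimum of all supersolutions lying above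
  every bounded subsolution, periodic or not.\<close>

lemma greatest_solution_exists:
  fixes g a :: "real^'n \<Rightarrow> real"
  assumes d: "d > 0" and \<delta>: "0 < \<delta>" "\<delta> < 1" and g: "g \<in> Cper \<delta>" and a: "a \<in> Cper \<delta>" "\<And>x. a x > 0"
  shows "\<exists>I. bdd_nonneg_sol d g a I \<and> periodic1 I \<and> (\<forall>J. bdd_nonneg_subsol d g a J \<longrightarrow> (\<forall>x. J x \<le> I x))"
proof -
  obtain a0 where a0: "a0 > 0" "\<And>x. a0 \<le> a x" using Cper_lower_bound[OF a(1) \<delta>(1) a(2)] by blast
  obtain A where A: "A > 0" "\<And>x. \<bar>a x\<bar> \<le> A" using Cper_bounded[OF a(1) \<delta>(1)] by auto
  obtain G where G: "G > 0" "\<And>x. \<bar>g x\<bar> \<le> G" using Cper_bounded[OF g \<delta>(1)] by auto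
  have gG: "g x \<le> G" "- G \<le> g x" for x using G(2)[of x] by auto
  define M where "M = G / a0 + 1"
  have M: "M \<ge> 1" "G \<le> a0 * M" using G a0 by (auto simp: M_def field_simps)
  have J_le_M: "J x \<le> M" if J: "bdd_nonneg_subsol d g a J" for J x
  proof -
    have Jf: "C2 J" "bounded (range J)" "\<And>x. J x \<ge> 0" "\<And>x. - d * lap J x \<le> g x * J x - a x * (J x)\<^sup>2"
      using J by (auto simp: bdd_nonneg_subsol_def)
    obtain B where B: "\<And>x. \<bar>J x\<bar> \<le> B" using Jf(2) by (auto simp: bounded_iff)
    have "M - J x \<ge> 0"
    proof (rule max_principle[where w="\<lambda>x. M - J x" and B="B" and c="a0 / d"])
      show "axis_diff2 (\<lambda>x. M - J x)" by (intro axis_diff2_diff axis_diff2_const C2_axis_diff2 Jf)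
      show "continuous_on UNIV (\<lambda>x. M - J x)" by (intro continuous_intros C2_continuous Jf)
      show "M - J x \<ge> - B" for x using B[of x] M by linarith
      show "lap (\<lambda>x. M - J x) x \<le> a0 / d * (M - J x)" if "M - J x < 0" for x
      proof -
        have J1: "J x \<ge> 1" "J x > M" using that M by auto
        have "a0 * J x \<le> a x * J x" using a0(2)[of x] J1 by (intro mult_right_mono) auto
        then have "g x - a x * J x \<le> a0 * (M - J x)" using gG(1)[of x] M(2) by (simp add: right_diff_distrib)
        then have "J x * (g x - a x * J x) \<le> J x * (a0 * (M - J x))" using J1 by (intro mult_left_mono) auto
        also have "\<dots> \<le> 1 * (a0 * (M - J x))"
          using J1 a0 by (intro mult_right_mono_neg) (auto simp: mult_le_0_iff)
        finally have "- d * lap J x \<le> a0 * (M - J x)" using Jf(4)[of x] by (simp add: power2_eq_square algebra_simps)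
        then have "- lap J x \<le> a0 / d * (M - J x)" using d by (simp add: field_simps)
        then show ?thesis by (simp add: lap_diff axis_diff2_const C2_axis_diff2 Jf lap_const)
      qed
    qed (use a0 d in auto)
    then show ?thesis by simp
  qed
  define \<Lambda> where "\<Lambda> = G + 2 * A * M"
  have AM: "A * M \<ge> 0" using A M by simp
  have \<Lambda>: "\<Lambda> > 0" using G AM by (simp add: \<Lambda>_def)
  have mono: "0 \<le> \<Lambda> + g x - 2 * a x * M" for x
  proof -
    have "a x * M \<le> A * M" using A(2)[of x] M by (intro mult_right_mono) auto
    then show ?thesis using gG[of x] by (simp add: \<Lambda>_def)
  qed
  define f where "f v = (\<lambda>x. (\<Lambda> + g x - a x * v x) * v x)" for v :: "real^'n \<Rightarrow> real"
  define L where "L = lip_const d \<Lambda> \<Lambda> (\<Lambda> * M)"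
  have L0: "L \<ge> 0" using d \<Lambda> M unfolding L_def lip_const_def
    by (intro mult_nonneg_nonneg add_nonneg_nonneg divide_nonneg_pos) auto
  define X where "X = lip_between L (\<lambda>x::real^'n. 0) (\<lambda>x. M)"
  have X: "per_lip L v" "0 \<le> v x" "v x \<le> M" if "v \<in> X" for v x
    using that by (auto simp: X_def lip_between_def)
  define T where "T v = (SOME w. elliptic_sol d (\<lambda>x. \<Lambda>) (f v) w)" for v
  have XC: "v \<in> Cper \<delta>" if "v \<in> X" for v
    using X(1)[OF that] L0 by (intro per_lip_Cper[OF _ _ \<delta>])
  have T: "elliptic_sol d (\<lambda>x. \<Lambda>) (f v) (T v)" if "v \<in> X" for v
  proof -
    have "f v \<in> Cper \<delta>" unfolding f_def
      by (intro Cper_add Cper_mult Cper_diff Cper_const g a(1) \<delta> XC[OF that])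
    from elliptic_sol_const_exists[OF d \<Lambda> this \<delta>] show ?thesis unfolding T_def by (rule someI_ex)
  qed
  have fmono: "f v x \<le> f w x" if "0 \<le> v x" "v x \<le> w x" "w x \<le> M" for v w x
    unfolding f_def using that less_imp_le[OF a(2)] mono by (intro logistic_mono) auto
  have f0: "0 \<le> f v x" and fM: "f v x \<le> \<Lambda> * M" if "v \<in> X" for v x
  proof -
    show "0 \<le> f v x" using fmono[of "\<lambda>x. 0" x v] X(2,3)[OF that, of x] by (simp add: f_def)
    have "a0 * M \<le> a x * M" using a0(2)[of x] M by (intro mult_right_mono) auto
    then have "g x \<le> a x * M" using gG(1)[of x] M(2) by linarith
    then have "(\<Lambda> + g x - a x * M) * M \<le> \<Lambda> * M" using M by (intro mult_right_mono) auto
    then show "f v x \<le> \<Lambda> * M" using fmono[of v x "\<lambda>x. M"] X(2,3)[OF that, of x] by (simp add: f_def)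
  qed
  have fabs: "\<bar>f v x\<bar> \<le> \<Lambda> * M" if "v \<in> X" for v x using f0[OF that, of x] fM[OF that, of x] by simp
  have const_facts: "axis_diff2 (\<lambda>x::real^'n. k)" "continuous_on UNIV (\<lambda>x::real^'n. k)" "bounded (range (\<lambda>x::real^'n. k))" for k :: real
    by (auto simp: axis_diff2_const)
  have TC: "C2 (T v)" "periodic1 (T v)" "\<And>x. - d * lap (T v) x + \<Lambda> * T v x = f v x" if "v \<in> X" for v
    using T[OF that] by (auto simp: elliptic_sol_def)
  have TX: "T v \<in> X" if v: "v \<in> X" for v
  proof -
    have "0 \<le> T v x" for x
      by (rule elliptic_comparison[OF d const_facts C2_periodic_facts[OF TC(1,2)[OF v]] \<Lambda>, where q="\<lambda>x. \<Lambda>"])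
        (use TC(3)[OF v] f0[OF v] in \<open>auto simp: lap_const\<close>)
    moreover have "T v x \<le> \<Lambda> * M / \<Lambda>" for x
      using elliptic_sol_bound[OF d \<Lambda> _ T[OF v] fabs[OF v], of x] by simp
    moreover have "per_lip L (T v)" unfolding L_def
      by (rule elliptic_sol_per_lip(1)[OF d \<Lambda> _ _ T[OF v] fabs[OF v]]) auto
    ultimately show ?thesis using \<Lambda> by (simp add: X_def lip_between_def)
  qed
  have T_mono: "T v x \<le> T w x" if "v \<in> X" "w \<in> X" "\<And>x. v x \<le> w x" for v w x
    by (rule elliptic_sol_mono[OF d \<Lambda> _ T[OF that(1)] T[OF that(2)]]) (use that X fmono in auto)
  define Y where "Y = {v \<in> X. \<forall>J. bdd_nonneg_subsol d g a J \<longrightarrow> (\<forall>x. J x \<le> v x)}"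
  have TY: "T v \<in> Y" if v: "v \<in> Y" for v
  proof -
    have vX: "v \<in> X" using v by (simp add: Y_def)
    have "J x \<le> T v x" if J: "bdd_nonneg_subsol d g a J" for J x
    proof -
      have Jf: "C2 J" "bounded (range J)" "\<And>x. J x \<ge> 0" "\<And>x. - d * lap J x \<le> g x * J x - a x * (J x)\<^sup>2"
        using J by (auto simp: bdd_nonneg_subsol_def)
      show ?thesis
      proof (rule elliptic_comparison[OF d C2_axis_diff2 C2_continuous _ C2_periodic_facts[OF TC(1,2)[OF vX]] \<Lambda>, where q="\<lambda>x. \<Lambda>"])
        fix x
        have "J x \<le> v x" using v J by (simp add: Y_def)
        then have "f J x \<le> f v x" using fmono[of J x v] Jf(3)[of x] X(3)[OF vX, of x] by simp
        moreover have "- d * lap J x + \<Lambda> * J x \<le> f J x"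
          using Jf(4)[of x] by (simp add: f_def power2_eq_square algebra_simps)
        ultimately show "- d * lap J x + \<Lambda> * J x \<le> - d * lap (T v) x + \<Lambda> * T v x"
          using TC(3)[OF vX, of x] by simp
      qed (use Jf in auto)
    qed
    then show ?thesis using TX[OF vX] by (simp add: Y_def)
  qed
  define Z where "Z = {v \<in> Y. \<forall>x. T v x \<le> v x}"
  have ZX: "v \<in> X" if "v \<in> Z" for v using that by (simp add: Z_def Y_def)
  have MX: "(\<lambda>x. M) \<in> X" using M L0 by (simp add: X_def lip_between_def per_lip_const)
  then have "(\<lambda>x. M) \<in> Z"
    using J_le_M X(3)[OF TX[OF MX]] by (simp add: Z_def Y_def)
  then have Zne: "Z \<noteq> {}" by blast
  define u where "u = (\<lambda>x. INF v\<in>Z. v x)"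
  have bdd: "bdd_below ((\<lambda>v. v x) ` Z)" for x using X(2)[OF ZX] by (intro bdd_belowI[of _ 0]) auto
  have u_le: "u x \<le> v x" if "v \<in> Z" for v x unfolding u_def by (rule cINF_lower[OF bdd that])
  have u_ge: "k \<le> u x" if "\<And>v. v \<in> Z \<Longrightarrow> k \<le> v x" for k x
    unfolding u_def by (rule cINF_greatest[OF Zne that])
  have uX: "u \<in> X"
  proof -
    have "per_lip L u" unfolding u_def by (rule per_lip_Inf[OF Zne, where b=0]) (use X ZX in auto)
    moreover have "u x \<le> M" for x using u_le[OF \<open>(\<lambda>x. M) \<in> Z\<close>] .
    moreover have "0 \<le> u x" for x by (rule u_ge) (rule X(2)[OF ZX])
    ultimately show ?thesis by (simp add: X_def lip_between_def)
  qed
  have uY: "u \<in> Y"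
    using uX u_ge by (auto simp: Y_def Z_def)
  have Tu: "T u x \<le> u x" for x
  proof (rule u_ge)
    fix v assume v: "v \<in> Z"
    have "T u x \<le> T v x" by (rule T_mono[OF uX ZX[OF v] u_le[OF v]])
    also have "\<dots> \<le> v x" using v by (simp add: Z_def)
    finally show "T u x \<le> v x" .
  qed
  have "T u \<in> Z" unfolding Z_def using TY[OF uY] T_mono[OF TX[OF uX] uX Tu] by simp
  then have "u x \<le> T u x" for x by (rule u_le)
  then have fix_u: "T u = u" using Tu by (intro ext antisym)
  have uC: "C2 u" "periodic1 u" "\<And>x. - d * lap u x + \<Lambda> * u x = f u x"
    using TC[OF uX] by (simp_all add: fix_u)
  have "- d * lap u x = g x * u x - a x * (u x)\<^sup>2" for x
    using uC(3)[of x] by (simp add: f_def power2_eq_square algebra_simps)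
  then have "bdd_nonneg_sol d g a u"
    using uC(1) C2_periodic_facts(3)[OF uC(1,2)] X(2)[OF uX] by (simp add: bdd_nonneg_sol_def)
  then show ?thesis using uC(2) uY by (auto simp: Y_def)
qed

lemma Ibar_properties:
  assumes "d > 0" "0 < \<delta>" "\<delta> < 1" "g \<in> Cper \<delta>" "a \<in> Cper \<delta>" "\<And>x. a x > 0"
  shows "bdd_nonneg_sol d g a (Ibar d g a)" "periodic1 (Ibar d g a)"
    "\<And>J x. bdd_nonneg_subsol d g a J \<Longrightarrow> J x \<le> Ibar d g a x"
proof -
  obtain I where I: "bdd_nonneg_sol d g a I" "periodic1 I" "\<And>J x. bdd_nonneg_subsol d g a J \<Longrightarrow> J x \<le> I x"
    using greatest_solution_exists[OF assms] by blast
  have sub: "bdd_nonneg_subsol d g a J" if "bdd_nonneg_sol d g a J" for J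
    using that by (simp add: bdd_nonneg_sol_def bdd_nonneg_subsol_def)
  have "Ibar d g a = I"
    unfolding Ibar_def
  proof (rule the_equality)
    show "bdd_nonneg_sol d g a I \<and> (\<forall>J. bdd_nonneg_sol d g a J \<longrightarrow> (\<forall>x. J x \<le> I x))"
      using I sub by blast
    show "I' = I" if "bdd_nonneg_sol d g a I' \<and> (\<forall>J. bdd_nonneg_sol d g a J \<longrightarrow> (\<forall>x. J x \<le> I' x))" for I'
      using that I sub by (intro ext antisym) auto
  qed
  then show "bdd_nonneg_sol d g a (Ibar d g a)" "periodic1 (Ibar d g a)"
    "\<And>J x. bdd_nonneg_subsol d g a J \<Longrightarrow> J x \<le> Ibar d g a x"
    using I by simp_all
qed

lemma elliptic_sol_pos:
  fixes u :: "real^'n \<Rightarrow> real"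
  assumes d: "d > 0" and \<delta>: "\<delta> > 0" and q: "q \<in> Cper \<delta>" "\<And>x. q x > 0" and f: "f \<in> Cper \<delta>" "\<And>x. f x > 0"
    and u: "elliptic_sol d q f u"
  shows "u x > 0"
proof -
  obtain q0 where q0: "q0 > 0" "\<And>x. q0 \<le> q x" using Cper_lower_bound[OF q(1) \<delta> q(2)] by blast
  obtain f0 where f0: "f0 > 0" "\<And>x. f0 \<le> f x" using Cper_lower_bound[OF f(1) \<delta> f(2)] by blast
  obtain Q where Q: "Q > 0" "\<And>x. \<bar>q x\<bar> \<le> Q" using Cper_bounded[OF q(1) \<delta>] by auto
  have u': "C2 u" "periodic1 u" "\<And>x. - d * lap u x + q x * u x = f x" using u by (auto simp: elliptic_sol_def)
  have "f0 / Q \<le> u x"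
  proof (rule elliptic_comparison[OF d _ _ _ C2_periodic_facts[OF u'(1,2)] q0, where u="\<lambda>x. f0 / Q"])
    fix x
    have "q x * (f0 / Q) \<le> Q * (f0 / Q)" using Q(1) Q(2)[of x] f0 by (intro mult_right_mono) auto
    also have "\<dots> \<le> f x" using Q f0 by simp
    finally show "- d * lap (\<lambda>x. f0 / Q) x + q x * (f0 / Q) \<le> - d * lap u x + q x * u x"
      using u'(3)[of x] by (simp add: lap_const)
  qed (auto simp: axis_diff2_const)
  then show ?thesis using f0 Q by (smt (verit) divide_pos_pos)
qed

theorem mainTheorem3:
  fixes d \<delta> :: real and \<alpha> \<mu> lam \<gamma> :: "real^'n \<Rightarrow> real"
  assumes "d > 0" and "0 < \<delta>" and "\<delta> < 1"
    and "\<alpha> \<in> Cper \<delta>" and "\<mu> \<in> Cper \<delta>" and "lam \<in> Cper \<delta>" and "\<gamma> \<in> Cper \<delta>"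
    and "\<forall>x. \<alpha> x > 0" and "\<forall>x. \<mu> x > 0" and "\<forall>x. lam x > 0"
    and A1: "princ_eig d \<gamma> < 0"
    and A2: "princ_eig d (\<lambda>x. \<gamma> x - \<alpha> x * Rbar d \<gamma> \<alpha> lam \<mu> x) < 0"
  shows "\<exists>I R. I \<in> Cper \<delta> \<and> R \<in> Cper \<delta> \<and> C2 I \<and> C2 R \<and>
     (\<forall>x. I x > 0) \<and> (\<forall>x. R x > 0) \<and>
     (\<forall>x. - d * lap I x - \<gamma> x * I x + \<alpha> x * (I x)^2 + \<alpha> x * I x * R x = 0) \<and>
     (\<forall>x. - d * lap R x + lam x * R x - \<mu> x * I x = 0)"
proof -
  note d = assms(1) and \<delta> = assms(2,3)
  note \<alpha> = assms(4) and \<mu> = assms(5) and lam = assms(6) and \<gamma> = assms(7)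
  have \<alpha>p: "\<alpha> x > 0" and \<mu>p: "\<mu> x > 0" and lp: "lam x > 0" for x using assms(8-10) by auto
  define Ib where "Ib = Ibar d \<gamma> \<alpha>"
  have Ib: "bdd_nonneg_sol d \<gamma> \<alpha> Ib" "periodic1 Ib" "\<And>J x. bdd_nonneg_subsol d \<gamma> \<alpha> J \<Longrightarrow> J x \<le> Ib x"
    unfolding Ib_def using Ibar_properties[OF d \<delta> \<gamma> \<alpha> \<alpha>p] by blast+
  have IbC: "C2 Ib" "\<And>x. Ib x \<ge> 0" "\<And>x. - d * lap Ib x = \<gamma> x * Ib x - \<alpha> x * (Ib x)\<^sup>2"
    using Ib(1) by (auto simp: bdd_nonneg_sol_def)
  obtain l0 where l0: "l0 > 0" "\<And>x. l0 \<le> lam x" using Cper_lower_bound[OF lam \<delta>(1) lp] by blast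
  have Ib_hol: "Ib \<in> Cper \<delta>" by (rule C2_periodic_Cper[OF IbC(1) Ib(2) \<delta>])
  obtain Rb where Rb: "elliptic_sol d lam (\<lambda>x. \<mu> x * Ib x) Rb"
    using elliptic_sol_exists[OF d lam lp Cper_mult[OF \<mu> Ib_hol \<delta>(1)] \<delta>] by blast
  have Rbar_eq: "Rbar d \<gamma> \<alpha> lam \<mu> = Rb"
    unfolding Rbar_def Ib_def[symmetric]
  proof (rule the_equality)
    show "C2 Rb \<and> periodic1 Rb \<and> (\<forall>x. - d * lap Rb x + lam x * Rb x = \<mu> x * Ib x)"
      using Rb by (simp add: elliptic_sol_def)
    show "R = Rb" if "C2 R \<and> periodic1 R \<and> (\<forall>x. - d * lap R x + lam x * R x = \<mu> x * Ib x)" for R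
      by (rule elliptic_sol_unique[OF d l0 _ Rb]) (use that in \<open>simp add: elliptic_sol_def\<close>)
  qed
  have Rb0: "Rb x \<ge> 0" for x
    by (rule elliptic_sol_nonneg[OF d l0 Rb]) (simp add: IbC(2) less_imp_le[OF \<mu>p])
  have Rb_hol: "Rb \<in> Cper \<delta>" using Rb C2_periodic_Cper \<delta> by (auto simp: elliptic_sol_def)
  define c where "c = (\<lambda>x. \<gamma> x - \<alpha> x * Rb x)"
  define l where "l = princ_eig d c"
  have l: "l < 0" using A2 by (simp add: l_def c_def Rbar_eq)
  have "c \<in> Cper \<delta>" unfolding c_def by (intro Cper_diff Cper_mult \<gamma> \<alpha> Rb_hol \<delta>)
  then obtain \<phi> where "eigenpair d c l \<phi>" using princ_eig_eigenpair[OF d \<delta>] l_def by blast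
  then have \<phi>: "C2 \<phi>" "periodic1 \<phi>" "\<And>x. \<phi> x > 0" "\<And>x. - d * lap \<phi> x - c x * \<phi> x = l * \<phi> x"
    by (auto simp: eigenpair_def)
  obtain P where P: "P > 0" "\<And>x. \<bar>\<phi> x\<bar> \<le> P" using periodic_bounded[OF \<phi>(2) C2_continuous[OF \<phi>(1)]] by blast
  obtain A where A: "A > 0" "\<And>x. \<bar>\<alpha> x\<bar> \<le> A" using Cper_bounded[OF \<alpha> \<delta>(1)] by auto
  obtain G where G: "G > 0" "\<And>x. \<bar>\<gamma> x\<bar> \<le> G" using Cper_bounded[OF \<gamma> \<delta>(1)] by auto
  obtain U where U: "U > 0" "\<And>x. \<bar>\<mu> x\<bar> \<le> U" using Cper_bounded[OF \<mu> \<delta>(1)] by auto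
  obtain M where M: "M > 0" "\<And>x. \<bar>Ib x\<bar> \<le> M" using Cper_bounded[OF Ib_hol \<delta>(1)] by auto
  obtain S where S: "S > 0" "\<And>x. \<bar>Rb x\<bar> \<le> S" using Cper_bounded[OF Rb_hol \<delta>(1)] by auto
  define \<epsilon> where "\<epsilon> = - l / (A * P)"
  have \<epsilon>: "\<epsilon> > 0" unfolding \<epsilon>_def using l A P by (intro divide_pos_pos mult_pos_pos) auto
  define lo where "lo = (\<lambda>x. \<epsilon> * \<phi> x)"
  have lo_pos: "lo x > 0" for x using \<epsilon> \<phi>(3) by (simp add: lo_def)
  have lo_C: "C2 lo" "periodic1 lo"
    using C2_cmult[OF \<phi>(1)] \<phi>(2) by (auto simp: lo_def periodic1_def)
  have lo_sub: "- d * lap lo x \<le> (c x - \<alpha> x * lo x) * lo x" for x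
  proof -
    have "\<alpha> x * lo x \<le> A * (\<epsilon> * P)"
      unfolding lo_def using A(2)[of x] P(2)[of x] \<alpha>p[of x] \<phi>(3)[of x] \<epsilon> A
      by (intro mult_mono) auto
    also have "\<dots> = - l" using A P by (simp add: \<epsilon>_def)
    finally have "l \<le> - (\<alpha> x * lo x)" by simp
    then have "(c x + l) * lo x \<le> (c x - \<alpha> x * lo x) * lo x"
      using lo_pos[of x] by (intro mult_right_mono) auto
    moreover have "- d * lap lo x = (c x + l) * lo x"
    proof -
      have "- d * lap \<phi> x = (c x + l) * \<phi> x" using \<phi>(4)[of x] by (simp add: algebra_simps)
      then have "\<epsilon> * (- d * lap \<phi> x) = \<epsilon> * ((c x + l) * \<phi> x)" by simp
      then show ?thesis unfolding lo_def lap_cmult[OF C2_axis_diff2[OF \<phi>(1)]] by (simp add: mult_ac)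
    qed
    ultimately show ?thesis by simp
  qed
  have "bdd_nonneg_subsol d \<gamma> \<alpha> lo"
    unfolding bdd_nonneg_subsol_def
  proof (intro conjI allI)
    show "- d * lap lo x \<le> \<gamma> x * lo x - \<alpha> x * (lo x)\<^sup>2" for x
    proof -
      have "\<alpha> x * Rb x * lo x \<ge> 0" using \<alpha>p[of x] Rb0[of x] lo_pos[of x] by simp
      then show ?thesis using lo_sub[of x] by (simp add: c_def power2_eq_square algebra_simps)
    qed
  qed (use lo_C C2_periodic_facts lo_pos in \<open>auto intro: less_imp_le\<close>)
  then have lo_Ib: "lo x \<le> Ib x" for x by (rule Ib(3))
  define \<Lambda> where "\<Lambda> = G + A * S + 2 * A * M"
  have prods: "A * S > 0" "A * M > 0" "U * M > 0" using A S M U by auto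
  have \<Lambda>: "\<Lambda> > 0" using G prods by (simp add: \<Lambda>_def)
  have mono: "0 \<le> \<Lambda> + (\<gamma> x - \<alpha> x * t) - 2 * \<alpha> x * M" if "0 \<le> t" "t \<le> S" for x t
  proof -
    have "\<alpha> x * t \<le> A * S" using A(2)[of x] \<alpha>p[of x] that A by (intro mult_mono) auto
    moreover have "\<alpha> x * M \<le> A * M" using A(2)[of x] M by (intro mult_right_mono) auto
    moreover have "- G \<le> \<gamma> x" using G(2)[of x] by simp
    ultimately show ?thesis by (simp add: \<Lambda>_def)
  qed
  define K where "K u = (SOME v. elliptic_sol d lam (\<lambda>x. \<mu> x * u x) v)" for u
  define f where "f u = (\<lambda>x. (\<Lambda> + (\<gamma> x - \<alpha> x * K u x) - \<alpha> x * u x) * u x)" for u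
  define T where "T u = (SOME v. elliptic_sol d (\<lambda>x. \<Lambda>) (f u) v)" for u
  define B where "B = (\<Lambda> + G) * M"
  obtain L1 where L1: "L1 \<ge> 0" "per_lip L1 lo" using C2_periodic_per_lip[OF lo_C] by blast
  obtain L2 where L2: "L2 \<ge> 0" "per_lip L2 Ib" using C2_periodic_per_lip[OF IbC(1) Ib(2)] by blast
  define L where "L = max (lip_const d \<Lambda> \<Lambda> B) (max L1 L2)"
  have L0: "L \<ge> 0" using L1 by (simp add: L_def le_max_iff_disj)
  have lips: "per_lip L lo" "per_lip L Ib"
    using per_lip_mono[OF L1(2), of L] per_lip_mono[OF L2(2), of L] by (auto simp: L_def)
  define X where "X = lip_between L lo Ib"
  have X: "per_lip L u" "lo x \<le> u x" "u x \<le> Ib x" "0 < u x" "u x \<le> M" if "u \<in> X" for u x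
    using that lo_pos[of x] M(2)[of x] by (auto simp: X_def lip_between_def abs_le_iff intro: less_le_trans order_trans)
  have XC: "u \<in> Cper \<delta>" if "u \<in> X" for u using X(1)[OF that] L0 by (intro per_lip_Cper[OF _ _ \<delta>])
  have K: "elliptic_sol d lam (\<lambda>x. \<mu> x * u x) (K u)" if "u \<in> X" for u
    using elliptic_sol_exists[OF d lam lp Cper_mult[OF \<mu> XC[OF that] \<delta>(1)] \<delta>] unfolding K_def by (rule someI_ex)
  have KC: "K u \<in> Cper \<delta>" if "u \<in> X" for u using K[OF that] C2_periodic_Cper \<delta> by (auto simp: elliptic_sol_def)
  have K0: "0 \<le> K u x" if "u \<in> X" for u x
    by (rule elliptic_sol_nonneg[OF d l0 K[OF that]]) (simp add: less_imp_le[OF X(4)[OF that]] less_imp_le[OF \<mu>p])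
  have KR: "K u x \<le> Rb x" if "u \<in> X" for u x
    by (rule elliptic_sol_mono[OF d l0 K[OF that] Rb]) (simp add: mult_left_mono[OF X(3)[OF that]] less_imp_le[OF \<mu>p])
  have KS: "K u x \<le> S" if "u \<in> X" for u x using KR[OF that, of x] S(2)[of x] by simp
  have T: "elliptic_sol d (\<lambda>x. \<Lambda>) (f u) (T u)" if "u \<in> X" for u
  proof -
    have "f u \<in> Cper \<delta>" unfolding f_def
      by (intro Cper_add Cper_mult Cper_diff Cper_const \<gamma> \<alpha> \<delta> XC[OF that] KC[OF that])
    from elliptic_sol_const_exists[OF d \<Lambda> this \<delta>] show ?thesis unfolding T_def by (rule someI_ex)
  qed
  have TC: "C2 (T u)" "periodic1 (T u)" "\<And>x. - d * lap (T u) x + \<Lambda> * T u x = f u x" if "u \<in> X" for u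
    using T[OF that] by (auto simp: elliptic_sol_def)
  have f_upper: "f u x \<le> (\<Lambda> + \<gamma> x - \<alpha> x * Ib x) * Ib x" if u: "u \<in> X" for u x
  proof -
    have "\<alpha> x * K u x * u x \<ge> 0" using \<alpha>p[of x] K0[OF u, of x] X(4)[OF u, of x] by simp
    then have "f u x \<le> (\<Lambda> + \<gamma> x - \<alpha> x * u x) * u x" unfolding f_def by (simp add: algebra_simps)
    also have "\<dots> \<le> (\<Lambda> + \<gamma> x - \<alpha> x * Ib x) * Ib x"
      using X(2-5)[OF u, of x] M(2)[of x] \<alpha>p[of x] mono[of 0 x] S(1) by (intro logistic_mono[where M=M]) auto
    finally show ?thesis .
  qed
  have f_lower: "(\<Lambda> + c x - \<alpha> x * lo x) * lo x \<le> f u x" if u: "u \<in> X" for u x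
  proof -
    have "(\<Lambda> + (\<gamma> x - \<alpha> x * Rb x) - \<alpha> x * lo x) * lo x \<le> (\<Lambda> + (\<gamma> x - \<alpha> x * Rb x) - \<alpha> x * u x) * u x"
      using X(2-5)[OF u, of x] lo_pos[of x] \<alpha>p[of x] mono[of "Rb x" x] Rb0[of x] S(2)[of x]
      by (intro logistic_mono[where M=M]) auto
    also have "\<dots> \<le> f u x"
    proof -
      have "\<alpha> x * K u x \<le> \<alpha> x * Rb x" using KR[OF u, of x] \<alpha>p[of x] by (intro mult_left_mono) auto
      then show ?thesis unfolding f_def using X(4)[OF u, of x] by (intro mult_right_mono) auto
    qed
    finally show ?thesis by (simp add: c_def)
  qed
  have f_abs: "\<bar>f u x\<bar> \<le> B" if u: "u \<in> X" for u x
  proof -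
    have "0 \<le> \<Lambda> + (\<gamma> x - \<alpha> x * K u x) - \<alpha> x * u x"
    proof -
      have "\<alpha> x * u x \<le> 2 * \<alpha> x * M" using X(4,5)[OF u, of x] \<alpha>p[of x] by (intro mult_mono) auto
      then show ?thesis using mono[OF K0[OF u] KS[OF u], of x x] by linarith
    qed
    moreover have "\<Lambda> + (\<gamma> x - \<alpha> x * K u x) - \<alpha> x * u x \<le> \<Lambda> + G"
    proof -
      have "0 \<le> \<alpha> x * K u x" "0 \<le> \<alpha> x * u x" using \<alpha>p[of x] K0[OF u, of x] X(4)[OF u, of x] by auto
      then show ?thesis using G(2)[of x] by linarith
    qed
    ultimately show ?thesis unfolding f_def B_def abs_mult
      using X(4,5)[OF u, of x] by (intro mult_mono) auto
  qed
  have f_diff: "\<bar>f u x - f v x\<bar> \<le> (\<Lambda> + G + A * S + A * M * U / l0 + 2 * A * M) * e"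
    if u: "u \<in> X" and v: "v \<in> X" and e: "\<And>x. \<bar>u x - v x\<bar> \<le> e" for u v e x
  proof -
    have e0: "e \<ge> 0" using e[of 0] by simp
    have "\<bar>\<mu> y * u y - \<mu> y * v y\<bar> \<le> U * e" for y
      unfolding right_diff_distrib[symmetric] abs_mult using U(2)[of y] e[of y] U(1) by (intro mult_mono) auto
    from elliptic_sol_diff[OF d l0 K[OF u] K[OF v] this, of x]
    have Ke: "\<bar>K u x - K v x\<bar> \<le> U * e / l0" .
    have "f u x - f v x = (\<Lambda> + \<gamma> x) * (u x - v x) - \<alpha> x * K u x * (u x - v x)
        - \<alpha> x * v x * (K u x - K v x) - \<alpha> x * (u x + v x) * (u x - v x)"
      by (simp add: f_def algebra_simps)
    moreover have "\<bar>(\<Lambda> + \<gamma> x) * (u x - v x)\<bar> \<le> (\<Lambda> + G) * e"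
      unfolding abs_mult using G(2)[of x] \<Lambda> e[of x] by (intro mult_mono) auto
    moreover have "\<bar>\<alpha> x * K u x * (u x - v x)\<bar> \<le> A * S * e"
      unfolding abs_mult using A S KS[OF u, of x] K0[OF u, of x] e[of x] by (intro mult_mono) auto
    moreover have "\<bar>\<alpha> x * v x * (K u x - K v x)\<bar> \<le> A * M * (U * e / l0)"
      unfolding abs_mult using A M X(4,5)[OF v, of x] Ke by (intro mult_mono) auto
    moreover have "\<bar>\<alpha> x * (u x + v x) * (u x - v x)\<bar> \<le> A * (2 * M) * e"
      unfolding abs_mult using A M X(4,5)[OF u, of x] X(4,5)[OF v, of x] e[of x] by (intro mult_mono) auto
    ultimately have "\<bar>f u x - f v x\<bar> \<le> (\<Lambda> + G) * e + A * S * e + A * M * (U * e / l0) + A * (2 * M) * e"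
      by linarith
    also have "\<dots> = (\<Lambda> + G + A * S + A * M * U / l0 + 2 * A * M) * e" by (simp add: algebra_simps)
    finally show ?thesis .
  qed
  define C where "C = (\<Lambda> + G + A * S + A * M * U / l0 + 2 * A * M) / \<Lambda>"
  have "A * M * U / l0 > 0" using A M U l0 by simp
  then have C0: "C \<ge> 0" using \<Lambda> G prods by (simp add: C_def)
  obtain I where I: "I \<in> X" "T I = I"
    unfolding X_def
  proof (rule lip_between_fixed_point[OF L0 lips lo_Ib _ C0, where T=T])
    show "T u \<in> lip_between L lo Ib" if "u \<in> lip_between L lo Ib" for u
    proof -
      have u: "u \<in> X" using that by (simp add: X_def)
      note Tf = C2_periodic_facts[OF TC(1,2)[OF u]]
      have "per_lip (lip_const d \<Lambda> \<Lambda> B) (T u)"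
        by (rule elliptic_sol_per_lip(1)[OF d \<Lambda> _ _ T[OF u] f_abs[OF u]]) auto
      then have "per_lip L (T u)" by (rule per_lip_mono) (simp add: L_def)
      moreover have "T u x \<le> Ib x" for x
      proof (rule elliptic_comparison[OF d Tf C2_periodic_facts[OF IbC(1) Ib(2)] \<Lambda>, where q="\<lambda>x. \<Lambda>"])
        show "- d * lap (T u) x + \<Lambda> * T u x \<le> - d * lap Ib x + \<Lambda> * Ib x" for x
          unfolding TC(3)[OF u] IbC(3) using f_upper[OF u, of x] by (simp add: power2_eq_square algebra_simps)
      qed simp
      moreover have "lo x \<le> T u x" for x
      proof (rule elliptic_comparison[OF d C2_periodic_facts[OF lo_C] Tf \<Lambda>, where q="\<lambda>x. \<Lambda>"])
        show "- d * lap lo x + \<Lambda> * lo x \<le> - d * lap (T u) x + \<Lambda> * T u x" for x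
          unfolding TC(3)[OF u] using f_lower[OF u, of x] lo_sub[of x] by (simp add: algebra_simps)
      qed simp
      ultimately show ?thesis by (simp add: lip_between_def)
    qed
    show "\<bar>T u x - T v x\<bar> \<le> C * e"
      if "u \<in> lip_between L lo Ib" "v \<in> lip_between L lo Ib" "\<And>x. \<bar>u x - v x\<bar> \<le> e" for u v e x
    proof -
      have uv: "u \<in> X" "v \<in> X" using that by (auto simp: X_def)
      have "\<bar>T u x - T v x\<bar> \<le> (\<Lambda> + G + A * S + A * M * U / l0 + 2 * A * M) * e / \<Lambda>"
        by (rule elliptic_sol_diff[OF d \<Lambda> _ T[OF uv(1)] T[OF uv(2)] f_diff[OF uv that(3)]]) simp
      then show ?thesis by (simp add: C_def)
    qed
  qed
  define R where "R = K I"
  have R: "elliptic_sol d lam (\<lambda>x. \<mu> x * I x) R" unfolding R_def by (rule K[OF I(1)])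
  have IC: "C2 I" "\<And>x. - d * lap I x + \<Lambda> * I x = f I x" using TC[OF I(1)] by (simp_all add: I(2))
  show ?thesis
  proof (intro exI conjI allI)
    show "I \<in> Cper \<delta>" "R \<in> Cper \<delta>" unfolding R_def by (rule XC[OF I(1)], rule KC[OF I(1)])
    show "C2 I" by (rule IC)
    show "C2 R" using R by (simp add: elliptic_sol_def)
    show Ipos: "I x > 0" for x by (rule X(4)[OF I(1)])
    show "R x > 0" for x
      by (rule elliptic_sol_pos[OF d \<delta>(1) lam lp Cper_mult[OF \<mu> XC[OF I(1)] \<delta>(1)] _ R])
        (use \<mu>p Ipos in simp)
    show "- d * lap I x - \<gamma> x * I x + \<alpha> x * (I x)^2 + \<alpha> x * I x * R x = 0" for x
      using IC(2)[of x] by (simp add: f_def R_def power2_eq_square algebra_simps)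
    show "- d * lap R x + lam x * R x - \<mu> x * I x = 0" for x
      using R by (simp add: elliptic_sol_def)
  qed
qed

end
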